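(* Let $\Omega$ be a bounded open set in $\mathbb{R}^N$, let $p\in[1,N]$, and let $\varphi\in W^{1,p}(\mathbb{R}^N)\cap L^\infty(\mathbb{R}^N)$. Let $H:\mathbb{R}\times\mathbb{R}^N\to\mathbb{R}$ be continuous. Then the functional $\mathcal{L}(u)=\int_\Omega H(u(x),\nabla u(x))\,dx$ is $L^\infty(\Omega)$-regular at every $u\in\mathcal{A}$; that is, for every $u\in\mathcal{A}$ there exists a sequence $(u_k)_{k\geq 1}\subset\mathcal{A}\cap L^\infty(\Omega)$ such that $u_k\to u$ in $W^{1,p}(\Omega)$ and $H(u_k,\nabla u_k)\to H(u,\nabla u)$ in $L^1(\Omega)$ as $k\to+\infty$.
   Context: Functions are real-valued. $W^{1,p}_0(\Omega)$ denotes the closure in $W^{1,p}(\Omega)$ of the smooth functions with compact support in $\Omega$, and $W^{1,p}_\varphi(\Omega):=\varphi+W^{1,p}_0(\Omega)$. The admissible class is $$\mathcal{A}:=\left\{u\in W^{1,p}_\varphi(\Omega): H(u,\nabla u)\in L^1(\Omega)\right\},$$ where $H(u,\nabla u)$ denotes the function $x\mapsto H(u(x),\nabla u(x))$. The functional $\mathcal{L}$ is well-defined on $\mathcal{A}$. Definition: $\mathcal{L}$ is $L^\infty(\Omega)$-regular at $u\in\mathcal{A}$ when there exists a sequence $(u_k)_k\subset\mathcal{A}\cap L^\infty(\Omega)$ converging to $u$ in $W^{1,p}(\Omega)$ and such that $(H(u_k,\nabla u_k))_{k\ge1}$ converges to $H(u,\nabla u)$ in $L^1(\Omega)$. *)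

theory Defs
  imports "HOL-Analysis.Analysis"
begin

primrec C_k :: "nat \<Rightarrow> (real^'n \<Rightarrow> real) \<Rightarrow> bool" where
  "C_k 0 f \<longleftrightarrow> continuous_on UNIV f"
| "C_k (Suc k) f \<longleftrightarrow>
     (\<forall>x. f differentiable (at x)) \<and> (\<forall>v. C_k k (\<lambda>x. frechet_derivative f (at x) v))"

(* A smooth function with compact support in the open set \<Omega> extends by zero to a smooth
   function on the whole space, so it is represented by that extension. *)
definition test_functions :: "(real^'n) set \<Rightarrow> (real^'n \<Rightarrow> real) set" where
  "test_functions \<Omega> =
     {\<psi>. (\<forall>k. C_k k \<psi>) \<and> compact (closure {x. \<psi> x \<noteq> 0}) \<and> closure {x. \<psi> x \<noteq> 0} \<subseteq> \<Omega>}"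

(* Elements of the function spaces below are represented by functions on all of R^N of which
   only the restriction to \<Omega>, up to null sets, matters; membership and norms are invariant
   under change of representative. *)
definition Lp :: "real \<Rightarrow> (real^'n) set \<Rightarrow> (real^'n \<Rightarrow> 'b::euclidean_space) set" where
  "Lp p \<Omega> = {f \<in> borel_measurable (lebesgue_on \<Omega>).
               integrable (lebesgue_on \<Omega>) (\<lambda>x. norm (f x) powr p)}"

definition Linf :: "(real^'n) set \<Rightarrow> (real^'n \<Rightarrow> real) set" where
  "Linf \<Omega> = {f \<in> borel_measurable (lebesgue_on \<Omega>). \<exists>C. AE x in lebesgue_on \<Omega>. \<bar>f x\<bar> \<le> C}"

definition L1_tendsto ::
    "(real^'n) set \<Rightarrow> (nat \<Rightarrow> real^'n \<Rightarrow> real) \<Rightarrow> (real^'n \<Rightarrow> real) \<Rightarrow> bool" where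
  "L1_tendsto \<Omega> f g \<longleftrightarrow>
     (\<forall>k. integrable (lebesgue_on \<Omega>) (f k)) \<and> integrable (lebesgue_on \<Omega>) g \<and>
     (\<lambda>k. LINT x|lebesgue_on \<Omega>. \<bar>f k x - g x\<bar>) \<longlonglongrightarrow> 0"

definition locally_integrable ::
    "(real^'n) set \<Rightarrow> (real^'n \<Rightarrow> 'b::euclidean_space) \<Rightarrow> bool" where
  "locally_integrable \<Omega> f \<longleftrightarrow> (\<forall>K. compact K \<and> K \<subseteq> \<Omega> \<longrightarrow> f absolutely_integrable_on K)"

definition has_weak_gradient ::
    "(real^'n) set \<Rightarrow> (real^'n \<Rightarrow> real) \<Rightarrow> (real^'n \<Rightarrow> real^'n) \<Rightarrow> bool" where
  "has_weak_gradient \<Omega> u g \<longleftrightarrow>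
     locally_integrable \<Omega> u \<and> locally_integrable \<Omega> g \<and>
     (\<forall>\<psi> \<in> test_functions \<Omega>. \<forall>i.
        (LINT x|lebesgue_on \<Omega>. u x * frechet_derivative \<psi> (at x) (axis i 1)) =
        - (LINT x|lebesgue_on \<Omega>. g x $ i * \<psi> x))"

(* For open \<Omega> the weak gradient is unique up to a null set; weak_grad selects a
   representative. It is meaningful only for u that possess a weak gradient on \<Omega>. *)
definition weak_grad :: "(real^'n) set \<Rightarrow> (real^'n \<Rightarrow> real) \<Rightarrow> real^'n \<Rightarrow> real^'n" where
  "weak_grad \<Omega> u = (SOME g. has_weak_gradient \<Omega> u g)"

definition W1p :: "real \<Rightarrow> (real^'n) set \<Rightarrow> (real^'n \<Rightarrow> real) set" where
  "W1p p \<Omega> = {u \<in> Lp p \<Omega>. \<exists>g \<in> Lp p \<Omega>. has_weak_gradient \<Omega> u g}"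

definition W1p_norm :: "real \<Rightarrow> (real^'n) set \<Rightarrow> (real^'n \<Rightarrow> real) \<Rightarrow> real" where
  "W1p_norm p \<Omega> u =
     ((LINT x|lebesgue_on \<Omega>. \<bar>u x\<bar> powr p) +
      (LINT x|lebesgue_on \<Omega>. norm (weak_grad \<Omega> u x) powr p)) powr (1 / p)"

definition W1p_tendsto ::
    "real \<Rightarrow> (real^'n) set \<Rightarrow> (nat \<Rightarrow> real^'n \<Rightarrow> real) \<Rightarrow> (real^'n \<Rightarrow> real) \<Rightarrow> bool" where
  "W1p_tendsto p \<Omega> u v \<longleftrightarrow>
     (\<forall>k. u k \<in> W1p p \<Omega>) \<and> v \<in> W1p p \<Omega> \<and>
     (\<lambda>k. W1p_norm p \<Omega> (\<lambda>x. u k x - v x)) \<longlonglongrightarrow> 0"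

definition W1p_0 :: "real \<Rightarrow> (real^'n) set \<Rightarrow> (real^'n \<Rightarrow> real) set" where
  "W1p_0 p \<Omega> =
     {v \<in> W1p p \<Omega>. \<forall>e>0. \<exists>\<psi> \<in> test_functions \<Omega>. W1p_norm p \<Omega> (\<lambda>x. v x - \<psi> x) < e}"

definition W1p_bdry ::
    "real \<Rightarrow> (real^'n) set \<Rightarrow> (real^'n \<Rightarrow> real) \<Rightarrow> (real^'n \<Rightarrow> real) set" where
  "W1p_bdry p \<Omega> \<phi> = {(\<lambda>x. \<phi> x + v x) | v. v \<in> W1p_0 p \<Omega>}"

definition lagrangian_along ::
    "(real^'n) set \<Rightarrow> (real \<times> (real^'n) \<Rightarrow> real) \<Rightarrow> (real^'n \<Rightarrow> real) \<Rightarrow> real^'n \<Rightarrow> real" where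
  "lagrangian_along \<Omega> H u = (\<lambda>x. H (u x, weak_grad \<Omega> u x))"

definition admissible ::
    "real \<Rightarrow> (real^'n) set \<Rightarrow> (real^'n \<Rightarrow> real) \<Rightarrow> (real \<times> (real^'n) \<Rightarrow> real)
      \<Rightarrow> (real^'n \<Rightarrow> real) set" where
  "admissible p \<Omega> \<phi> H =
     {u \<in> W1p_bdry p \<Omega> \<phi>. integrable (lebesgue_on \<Omega>) (lagrangian_along \<Omega> H u)}"

(* Regularity at u of the functional u \<mapsto> (LINT x|lebesgue_on \<Omega>. H (u x, weak_grad \<Omega> u x)) on
   the admissible class. The notion refers to the functional only through its integrand H, so
   it is parametrized by H. *)
definition Linf_regular_at ::
    "real \<Rightarrow> (real^'n) set \<Rightarrow> (real^'n \<Rightarrow> real) \<Rightarrow> (real \<times> (real^'n) \<Rightarrow> real)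
      \<Rightarrow> (real^'n \<Rightarrow> real) \<Rightarrow> bool" where
  "Linf_regular_at p \<Omega> \<phi> H u \<longleftrightarrow>
     (\<exists>U :: nat \<Rightarrow> real^'n \<Rightarrow> real.
        (\<forall>k. U k \<in> admissible p \<Omega> \<phi> H \<inter> Linf \<Omega>) \<and>
        W1p_tendsto p \<Omega> U u \<and>
        L1_tendsto \<Omega> (\<lambda>k. lagrangian_along \<Omega> H (U k)) (lagrangian_along \<Omega> H u))"

end

theory Submission
  imports Defs
begin

text \<open>
  Write \<open>L (s, \<xi>) = \<bar>H (s, \<xi>)\<bar> + norm \<xi> powr p + \<Psi> (norm \<xi>)\<close>, where \<open>\<Psi>\<close> is a superlinear function, supplied by
  the criterion of de la Vallee-Poussin, for which \<open>L (u, \<nabla>u)\<close> is still integrable. To bound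
  \<open>u\<close> from above, replace it by \<open>min u (t + w)\<close>, where \<open>w \<ge> 0\<close> is a uniformly small function whose gradient
  takes finitely many values and oscillates so fast that it is almost weakly zero. Since \<open>H\<close> is
  arbitrary, \<open>w = 0\<close> can be far too expensive; instead the values of \<open>\<nabla>w\<close> are taken from the
  points where \<open>L (t, \<cdot>)\<close> almost touches an affine minorant \<open>\<gamma> + q \<bullet> \<xi>\<close> that is optimal at \<open>\<xi> = 0\<close>, so that the
  modification costs about \<open>\<gamma> m\<close> with \<open>m\<close> the measure of \<open>{u > t}\<close>. On the other hand
  the gradient of \<open>u\<close> has mean zero over \<open>{a < u \<le> b}\<close>, for \<open>a\<close> above the bound of \<open>\<phi>\<close>, so \<open>u\<close> itself pays at
  least about \<open>\<gamma>\<close> per unit of measure near height \<open>t\<close>. As \<open>u\<close> has finite cost, \<open>\<gamma> m\<close> must be small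
  for suitable arbitrarily large \<open>t\<close>. The same argument applied to \<open>-u\<close> bounds it from below.
\<close>

section \<open>Smooth bump functions\<close>

text \<open>Since \<open>H\<close> has neither growth nor convexity, \<open>\<Psi>\<close> has to
  supply the affine minorant: superlinearity makes the infimum of
  \<open>L (t, \<xi>) - q \<bullet> \<xi>\<close> finite for every \<open>q\<close>, keeps the
  almost contact points in a compact set, and lets a minorant at height \<open>t\<close> survive, up
  to 1, at nearby heights uniformly in \<open>\<xi>\<close>. The term
  \<open>norm \<xi> powr p\<close> lets one estimate serve both the Lagrangian and the gradients in
  L^p. The order of choice matters: the height \<open>t\<close> comes first, it fixes
  \<open>q\<close> and the finite set of gradients, and only then is \<open>w\<close> taken so small
  that \<open>q \<bullet> \<nabla>w\<close> integrates to almost nothing over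
  \<open>{u > t}\<close>. Losses by a constant are paid by the measure of that set, which tends to
  0. Boundary values survive because \<open>v = u - \<phi>\<close> is changed by the positive part
  of \<open>v - (t + w - \<phi>)\<close>, and \<open>t + w - \<phi>\<close> is nonnegative, so this
  positive part is again a limit of test functions. Such expressions are handled on the whole space,
  with elements of \<open>W1p_0\<close> extended by zero.\<close>

definition smooth :: "(real^'n \<Rightarrow> real) \<Rightarrow> bool" where
  "smooth f \<longleftrightarrow> (\<forall>k. C_k k f)"

text \<open>Collects the partial derivatives in the form in which \<open>has_weak_gradient\<close>
  uses them, so that its componentwise identities become one vector identity.\<close>

definition grad :: "(real^'n \<Rightarrow> real) \<Rightarrow> real^'n \<Rightarrow> real^'n" where
  "grad f x = (\<chi> i. frechet_derivative f (at x) (axis i 1))"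

text \<open>A coinduction principle: \<open>C_k (Suc k)\<close> asks for \<open>C_k k\<close> of the
  directional derivatives, so induction on \<open>k\<close> with \<open>f\<close> ranging over
  \<open>S\<close> needs only that \<open>S\<close> is closed under them. Each later smoothness
  proof comes down to choosing a suitable \<open>S\<close>.\<close>

lemma smoothI:
  assumes "f \<in> S"
    and "\<And>f x. f \<in> S \<Longrightarrow> f differentiable (at x)"
    and "\<And>f v. f \<in> S \<Longrightarrow> (\<lambda>x. frechet_derivative f (at x) v) \<in> S"
  shows "smooth f"
proof -
  have "C_k k f" if "f \<in> S" for k f
    using that
  proof (induction k arbitrary: f)
    case 0
    then show ?case
      by (simp add: assms(2) continuous_at_imp_continuous_on differentiable_imp_continuous_within)
  next
    case (Suc k)
    then show ?case using assms(2,3) by simp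
  qed
  with assms(1) show ?thesis by (simp add: smooth_def)
qed

lemma smooth_differentiable: "smooth f \<Longrightarrow> f differentiable (at x)"
  unfolding smooth_def using C_k.simps(2) by blast

lemma smooth_frechet_derivative:
  "smooth f \<Longrightarrow> smooth (\<lambda>x. frechet_derivative f (at x) v)"
  unfolding smooth_def using C_k.simps(2) by blast

lemma smooth_continuous: "smooth f \<Longrightarrow> continuous_on S f"
  by (meson C_k.simps(1) continuous_on_subset smooth_def subset_UNIV)

lemma inner_eq_sum_axis: "v \<bullet> (\<chi> i. f i) = (\<Sum>i\<in>UNIV. v $ i * f i)" for v :: "real^'n"
  by (simp add: inner_vec_def)

lemma linear_eq_inner_vec:
  fixes D :: "real^'n \<Rightarrow> real"
  assumes "linear D"
  shows "D v = v \<bullet> (\<chi> i. D (axis i 1))"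
proof -
  have "D v = D (\<Sum>i\<in>UNIV. v $ i *\<^sub>R axis i 1)"
    by (simp add: basis_expansion scalar_mult_eq_scaleR[symmetric])
  also have "\<dots> = (\<Sum>i\<in>UNIV. v $ i * D (axis i 1))"
    using assms by (simp add: linear_sum linear_scale)
  finally show ?thesis by (simp add: inner_eq_sum_axis)
qed

lemma frechet_derivative_eq_grad:
  "f differentiable (at x) \<Longrightarrow> frechet_derivative f (at x) v = v \<bullet> grad f x"
  unfolding grad_def by (intro linear_eq_inner_vec linear_frechet_derivative)

lemma differentiable_has_grad:
  "f differentiable (at x) \<Longrightarrow> (f has_derivative (\<lambda>v. v \<bullet> grad f x)) (at x)"
  by (metis frechet_derivative_eq_grad frechet_derivative_works ext)

lemma grad_eqI:
  assumes "(f has_derivative (\<lambda>v. v \<bullet> G)) (at x)"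
  shows "grad f x = G"
proof -
  have "frechet_derivative f (at x) = (\<lambda>v. v \<bullet> G)"
    using frechet_derivative_at[OF assms] by simp
  then show ?thesis
    by (simp add: grad_def vec_eq_iff inner_axis' )
qed

lemma smooth_has_grad: "smooth f \<Longrightarrow> (f has_derivative (\<lambda>v. v \<bullet> grad f x)) (at x)"
  by (simp add: differentiable_has_grad smooth_differentiable)

lemma continuous_on_grad: "smooth f \<Longrightarrow> continuous_on S (grad f)"
  unfolding grad_def
  by (intro continuous_on_vec_lambda smooth_continuous smooth_frechet_derivative)

text \<open>For \<open>Q = 1\<close> this is the classical flat function exp (-1/s). The polynomial
  in 1/s is carried along so that the family is closed under differentiation.\<close>

definition flat :: "real poly \<Rightarrow> real \<Rightarrow> real" where
  "flat Q s = (if s > 0 then poly Q (1 / s) * exp (- 1 / s) else 0)"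

lemma poly_exp_tendsto_0: "((\<lambda>z. poly Q z * exp (- z)) \<longlongrightarrow> 0) at_top" for Q :: "real poly"
proof -
  have "((\<lambda>z. \<Sum>i\<le>degree Q. coeff Q i * (z ^ i / exp z)) \<longlongrightarrow> (\<Sum>i\<le>degree Q. coeff Q i * 0)) at_top"
    by (intro tendsto_sum tendsto_mult tendsto_const tendsto_power_div_exp_0)
  then show ?thesis
    by (simp add: poly_altdef sum_distrib_right sum_divide_distrib exp_minus divide_inverse mult.assoc)
qed

text \<open>For s > 0 the derivative of Q(1/s) exp(-1/s) is (Q - Q')(1/s) exp(-1/s) / s^2, and
  \<open>monom 1 2\<close> encodes the factor 1/s^2. At s = 0 the right difference quotient is z
  Q(z) exp(-z) with z = 1/h, which tends to 0.\<close>

lemma flat_has_derivative: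
  "(flat Q has_real_derivative flat (monom 1 2 * (Q - pderiv Q)) s) (at s)"
proof -
  consider "s > 0" | "s < 0" | "s = 0" by linarith
  then show ?thesis
  proof cases
    case 1
    have "((\<lambda>s. poly Q (1 / s) * exp (- 1 / s)) has_real_derivative
        flat (monom 1 2 * (Q - pderiv Q)) s) (at s)"
      unfolding flat_def using 1
      by (auto intro!: derivative_eq_intros DERIV_chain'[OF _ poly_DERIV]
          simp: poly_monom power2_eq_square field_simps)
    moreover have "eventually (\<lambda>s. flat Q s = poly Q (1 / s) * exp (- 1 / s)) (nhds s)"
      using eventually_nhds_in_open[of "{0<..}" s] 1
      by (auto elim!: eventually_mono simp: flat_def)
    ultimately show ?thesis by (subst DERIV_cong_ev[OF refl _ refl])
  next
    case 2
    have "eventually (\<lambda>s. flat Q s = 0) (nhds s)"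
      using eventually_nhds_in_open[of "{..<0}" s] 2
      by (auto elim!: eventually_mono simp: flat_def)
    then show ?thesis
      using 2 by (subst DERIV_cong_ev[OF refl _ refl]) (auto simp: flat_def)
  next
    case 3
    have "((\<lambda>h. flat Q h / h) \<longlongrightarrow> 0) (at_right 0)"
    proof (rule Lim_transform_eventually)
      show "((\<lambda>h. poly (monom 1 1 * Q) (inverse h) * exp (- (inverse h))) \<longlongrightarrow> 0) (at_right (0::real))"
        by (rule filterlim_compose[OF poly_exp_tendsto_0 filterlim_inverse_at_top_right])
      show "\<forall>\<^sub>F h in at_right 0. poly (monom 1 1 * Q) (inverse h) * exp (- inverse h) = flat Q h / h"
        by (auto simp: eventually_at_filter flat_def poly_monom field_simps)
    qed
    moreover have "((\<lambda>h. flat Q h / h) \<longlongrightarrow> 0) (at_left 0)"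
      by (rule Lim_transform_eventually[OF tendsto_const])
        (auto simp: eventually_at_filter flat_def)
    ultimately have "((\<lambda>h. flat Q h / h) \<longlongrightarrow> 0) (at 0)"
      by (simp add: filterlim_at_split)
    then show ?thesis
      using 3 by (simp add: DERIV_def flat_def)
  qed
qed

text \<open>Closed under directional derivatives, hence consisting of smooth functions.\<close>
inductive_set bump_algebra :: "real \<Rightarrow> (real^'n \<Rightarrow> real) set" for r where
  const: "(\<lambda>x. c) \<in> bump_algebra r"
| inner: "(\<lambda>x. x \<bullet> a) \<in> bump_algebra r"
| flat: "(\<lambda>x. flat Q (r\<^sup>2 - x \<bullet> x)) \<in> bump_algebra r"
| add: "f \<in> bump_algebra r \<Longrightarrow> g \<in> bump_algebra r \<Longrightarrow> (\<lambda>x. f x + g x) \<in> bump_algebra r"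
| mult: "f \<in> bump_algebra r \<Longrightarrow> g \<in> bump_algebra r \<Longrightarrow> (\<lambda>x. f x * g x) \<in> bump_algebra r"

lemma bump_algebra_deriv:
  assumes "f \<in> bump_algebra r"
  shows "\<exists>D. (\<forall>x. (f has_derivative D x) (at x)) \<and> (\<forall>v. (\<lambda>x. D x v) \<in> bump_algebra r)"
  using assms
proof induction
  case (const c)
  then show ?case by (intro exI[of _ "\<lambda>x v. 0"]) (auto intro: bump_algebra.const)
next
  case (inner a)
  then show ?case
    by (intro exI[of _ "\<lambda>x v. v \<bullet> a"])
      (auto intro: bump_algebra.const derivative_eq_intros)
next
  case (flat Q)
  let ?P = "monom 1 2 * (Q - pderiv Q)"
  have "((\<lambda>x. flat Q (r\<^sup>2 - x \<bullet> x)) has_derivative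
      (\<lambda>v. flat ?P (r\<^sup>2 - x \<bullet> x) * ((- 2) * (x \<bullet> v)))) (at x)" for x :: "real^'n"
  proof -
    have "((\<lambda>x. r\<^sup>2 - x \<bullet> x) has_derivative (\<lambda>v. (- 2) * (x \<bullet> v))) (at x)"
      by (auto intro!: derivative_eq_intros simp: inner_commute)
    from has_derivative_compose[OF this flat_has_derivative[of Q, unfolded has_field_derivative_def]]
    show ?thesis .
  qed
  moreover have "(\<lambda>x. flat ?P (r\<^sup>2 - x \<bullet> x) * ((- 2) * (x \<bullet> v))) \<in> bump_algebra r" for v :: "real^'n"
    by (intro bump_algebra.intros)
  ultimately show ?case
    by (intro exI[of _ "\<lambda>x v. flat ?P (r\<^sup>2 - x \<bullet> x) * ((- 2) * (x \<bullet> v))"]) blast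
next
  case (add f g)
  then obtain D E where "\<forall>x. (f has_derivative D x) (at x)" "\<forall>v. (\<lambda>x. D x v) \<in> bump_algebra r"
    "\<forall>x. (g has_derivative E x) (at x)" "\<forall>v. (\<lambda>x. E x v) \<in> bump_algebra r" by blast
  then show ?case
    by (intro exI[of _ "\<lambda>x v. D x v + E x v"]) (auto intro: bump_algebra.add has_derivative_add)
next
  case (mult f g)
  then obtain D E where "\<forall>x. (f has_derivative D x) (at x)" "\<forall>v. (\<lambda>x. D x v) \<in> bump_algebra r"
    "\<forall>x. (g has_derivative E x) (at x)" "\<forall>v. (\<lambda>x. E x v) \<in> bump_algebra r" by blast
  then show ?case using mult.hyps
    by (intro exI[of _ "\<lambda>x v. f x * E x v + D x v * g x"])
      (auto intro!: bump_algebra.add bump_algebra.mult has_derivative_mult)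
qed

text \<open>The standard radial bump exp (-1 / (r^2 - |x|^2)); the \<open>1\<close> is the constant
  polynomial.\<close>

definition bump :: "real \<Rightarrow> real^'n \<Rightarrow> real" where
  "bump r x = flat 1 (r\<^sup>2 - x \<bullet> x)"

lemma bump_algebra_smooth:
  assumes "f \<in> bump_algebra r"
  shows "smooth f"
  using assms
proof (rule smoothI)
  fix f :: "real^'n \<Rightarrow> real" and x assume "f \<in> bump_algebra r"
  then show "f differentiable (at x)"
    using bump_algebra_deriv differentiableI by blast
next
  fix f :: "real^'n \<Rightarrow> real" and v assume "f \<in> bump_algebra r"
  then obtain D where D: "\<And>x. (f has_derivative D x) (at x)" "\<And>v. (\<lambda>x. D x v) \<in> bump_algebra r"
    using bump_algebra_deriv by blast
  have "(\<lambda>x. frechet_derivative f (at x) v) = (\<lambda>x. D x v)"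
    using frechet_derivative_at[OF D(1)] by metis
  with D(2) show "(\<lambda>x. frechet_derivative f (at x) v) \<in> bump_algebra r"
    by simp
qed

lemma bump_nonneg: "0 \<le> bump r x"
  by (simp add: bump_def flat_def)

lemma bump_pos_iff: "0 < r \<Longrightarrow> 0 < bump r x \<longleftrightarrow> norm x < r"
  by (auto simp: bump_def flat_def power2_norm_eq_inner[symmetric]
      dest: power_less_imp_less_base intro: power_strict_mono)

lemma bump_eq_0: "0 < r \<Longrightarrow> r \<le> norm x \<Longrightarrow> bump r x = 0"
  using bump_pos_iff[of r x] bump_nonneg[of r x] by linarith

section \<open>Integrability, local integrability, and density of continuous functions in
  L^p\<close>

lemma continuous_lebesgue_measurable:
  "continuous_on UNIV f \<Longrightarrow> f \<in> borel_measurable lebesgue"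
  for f :: "'a::euclidean_space \<Rightarrow> 'b::euclidean_space"
  by (simp add: borel_measurable_continuous_onI measurable_completion)

lemma ident_lebesgue_measurable [measurable]: "(\<lambda>x. x) \<in> borel_measurable (lebesgue :: 'a::euclidean_space measure)"
  by (simp add: continuous_lebesgue_measurable)

lemma cball_sets_lebesgue [measurable]: "cball a r \<in> sets (lebesgue :: 'a::euclidean_space measure)"
  by simp

text \<open>Stands in for the Minkowski inequality. The crude constant is good enough because only
  smallness of p-th powers matters, and no p-th root has to be taken.\<close>

lemma powr_norm_add_le:
  fixes a b :: "'a::real_normed_vector"
  assumes "0 \<le> p"
  shows "norm (a + b) powr p \<le> 2 powr p * (norm a powr p + norm b powr p)"
proof -
  have "norm (a + b) powr p \<le> (2 * max (norm a) (norm b)) powr p"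
    using assms norm_triangle_ineq[of a b] by (intro powr_mono2) auto
  also have "\<dots> = 2 powr p * max (norm a) (norm b) powr p"
    by (simp add: powr_mult)
  also have "max (norm a) (norm b) powr p \<le> norm a powr p + norm b powr p"
    by (simp add: max_def)
  finally show ?thesis by simp
qed

text \<open>The convex function x^p lies above its tangent at \<open>b\<close>. The tangent argument
  runs on the open half line, so \<open>a = 0\<close> is computed directly. This is the pointwise
  input for \<open>jensen_mollifier\<close>.\<close>

lemma powr_tangent_le:
  assumes "1 \<le> p" "0 \<le> a" "0 < (b::real)"
  shows "b powr p + p * b powr (p - 1) * (a - b) \<le> a powr p"
proof (cases "a = 0")
  case True
  have "b powr p = b powr (p - 1) * b"
    using assms by (simp add: powr_mult_base mult.commute)
  then have "b powr p + p * b powr (p - 1) * (a - b) = (1 - p) * (b powr (p - 1) * b)"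
    using True by (simp add: algebra_simps)
  also have "\<dots> \<le> 0"
    using assms by (intro mult_nonpos_nonneg) auto
  finally show ?thesis using True by simp
next
  case False
  have "((\<lambda>x. x powr p) has_real_derivative p * b powr (p - 1)) (at b within {0<..})"
    using assms by (auto intro!: derivative_eq_intros)
  from convex_on_imp_above_tangent[OF powr_convex[OF assms(1)] _ _ _ this, of a]
  show ?thesis using False assms by (simp add: interior_open)
qed

lemma emeasure_lebesgue_cball: "emeasure lebesgue (cball 0 R :: (real^'n) set) < \<infinity>"
  using emeasure_bounded_finite[of "cball 0 R :: (real^'n) set"] by simp

lemma integrable_indicator_cball: "integrable lebesgue (indicator (cball 0 R) :: real^'n \<Rightarrow> real)"
  using emeasure_lebesgue_cball by (intro integrable_real_indicator) auto

lemma integrable_of_bounded: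
  fixes f :: "real^'n \<Rightarrow> 'b::euclidean_space"
  assumes "f \<in> borel_measurable lebesgue"
    and "\<And>x. norm (f x) \<le> B" and "\<And>x. norm x > R \<Longrightarrow> f x = 0"
  shows "integrable lebesgue f"
  by (rule integrableI_bounded_set[where A = "cball 0 R" and B = B])
     (use assms emeasure_lebesgue_cball in auto)

lemma compactly_supported_bounded:
  fixes f :: "real^'n \<Rightarrow> 'b::real_normed_vector"
  assumes "continuous_on UNIV f" "\<And>x. norm x > R \<Longrightarrow> f x = 0"
  obtains B where "0 \<le> B" "\<And>x. norm (f x) \<le> B"
proof -
  have "bounded (f ` cball 0 R)"
    by (meson assms(1) compact_cball compact_continuous_image compact_imp_bounded
        continuous_on_subset top_greatest)
  then obtain B where "\<And>x. norm x \<le> R \<Longrightarrow> norm (f x) \<le> B"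
    unfolding bounded_iff by fastforce
  then have "norm (f x) \<le> max 0 B" for x
    using assms(2)[of x] by (cases "norm x \<le> R") (auto simp: le_max_iff_disj)
  then show ?thesis using that[of "max 0 B"] by simp
qed

lemma integrable_compactly_supported:
  fixes f :: "real^'n \<Rightarrow> 'b::euclidean_space"
  assumes "continuous_on UNIV f" "\<And>x. norm x > R \<Longrightarrow> f x = 0"
  shows "integrable lebesgue f"
proof -
  obtain B where "0 \<le> B" "\<And>x. norm (f x) \<le> B"
    using compactly_supported_bounded[OF assms] by metis
  then show ?thesis
    using assms by (intro integrable_of_bounded[where B = B and R = R] continuous_lebesgue_measurable)
qed

lemma compactly_supported_uniformly_continuous:
  fixes f :: "real^'n \<Rightarrow> 'b::real_normed_vector"
  assumes "continuous_on UNIV f" "\<And>x. norm x > R \<Longrightarrow> f x = 0" "0 < e"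
  obtains d where "0 < d" "\<And>x y. norm (x - y) < d \<Longrightarrow> norm (f x - f y) < e"
proof -
  have "uniformly_continuous_on (cball 0 (R + 1)) f"
    using assms(1) by (intro compact_uniformly_continuous) (auto intro: continuous_on_subset)
  then obtain d where d: "0 < d"
    "\<And>x y. norm x \<le> R + 1 \<Longrightarrow> norm y \<le> R + 1 \<Longrightarrow> norm (x - y) < d \<Longrightarrow> norm (f x - f y) < e"
    using assms(3) by (auto simp: uniformly_continuous_on_def dist_norm)
  \<comment> \<open>Capping the distance at 1 settles the remaining case: if one of two such points
    lies outside radius R + 1, then both lie outside radius R, where \<open>f\<close>
    vanishes.\<close>
  have "norm (f x - f y) < e" if "norm (x - y) < min d 1" for x y
  proof (cases "norm x \<le> R + 1 \<and> norm y \<le> R + 1")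
    case True then show ?thesis using d(2) that by simp
  next
    case False
    then have "norm x > R" "norm y > R"
      using that norm_triangle_ineq2[of x y] norm_triangle_ineq2[of y x]
      by (auto simp: norm_minus_commute)
    then show ?thesis using assms by simp
  qed
  then show ?thesis using d(1) that[of "min d 1"] by simp
qed

text \<open>Balls around the origin exhaust the whole space, so they replace arbitrary compact sets;
  \<open>locally_integrable_UNIV\<close> identifies the two notions.\<close>

definition locint :: "(real^'n \<Rightarrow> 'b::euclidean_space) \<Rightarrow> bool" where
  "locint f \<longleftrightarrow> (\<forall>R. set_integrable lebesgue (cball 0 R) f)"

lemma locint_measurable:
  assumes "locint f" shows "f \<in> borel_measurable lebesgue"
proof (rule borel_measurable_LIMSEQ_metric)
  show "(\<lambda>x. indicator (cball 0 (real n)) x *\<^sub>R f x) \<in> borel_measurable lebesgue" for n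
    using assms unfolding locint_def set_integrable_def by (blast intro: borel_measurable_integrable)
  show "(\<lambda>n. indicator (cball 0 (real n)) x *\<^sub>R f x) \<longlonglongrightarrow> f x" for x
  proof (rule tendsto_eventually)
    show "\<forall>\<^sub>F n in sequentially. indicator (cball 0 (real n)) x *\<^sub>R f x = f x"
      using eventually_ge_at_top[of "nat \<lceil>norm x\<rceil>"]
    proof eventually_elim
      case (elim n)
      then have "norm x \<le> real n" by linarith
      then show ?case by simp
    qed
  qed
qed

lemma locintI_bounded:
  fixes f :: "real^'n \<Rightarrow> 'b::euclidean_space"
  assumes "f \<in> borel_measurable lebesgue" "\<And>R. \<exists>B. \<forall>x. norm x \<le> R \<longrightarrow> norm (f x) \<le> B"
  shows "locint f"
  unfolding locint_def set_integrable_def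
proof
  fix R
  obtain B where "\<And>x. norm x \<le> R \<Longrightarrow> norm (f x) \<le> B" using assms(2) by blast
  then show "integrable lebesgue (\<lambda>x. indicator (cball 0 R) x *\<^sub>R f x)"
    using assms(1) emeasure_lebesgue_cball[of R]
    by (intro integrableI_bounded_set_indicator[where B = B]) auto
qed

lemma continuous_locint:
  fixes f :: "real^'n \<Rightarrow> 'b::euclidean_space"
  assumes "continuous_on UNIV f" shows "locint f"
proof (rule locintI_bounded)
  show "f \<in> borel_measurable lebesgue" using assms by (rule continuous_lebesgue_measurable)
  fix R
  have "bounded (f ` cball 0 R)"
    by (meson assms(1) compact_cball compact_continuous_image compact_imp_bounded
        continuous_on_subset top_greatest)
  then show "\<exists>B. \<forall>x. norm x \<le> R \<longrightarrow> norm (f x) \<le> B" unfolding bounded_iff by fastforce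
qed

lemma integrable_locint: "integrable lebesgue f \<Longrightarrow> locint f"
  by (simp add: locint_def set_integrable_def integrable_mult_indicator)

lemma locint_mult_integrable:
  fixes f :: "real^'n \<Rightarrow> 'b::euclidean_space" and k :: "real^'n \<Rightarrow> real"
  assumes "locint f" "k \<in> borel_measurable lebesgue" "\<And>x. \<bar>k x\<bar> \<le> B" "\<And>x. norm x > R \<Longrightarrow> k x = 0"
  shows "integrable lebesgue (\<lambda>x. k x *\<^sub>R f x)"
proof (rule Bochner_Integration.integrable_bound)
  show "integrable lebesgue (\<lambda>x. B *\<^sub>R (indicator (cball 0 R) x *\<^sub>R f x))"
    using assms(1) unfolding locint_def set_integrable_def by (intro integrable_scaleR_right) auto
  show "(\<lambda>x. k x *\<^sub>R f x) \<in> borel_measurable lebesgue"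
    using assms(2) locint_measurable[OF assms(1)] by simp
  have "\<bar>k x\<bar> * norm (f x) \<le> \<bar>B\<bar> * norm (f x)" for x
    using assms(3)[of x] by (intro mult_right_mono) auto
  then show "AE x in lebesgue. norm (k x *\<^sub>R f x) \<le> norm (B *\<^sub>R (indicator (cball 0 R) x *\<^sub>R f x))"
    using assms(4) by (intro AE_I2) (auto simp: indicator_def)
qed

lemma locint_mult_continuous:
  fixes f :: "real^'n \<Rightarrow> 'b::euclidean_space" and k :: "real^'n \<Rightarrow> real"
  assumes "locint f" "continuous_on UNIV k" "\<And>x. norm x > R \<Longrightarrow> k x = 0"
  shows "integrable lebesgue (\<lambda>x. k x *\<^sub>R f x)"
proof -
  obtain B where "\<And>x. norm (k x) \<le> B"
    using compactly_supported_bounded[OF assms(2,3)] by blast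
  then show ?thesis
    using assms by (intro locint_mult_integrable[where B = B and R = R] continuous_lebesgue_measurable) auto
qed

lemma locint_mult_continuous':
  fixes f :: "real^'n \<Rightarrow> real" and k :: "real^'n \<Rightarrow> 'b::euclidean_space"
  assumes "locint f" "continuous_on UNIV k" "\<And>x. norm x > R \<Longrightarrow> k x = 0"
  shows "integrable lebesgue (\<lambda>x. f x *\<^sub>R k x)"
proof -
  obtain B where B: "\<And>x. norm (k x) \<le> B"
    using compactly_supported_bounded[OF assms(2,3)] by blast
  show ?thesis
  proof (rule Bochner_Integration.integrable_bound)
    show "integrable lebesgue (\<lambda>x. B *\<^sub>R (indicator (cball 0 R) x *\<^sub>R f x))"
      using assms(1) unfolding locint_def set_integrable_def by (intro integrable_scaleR_right) auto
    show "(\<lambda>x. f x *\<^sub>R k x) \<in> borel_measurable lebesgue"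
      using continuous_lebesgue_measurable[OF assms(2)] locint_measurable[OF assms(1)] by measurable
    have "\<bar>f x\<bar> * norm (k x) \<le> \<bar>B\<bar> * \<bar>f x\<bar>" for x
      using B[of x] by (subst mult.commute, intro mult_right_mono) auto
    then show "AE x in lebesgue. norm (f x *\<^sub>R k x) \<le> norm (B *\<^sub>R (indicator (cball 0 R) x *\<^sub>R f x))"
      using assms(3) by (intro AE_I2) (auto simp: indicator_def abs_mult)
  qed
qed

text \<open>For p at least 1 one has a <= 1 + a^p, and the constant 1 is integrable on
  balls.\<close>

lemma powr_integrable_locint:
  fixes f :: "real^'n \<Rightarrow> 'b::euclidean_space"
  assumes "1 \<le> p" "f \<in> borel_measurable lebesgue" "integrable lebesgue (\<lambda>x. norm (f x) powr p)"
  shows "locint f"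
  unfolding locint_def set_integrable_def
proof
  fix R
  show "integrable lebesgue (\<lambda>x. indicator (cball 0 R) x *\<^sub>R f x)"
  proof (rule Bochner_Integration.integrable_bound)
    show "integrable lebesgue (\<lambda>x. indicator (cball 0 R) x + norm (f x) powr p)"
      using assms(3) by (intro Bochner_Integration.integrable_add integrable_indicator_cball)
    show "(\<lambda>x. indicator (cball 0 R) x *\<^sub>R f x) \<in> borel_measurable lebesgue"
      using assms(2) by measurable
    have "norm (f x) \<le> 1 + norm (f x) powr p" for x
    proof (cases "norm (f x) \<le> 1")
      case False
      then have "norm (f x) powr 1 \<le> norm (f x) powr p" using assms(1) by (intro powr_mono) auto
      then show ?thesis by (simp add: abs_if)
    qed (simp add: add_increasing2)
    then show "AE x in lebesgue. norm (indicator (cball 0 R) x *\<^sub>R f x)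
        \<le> norm (indicator (cball 0 R) x + norm (f x) powr p)"
      by (intro AE_I2) (auto simp: indicator_def)
  qed
qed

text \<open>Truncation in domain and range, then an almost everywhere limit of continuous functions
  clamped to the same bounds; both steps converge by dominated convergence.\<close>
lemma Lp_approx_continuous:
  fixes f :: "real^'n \<Rightarrow> 'b::euclidean_space"
  assumes p: "1 \<le> p" and f: "f \<in> borel_measurable lebesgue"
    and fp: "integrable lebesgue (\<lambda>x. norm (f x) powr p)" and e: "0 < e"
  obtains k R where "continuous_on UNIV k" "\<And>x. norm x > R \<Longrightarrow> k x = 0"
    "integrable lebesgue (\<lambda>x. norm (f x - k x) powr p)"
    "(LINT x|lebesgue. norm (f x - k x) powr p) < e"
proof -
  \<comment> \<open>Two errors below \<open>e'\<close> (truncation, then continuous approximation)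
    are combined by \<open>powr_norm_add_le\<close>, which multiplies their sum by 2^p.\<close>
  define e' where "e' = e / (2 * 2 powr p)"
  have e': "0 < e'" using e by (simp add: e'_def)
  define F where "F n x = (if norm x \<le> real n \<and> norm (f x) \<le> real n then f x else 0)" for n x
  have F_meas: "F n \<in> borel_measurable lebesgue" for n
    unfolding F_def using f by measurable
  have "(\<lambda>n. LINT x|lebesgue. norm (f x - F n x) powr p) \<longlonglongrightarrow> (LINT x::real^'n|lebesgue. (0::real))"
  proof (rule integral_dominated_convergence[where w = "\<lambda>x. norm (f x) powr p"])
    show "(\<lambda>x. norm (f x - F n x) powr p) \<in> borel_measurable lebesgue" for n
      using f F_meas by measurable
    show "AE x in lebesgue. (\<lambda>n. norm (f x - F n x) powr p) \<longlonglongrightarrow> 0"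
    proof (intro AE_I2 tendsto_eventually)
      fix x
      show "\<forall>\<^sub>F n in sequentially. norm (f x - F n x) powr p = 0"
        using eventually_ge_at_top[of "nat \<lceil>max (norm x) (norm (f x))\<rceil>"]
      proof eventually_elim
        case (elim n)
        then have "norm x \<le> real n" "norm (f x) \<le> real n" by linarith+
        then show ?case by (simp add: F_def)
      qed
    qed
    show "AE x in lebesgue. norm (norm (f x - F n x) powr p) \<le> norm (f x) powr p" for n
      by (intro AE_I2) (auto simp: F_def)
  qed (use fp in auto)
  then have "\<forall>\<^sub>F n in sequentially. (LINT x|lebesgue. norm (f x - F n x) powr p) < e'"
    using e' by (auto dest: order_tendstoD)
  then obtain n where n: "(LINT x|lebesgue. norm (f x - F n x) powr p) < e'"
    by (auto simp: eventually_sequentially)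
  have Fp: "integrable lebesgue (\<lambda>x. norm (f x - F n x) powr p)"
    by (rule Bochner_Integration.integrable_bound[OF fp])
       (use f F_meas in \<open>auto simp: F_def intro!: AE_I2\<close>)
  \<comment> \<open>\<open>F n\<close> lives in radius \<open>n\<close> and is bounded by
    \<open>n\<close>; the extra 1 leaves room for a continuous cut-off that equals 1 on radius
    \<open>n\<close> and 0 beyond \<open>M\<close>.\<close>
  define M where "M = real n + 1"
  have M: "0 < M" by (simp add: M_def)
  have "F n measurable_on UNIV"
    using F_meas by (intro lebesgue_measurable_imp_measurable_on) auto
  then obtain N g where N: "negligible N" "\<And>j. continuous_on UNIV (g j)"
    "\<And>x. x \<notin> N \<Longrightarrow> (\<lambda>j. g j x) \<longlonglongrightarrow> F n x"
    by (auto simp: measurable_on_def)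
  \<comment> \<open>The radial projection onto the ball of radius \<open>M\<close>: continuous, and
    the identity on all values of \<open>F n\<close>. It bounds the approximating functions without
    disturbing their limit.\<close>
  define P where "P y = (M / max M (norm y)) *\<^sub>R y" for y :: 'b
  have P_cont: "continuous_on UNIV P"
    unfolding P_def using M by (intro continuous_intros) (auto simp: max_def)
  have P_le: "norm (P y) \<le> M" for y
    using M by (auto simp: P_def max_def field_simps)
  have P_id: "norm y \<le> M \<Longrightarrow> P y = y" for y
    using M by (auto simp: P_def max_def)
  define ctf where "ctf x = max 0 (min 1 (M - norm x))" for x :: "real^'n"
  define c where "c j x = ctf x *\<^sub>R P (g j x)" for j x
  have c_cont: "continuous_on UNIV (c j)" for j
    unfolding c_def ctf_def
    using continuous_on_compose2[OF P_cont N(2)] by (auto intro!: continuous_intros)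
  have c_0: "c j x = 0" if "norm x > M" for j x
    using that by (simp add: c_def ctf_def)
  have c_le: "norm (c j x) \<le> M" for j x
  proof -
    have "\<bar>ctf x\<bar> * norm (P (g j x)) \<le> 1 * M"
      by (intro mult_mono P_le) (auto simp: ctf_def)
    then show ?thesis by (simp add: c_def)
  qed
  have F_le: "norm (F n x) \<le> M" "norm x > M \<Longrightarrow> F n x = 0" for x
    by (auto simp: F_def M_def)
  have bd: "norm (F n x - c j x) powr p \<le> (2 * M) powr p * indicator (cball 0 M) x" for j x
  proof (cases "norm x \<le> M")
    case True
    have "norm (F n x - c j x) \<le> 2 * M"
      using norm_triangle_ineq4[of "F n x" "c j x"] F_le(1)[of x] c_le[of j x] by linarith
    then show ?thesis using True p by (auto intro: powr_mono2)
  qed (use F_le c_0 in auto)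
  have dom: "integrable lebesgue (\<lambda>x::real^'n. (2 * M) powr p * indicator (cball 0 M) x :: real)"
    by (intro integrable_mult_right integrable_indicator_cball)
  have meas: "(\<lambda>x. norm (F n x - c j x) powr p) \<in> borel_measurable lebesgue" for j
    using F_meas[of n] continuous_lebesgue_measurable[OF c_cont[of j]] by measurable
  have "(\<lambda>j. LINT x|lebesgue. norm (F n x - c j x) powr p) \<longlonglongrightarrow> (LINT x::real^'n|lebesgue. (0::real))"
  proof (rule integral_dominated_convergence[OF _ meas dom])
    have "AE x in lebesgue. x \<notin> N"
      using N(1) by (simp add: AE_not_in negligible_iff_null_sets)
    then show "AE x in lebesgue. (\<lambda>j. norm (F n x - c j x) powr p) \<longlonglongrightarrow> 0"
    proof eventually_elim
      case (elim x)
      have "isCont P (F n x)" using P_cont by (simp add: continuous_on_eq_continuous_at)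
      from isCont_tendsto_compose[OF this N(3)[OF elim]]
      have "(\<lambda>j. P (g j x)) \<longlonglongrightarrow> F n x" using P_id[OF F_le(1)] by simp
      from tendsto_scaleR[OF tendsto_const[of "ctf x"] this]
      have "(\<lambda>j. c j x) \<longlonglongrightarrow> ctf x *\<^sub>R F n x" by (simp add: c_def)
      also have "ctf x *\<^sub>R F n x = F n x"
        by (auto simp: ctf_def F_def M_def)
      finally have "(\<lambda>j. norm (F n x - c j x)) \<longlonglongrightarrow> 0"
        using tendsto_norm[OF tendsto_diff[OF tendsto_const[of "F n x"]]] by fastforce
      from tendsto_powr'[OF this tendsto_const, of p] p show ?case by simp
    qed
    show "AE x in lebesgue. norm (norm (F n x - c j x) powr p) \<le> (2 * M) powr p * indicator (cball 0 M) x" for j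
      using bd by simp
  qed auto
  then have "\<forall>\<^sub>F j in sequentially. (LINT x|lebesgue. norm (F n x - c j x) powr p) < e'"
    using e' by (auto dest: order_tendstoD)
  then obtain j where j: "(LINT x|lebesgue. norm (F n x - c j x) powr p) < e'"
    by (auto simp: eventually_sequentially)
  have cp: "integrable lebesgue (\<lambda>x. norm (F n x - c j x) powr p)"
    by (rule Bochner_Integration.integrable_bound[OF dom meas]) (use bd in auto)
  have le: "norm (f x - c j x) powr p
      \<le> 2 powr p * (norm (f x - F n x) powr p + norm (F n x - c j x) powr p)" for x
    using powr_norm_add_le[of p "f x - F n x" "F n x - c j x"] p by simp
  have sum_int: "integrable lebesgue (\<lambda>x. 2 powr p * (norm (f x - F n x) powr p + norm (F n x - c j x) powr p))"
    using Fp cp by simp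
  have int: "integrable lebesgue (\<lambda>x. norm (f x - c j x) powr p)"
    by (rule Bochner_Integration.integrable_bound[OF sum_int])
       (use f continuous_lebesgue_measurable[OF c_cont[of j]] le in \<open>auto intro!: AE_I2\<close>)
  have "(LINT x|lebesgue. norm (f x - c j x) powr p)
      \<le> 2 powr p * ((LINT x|lebesgue. norm (f x - F n x) powr p) + (LINT x|lebesgue. norm (F n x - c j x) powr p))"
    using integral_mono[OF int sum_int le] Fp cp by simp
  also have "\<dots> < 2 powr p * (e' + e')"
    using n j by (intro mult_strict_left_mono add_strict_mono) auto
  also have "\<dots> = e" by (simp add: e'_def)
  finally show ?thesis using that[OF c_cont c_0 int] by blast
qed

section \<open>Convolution and mollification\<close>

text \<open>Each radius is normalised by its own integral instead of rescaling one fixed kernel.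
  What is used afterwards is smoothness, nonnegativity, support in the ball of radius
  \<open>r\<close>, and total mass 1.\<close>

definition mollifier :: "real \<Rightarrow> real^'n \<Rightarrow> real" where
  "mollifier r x = bump r x * (1 / (LINT y::real^'n|lebesgue. bump r y))"

lemma smooth_mollifier: "smooth (mollifier r)"
  unfolding mollifier_def bump_def
  by (rule bump_algebra_smooth[where r = r]) (intro bump_algebra.intros)

lemma continuous_mollifier: "continuous_on S (mollifier r)"
  by (rule smooth_continuous[OF smooth_mollifier])

lemma continuous_bump: "continuous_on S (bump r :: real^'n \<Rightarrow> real)"
  unfolding bump_def by (rule smooth_continuous[OF bump_algebra_smooth[OF bump_algebra.flat]])

lemma integrable_bump: "0 < r \<Longrightarrow> integrable lebesgue (bump r :: real^'n \<Rightarrow> real)"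
  by (rule integrable_compactly_supported[where R = r]) (auto intro: continuous_bump bump_eq_0)

text \<open>A nonnegative function with integral 0 vanishes almost everywhere, but
  \<open>bump r\<close> is positive on an open ball, which is not a null set.\<close>

lemma integral_bump_pos:
  assumes "0 < r"
  shows "0 < (LINT x::real^'n|lebesgue. bump r x)"
proof -
  have "(LINT x::real^'n|lebesgue. bump r x) \<noteq> 0"
  proof
    assume "(LINT x::real^'n|lebesgue. bump r x) = 0"
    then have "AE x::real^'n in lebesgue. bump r x = 0"
      using integrable_bump[OF assms] by (subst (asm) integral_nonneg_eq_0_iff_AE) (auto simp: bump_nonneg)
    then have "AE x::real^'n in lebesgue. x \<notin> ball 0 r"
      by eventually_elim (use bump_pos_iff[OF assms] in force)
    then have "ball (0::real^'n) r \<in> null_sets lebesgue"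
      by (subst AE_iff_null_sets) auto
    then have "negligible (ball (0::real^'n) r)"
      by (simp add: negligible_iff_null_sets)
    then show False
      using assms by (simp add: open_not_negligible)
  qed
  moreover have "0 \<le> (LINT x::real^'n|lebesgue. bump r x)"
    by (intro integral_nonneg_AE AE_I2) (simp add: bump_nonneg)
  ultimately show ?thesis by simp
qed

lemma mollifier_nonneg: "0 < r \<Longrightarrow> 0 \<le> mollifier r x"
  using integral_bump_pos[of r, where 'n = 'a] by (simp add: mollifier_def bump_nonneg)

lemma mollifier_eq_0: "0 < r \<Longrightarrow> r \<le> norm x \<Longrightarrow> mollifier r x = 0"
  by (simp add: mollifier_def bump_eq_0)

lemma integral_mollifier: "0 < r \<Longrightarrow> (LINT x::real^'n|lebesgue. mollifier r x) = 1"
  unfolding mollifier_def using integral_bump_pos[of r, where 'n = 'n] by simp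

lemma lebesgue_integral_borel:
  fixes f :: "'a::euclidean_space \<Rightarrow> 'b::euclidean_space"
  assumes "f \<in> borel_measurable borel"
  shows "(LINT x|lebesgue. f x) = (LINT x|lborel. f x)" "integrable lebesgue f \<longleftrightarrow> integrable lborel f"
  using assms by (simp_all add: integral_completion integrable_completion)

lemma lborel_integral_translation:
  fixes f :: "'a::euclidean_space \<Rightarrow> 'b::euclidean_space"
  assumes "f \<in> borel_measurable borel"
  shows "(LINT x|lborel. f (a + x)) = (LINT x|lborel. f x)"
proof -
  have "(LINT x|lborel. f x) = (LINT x|distr lborel borel ((+) a). f x)"
    by (simp add: lborel_distr_plus)
  also have "\<dots> = (LINT x|lborel. f (a + x))"
    using assms by (subst integral_distr) auto
  finally show ?thesis by simp
qed

lemma lborel_integral_reflect: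
  fixes f :: "'a::euclidean_space \<Rightarrow> 'b::euclidean_space"
  assumes [measurable]: "f \<in> borel_measurable borel"
  shows "(LINT x|lborel. f (a - x)) = (LINT x|lborel. f x)"
proof -
  have "(LINT x|lborel. f x) = (LINT x|distr lborel borel (\<lambda>x. a + (-1) *\<^sub>R x). f x)"
    using lborel_affine[of "-1" a] by (simp add: density_1)
  also have "\<dots> = (LINT x|lborel. f (a - x))"
    by (subst integral_distr) (auto intro!: measurable_compose[OF _ assms])
  finally show ?thesis by simp
qed

lemma integral_mollifier_shift:
  assumes "0 < r"
  shows "(LINT y::real^'n|lebesgue. mollifier r (x - y)) = 1"
    "(LINT y::real^'n|lebesgue. mollifier r (y - x)) = 1"
proof -
  have [measurable]: "mollifier r \<in> borel_measurable (borel :: (real^'n) measure)"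
    by (intro borel_measurable_continuous_onI continuous_mollifier)
  have "(LINT y::real^'n|lborel. mollifier r y) = 1"
    using integral_mollifier[OF assms, where 'n = 'n] by (subst lebesgue_integral_borel(1)[symmetric]) measurable
  moreover have "(LINT y::real^'n|lebesgue. mollifier r (x - y)) = (LINT y::real^'n|lborel. mollifier r (x - y))"
    "(LINT y::real^'n|lebesgue. mollifier r (y - x)) = (LINT y::real^'n|lborel. mollifier r (y - x))"
    by (intro lebesgue_integral_borel(1); measurable)+
  ultimately show "(LINT y::real^'n|lebesgue. mollifier r (x - y)) = 1"
    "(LINT y::real^'n|lebesgue. mollifier r (y - x)) = 1"
    using lborel_integral_reflect[of "mollifier r" x] lborel_integral_translation[of "mollifier r" "-x"]
    by simp_all
qed

text \<open>Vector values of \<open>f\<close> are allowed, so that a mollified function and its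
  mollified gradient are instances of the same operation.\<close>

definition convol :: "(real^'n \<Rightarrow> real) \<Rightarrow> (real^'n \<Rightarrow> 'b::euclidean_space) \<Rightarrow> real^'n \<Rightarrow> 'b" where
  "convol k f x = (LINT y|lebesgue. k (x - y) *\<^sub>R f y)"

lemma shift_support:
  fixes x y :: "'a::real_normed_vector"
  shows "norm y > norm x + r \<Longrightarrow> norm (x - y) > r"
  using norm_triangle_ineq2[of y x] by (simp add: norm_minus_commute)

lemma convol_integrable:
  fixes f :: "real^'n \<Rightarrow> 'b::euclidean_space"
  assumes "continuous_on UNIV k" "\<And>z. norm z > r \<Longrightarrow> k z = 0" "locint f"
  shows "integrable lebesgue (\<lambda>y. k (x - y) *\<^sub>R f y)"
  using assms(2) shift_support[of x r]
  by (intro locint_mult_continuous[where R = "norm x + r"] assms(3)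
      continuous_on_compose2[OF assms(1)]) (auto intro!: continuous_intros)

lemma mean_value_inner:
  fixes k :: "real^'n \<Rightarrow> real"
  assumes "\<And>x. (k has_derivative (\<lambda>v. v \<bullet> G x)) (at x)"
  obtains s where "0 < s" "s < 1" "k (z + v) - k z = v \<bullet> G (z + s *\<^sub>R v)"
proof -
  have "((\<lambda>s. k (z + s *\<^sub>R v)) has_real_derivative v \<bullet> G (z + s *\<^sub>R v)) (at s)" for s
  proof -
    have "((\<lambda>s. z + s *\<^sub>R v) has_derivative (\<lambda>h. h *\<^sub>R v)) (at s)"
      by (auto intro!: derivative_eq_intros)
    from has_derivative_compose[OF this assms]
    moreover have "(\<lambda>h. h * c) = (*) c" for c :: real by (auto simp: mult.commute)
    ultimately show ?thesis by (simp add: has_field_derivative_def)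
  qed
  from MVT2[of 0 1, OF zero_less_one this] obtain s where
    "0 < s" "s < 1" "k (z + 1 *\<^sub>R v) - k (z + 0 *\<^sub>R v) = (1 - 0) * (v \<bullet> G (z + s *\<^sub>R v))" by blast
  then show ?thesis using that[of s] by simp
qed

lemma convol_continuous:
  fixes f :: "real^'n \<Rightarrow> 'b::euclidean_space"
  assumes k: "continuous_on UNIV k" "\<And>z. norm z > r \<Longrightarrow> k z = 0" and f: "locint f"
  shows "continuous_on UNIV (convol k f)"
proof (rule continuous_at_imp_continuous_on, intro ballI)
  fix x :: "real^'n"
  \<comment> \<open>For every x' within distance 1 of \<open>x\<close>, the function y |-> k (x' -
    y) is supported in this ball, so a single integral of |f| controls all increments.\<close>
  define B where "B = cball (0::real^'n) (norm x + r + 1)"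
  define A where "A = (LINT y|lebesgue. indicator B y * norm (f y))"
  have Bf: "integrable lebesgue (\<lambda>y. indicator B y * norm (f y))"
    using integrable_norm[of lebesgue "\<lambda>y. indicator B y *\<^sub>R f y"] f
    unfolding locint_def set_integrable_def B_def by simp
  have A: "0 \<le> A" unfolding A_def by (intro integral_nonneg_AE AE_I2) simp
  show "isCont (convol k f) x"
    unfolding continuous_at_eps_delta
  proof (intro allI impI)
    fix e :: real assume e: "0 < e"
    then have "0 < e / (A + 1)" using A by simp
    then obtain d where d: "0 < d" "\<And>x y. norm (x - y) < d \<Longrightarrow> norm (k x - k y) < e / (A + 1)"
      using compactly_supported_uniformly_continuous[OF k] by metis
    have "dist (convol k f x') (convol k f x) < e" if "dist x' x < min d 1" for x'
    proof -
      have "convol k f x' - convol k f x = (LINT y|lebesgue. k (x' - y) *\<^sub>R f y - k (x - y) *\<^sub>R f y)"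
        unfolding convol_def using convol_integrable[OF k f] by simp
      also have "norm \<dots> \<le> (LINT y|lebesgue. e / (A + 1) * (indicator B y * norm (f y)))"
      proof (rule Bochner_Integration.integral_norm_bound_integral)
        show "norm (k (x' - y) *\<^sub>R f y - k (x - y) *\<^sub>R f y) \<le> e / (A + 1) * (indicator B y * norm (f y))" for y
        proof (cases "y \<in> B")
          case True
          have "norm (k (x' - y) - k (x - y)) \<le> e / (A + 1)"
            using that by (intro less_imp_le d(2)) (simp add: dist_norm)
          then have "\<bar>k (x' - y) - k (x - y)\<bar> * norm (f y) \<le> e / (A + 1) * norm (f y)"
            by (intro mult_right_mono) auto
          then show ?thesis using True by (simp add: scaleR_diff_left[symmetric])
        next
          case False
          then have "norm y > norm x + r + 1" by (simp add: B_def)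
          moreover have "norm x' < norm x + 1"
            using that norm_triangle_ineq2[of x' x] by (simp add: dist_norm)
          ultimately have "norm (x - y) > r" "norm (x' - y) > r"
            by (auto intro!: shift_support)
          then show ?thesis using k(2) False by simp
        qed
      qed (use Bf convol_integrable[OF k f] in auto)
      also have "\<dots> = e / (A + 1) * A" by (simp add: A_def)
      also have "\<dots> < e" using e A by (simp add: field_simps)
      finally show ?thesis by (simp add: dist_norm)
    qed
    then show "\<exists>d>0. \<forall>x'. dist x' x < d \<longrightarrow> dist (convol k f x') (convol k f x) < e"
      using d(1) by (intro exI[of _ "min d 1"]) auto
  qed
qed

text \<open>For each \<open>y\<close> the mean value theorem turns the first order remainder of
  \<open>k\<close> into the inner product of \<open>v\<close> with G (x - y + s v) - G (x - y).
  Uniform continuity of \<open>G\<close> makes this small relative to |v|, uniformly in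
  \<open>y\<close>, and integrating against |f| over a fixed ball finishes.\<close>

lemma convol_has_derivative:
  fixes f :: "real^'n \<Rightarrow> real"
  assumes k: "\<And>x. (k has_derivative (\<lambda>v. v \<bullet> G x)) (at x)" "\<And>z. norm z > r \<Longrightarrow> k z = 0"
    and G: "continuous_on UNIV G" "\<And>z. norm z > r \<Longrightarrow> G z = 0" and f: "locint f"
  shows "(convol k f has_derivative (\<lambda>v. v \<bullet> (LINT y|lebesgue. f y *\<^sub>R G (x - y)))) (at x)"
proof -
  define B where "B = cball (0::real^'n) (norm x + r + 1)"
  define A where "A = (LINT y|lebesgue. indicator B y * norm (f y))"
  have Bf: "integrable lebesgue (\<lambda>y. indicator B y * norm (f y))"
    using integrable_norm[of lebesgue "\<lambda>y. indicator B y *\<^sub>R f y"] f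
    unfolding locint_def set_integrable_def B_def by (simp add: abs_mult)
  have A: "0 \<le> A" unfolding A_def by (intro integral_nonneg_AE AE_I2) simp
  have kc: "continuous_on UNIV k"
    using k(1) has_derivative_continuous by (blast intro: continuous_at_imp_continuous_on)
  have ki: "integrable lebesgue (\<lambda>y. k (x - y) *\<^sub>R f y)" for x
    by (rule convol_integrable[OF kc k(2) f])
  have Gi: "integrable lebesgue (\<lambda>y. f y *\<^sub>R G (x - y))"
    using G(2) shift_support[of x r]
    by (intro locint_mult_continuous'[where R = "norm x + r"] f continuous_on_compose2[OF G(1)])
       (auto intro!: continuous_intros)
  show ?thesis
    unfolding has_derivative_at_alt
  proof (intro conjI allI impI)
    show "bounded_linear (\<lambda>v. v \<bullet> (LINT y|lebesgue. f y *\<^sub>R G (x - y)))"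
      by (rule bounded_linear_inner_left)
    fix e :: real assume e: "0 < e"
    then have e': "0 < e / (A + 1)" using A by simp
    obtain d where d: "0 < d" "\<And>x y. norm (x - y) < d \<Longrightarrow> norm (G x - G y) < e / (A + 1)"
      using compactly_supported_uniformly_continuous[OF G e'] by metis
    have "norm (convol k f x' - convol k f x - (x' - x) \<bullet> (LINT y|lebesgue. f y *\<^sub>R G (x - y)))
        \<le> e * norm (x' - x)" if x': "norm (x' - x) < min d 1" for x'
    proof -
      let ?v = "x' - x"
      have vG: "?v \<bullet> (LINT y|lebesgue. f y *\<^sub>R G (x - y)) = (LINT y|lebesgue. ?v \<bullet> (f y *\<^sub>R G (x - y)))"
        using Gi by (intro integral_inner_right[symmetric]) auto
      have vGi: "integrable lebesgue (\<lambda>y. ?v \<bullet> (f y *\<^sub>R G (x - y)))"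
        using Gi by (intro integrable_inner_right) auto
      have "convol k f x' - convol k f x - ?v \<bullet> (LINT y|lebesgue. f y *\<^sub>R G (x - y))
          = (LINT y|lebesgue. k (x' - y) *\<^sub>R f y - k (x - y) *\<^sub>R f y - ?v \<bullet> (f y *\<^sub>R G (x - y)))"
        unfolding convol_def vG using ki[of x] ki[of x'] vGi by (simp del: real_scaleR_def)
      also have "norm \<dots> \<le> (LINT y|lebesgue. (e / (A + 1) * norm ?v) * (indicator B y * norm (f y)))"
      proof (rule Bochner_Integration.integral_norm_bound_integral)
        show "integrable lebesgue
          (\<lambda>y. k (x' - y) *\<^sub>R f y - k (x - y) *\<^sub>R f y - ?v \<bullet> (f y *\<^sub>R G (x - y)))"
          using ki[of x] ki[of x'] vGi by (intro Bochner_Integration.integrable_diff)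
        show "norm (k (x' - y) *\<^sub>R f y - k (x - y) *\<^sub>R f y - ?v \<bullet> (f y *\<^sub>R G (x - y)))
            \<le> (e / (A + 1) * norm ?v) * (indicator B y * norm (f y))" for y
        proof (cases "y \<in> B")
          case True
          obtain s where s: "0 < s" "s < 1" "k ((x - y) + ?v) - k (x - y) = ?v \<bullet> G ((x - y) + s *\<^sub>R ?v)"
            using mean_value_inner[OF k(1)] by metis
          have "norm (s *\<^sub>R ?v) \<le> 1 * norm ?v"
            unfolding norm_scaleR using s by (intro mult_right_mono) auto
          then have "norm (((x - y) + s *\<^sub>R ?v) - (x - y)) < d"
            using x' by simp
          then have *: "norm (G ((x - y) + s *\<^sub>R ?v) - G (x - y)) \<le> e / (A + 1)"
            by (intro less_imp_le d(2))
          have "k (x' - y) *\<^sub>R f y - k (x - y) *\<^sub>R f y - ?v \<bullet> (f y *\<^sub>R G (x - y))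
              = (?v \<bullet> (G ((x - y) + s *\<^sub>R ?v) - G (x - y))) * f y"
          proof -
            have "k (x' - y) - k (x - y) = ?v \<bullet> G ((x - y) + s *\<^sub>R ?v)" using s(3) by simp
            then show ?thesis by (simp add: inner_diff_right left_diff_distrib[symmetric] mult.commute[of "f y"])
          qed
          also have "norm \<dots> \<le> (norm ?v * (e / (A + 1))) * norm (f y)"
            unfolding norm_mult
            by (intro mult_right_mono order_trans[OF _ mult_left_mono[OF *]])
               (auto simp: Cauchy_Schwarz_ineq2)
          finally show ?thesis using True by (simp add: mult_ac)
        next
          case False
          then have "norm y > norm x + r + 1" by (simp add: B_def)
          moreover have "norm x' < norm x + 1"
            using x' norm_triangle_ineq2[of x' x] by simp
          ultimately have "norm (x - y) > r" "norm (x' - y) > r"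
            by (auto intro!: shift_support)
          then show ?thesis using k(2) G(2) False by simp
        qed
      qed (use Bf in auto)
      also have "\<dots> = (e / (A + 1) * A) * norm ?v" by (simp add: A_def)
      also have "\<dots> \<le> e * norm ?v"
        using e A by (intro mult_right_mono) (auto simp: field_simps)
      finally show ?thesis .
    qed
    then show "\<exists>d>0. \<forall>x'. norm (x' - x) < d \<longrightarrow>
        norm (convol k f x' - convol k f x - (x' - x) \<bullet> (LINT y|lebesgue. f y *\<^sub>R G (x - y)))
        \<le> e * norm (x' - x)"
      using d(1) by (intro exI[of _ "min d 1"]) auto
  qed
qed

lemma grad_eq_0_outside:
  assumes "\<And>z. norm z > r \<Longrightarrow> k z = 0" "norm z > r"
  shows "grad k z = 0"
proof (rule grad_eqI)
  have "((\<lambda>_. 0) has_derivative (\<lambda>v. v \<bullet> (0::real^'a))) (at z)" by simp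
  then show "(k has_derivative (\<lambda>v. v \<bullet> 0)) (at z)"
  proof (rule has_derivative_transform_within_open[where s = "- cball 0 r"])
    show "open (- cball (0::real^'a) r)" by (simp add: open_Compl)
  qed (use assms in auto)
qed

text \<open>Derivatives fall on the kernel, so the class of all convolutions of \<open>f\<close>
  with smooth kernels supported in the ball of radius \<open>r\<close> is closed under directional
  derivatives, as \<open>smoothI\<close> demands.\<close>

lemma convol_smooth:
  fixes f :: "real^'n \<Rightarrow> real"
  assumes "smooth k" "\<And>z. norm z > r \<Longrightarrow> k z = 0" "locint f"
  shows "smooth (convol k f)"
    "grad (convol k f) x = (LINT y|lebesgue. f y *\<^sub>R grad k (x - y))"
proof -
  have D: "(convol k f has_derivative (\<lambda>v. v \<bullet> (LINT y|lebesgue. f y *\<^sub>R grad k (x - y)))) (at x)"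
    if "smooth k" "\<And>z. norm z > r \<Longrightarrow> k z = 0" for k x
    using that assms(3) grad_eq_0_outside[of r k]
    by (intro convol_has_derivative[where r = r] smooth_has_grad continuous_on_grad) auto
  show "grad (convol k f) x = (LINT y|lebesgue. f y *\<^sub>R grad k (x - y))"
    using D assms by (intro grad_eqI) auto
  let ?S = "{convol k f | k. smooth k \<and> (\<forall>z. norm z > r \<longrightarrow> k z = 0)}"
  show "smooth (convol k f)"
  proof (rule smoothI)
    show "convol k f \<in> ?S" using assms by blast
    fix h :: "real^'n \<Rightarrow> real" and x assume "h \<in> ?S"
    then show "h differentiable (at x)" using D by (auto simp: differentiable_def)
  next
    fix h :: "real^'n \<Rightarrow> real" and v assume "h \<in> ?S"
    then obtain k where k: "h = convol k f" "smooth k" "\<And>z. norm z > r \<Longrightarrow> k z = 0" by blast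
    have Gi: "integrable lebesgue (\<lambda>y. f y *\<^sub>R grad k (x - y))" for x
      using grad_eq_0_outside[of r k, OF k(3)] shift_support[of x r]
      by (intro locint_mult_continuous'[where R = "norm x + r"] assms(3)
          continuous_on_compose2[OF continuous_on_grad[OF k(2)]])
         (auto intro!: continuous_intros)
    have "frechet_derivative h (at x) v = convol (\<lambda>z. v \<bullet> grad k z) f x" for x
    proof -
      have "frechet_derivative h (at x) v = v \<bullet> (LINT y|lebesgue. f y *\<^sub>R grad k (x - y))"
        using frechet_derivative_at[OF D[OF k(2,3)]] k(1) by metis
      also have "\<dots> = (LINT y|lebesgue. v \<bullet> (f y *\<^sub>R grad k (x - y)))"
        using Gi by (intro integral_inner_right[symmetric]) auto
      finally show ?thesis by (simp add: convol_def mult.commute)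
    qed
    moreover have "smooth (\<lambda>z. v \<bullet> grad k z)"
    proof -
      have "(\<lambda>z. v \<bullet> grad k z) = (\<lambda>z. frechet_derivative k (at z) v)"
        using smooth_differentiable[OF k(2)] by (simp add: frechet_derivative_eq_grad)
      then show ?thesis using smooth_frechet_derivative[OF k(2)] by simp
    qed
    moreover have "\<forall>z. norm z > r \<longrightarrow> v \<bullet> grad k z = 0"
      using grad_eq_0_outside[of r k, OF k(3)] by simp
    ultimately show "(\<lambda>x. frechet_derivative h (at x) v) \<in> ?S"
      by (intro CollectI exI[of _ "\<lambda>z. v \<bullet> grad k z"]) (auto intro!: ext)
  qed
qed

lemma integrable_nn_bounded:
  fixes f :: "'a \<Rightarrow> real"
  assumes "f \<in> borel_measurable M" "\<And>x. 0 \<le> f x" "(\<integral>\<^sup>+x. ennreal (f x) \<partial>M) \<le> ennreal c" "0 \<le> c"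
  shows "integrable M f" "(LINT x|M. f x) \<le> c"
proof -
  show i: "integrable M f"
    using assms by (intro integrableI_nonneg) (auto intro: le_less_trans)
  have "ennreal (LINT x|M. f x) = (\<integral>\<^sup>+x. ennreal (f x) \<partial>M)"
    using i assms(2) by (intro nn_integral_eq_integral[symmetric]) auto
  then show "(LINT x|M. f x) \<le> c"
    using assms(3,4) by (metis ennreal_le_iff)
qed

lemma mollifier_eq_0': "0 < r \<Longrightarrow> r < norm x \<Longrightarrow> mollifier r x = 0"
  by (simp add: mollifier_eq_0)

lemma mollifier_scaleR_integrable:
  fixes f :: "real^'n \<Rightarrow> 'b::euclidean_space"
  assumes "0 < r" "locint f"
  shows "integrable lebesgue (\<lambda>y. mollifier r (x - y) *\<^sub>R f y)"
  by (rule convol_integrable[OF continuous_mollifier mollifier_eq_0'[OF assms(1)] assms(2)])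

lemma mollifier_integrable:
  "0 < r \<Longrightarrow> integrable lebesgue (\<lambda>y::real^'n. mollifier r (x - y))"
  using mollifier_scaleR_integrable[of r "\<lambda>_. 1 :: real" x] by (simp add: continuous_locint)

text \<open>Integrate the tangent inequality for x^p at the average \<open>b\<close> of
  \<open>a\<close>. The kernel has mass 1, so the linear term cancels. If \<open>b = 0\<close> there
  is no tangent to take, but then the left side is 0.\<close>

lemma jensen_mollifier:
  fixes a :: "real^'n \<Rightarrow> real"
  assumes r: "0 < r" and p: "1 \<le> p" and a: "\<And>y. 0 \<le> a y" "locint a" "locint (\<lambda>y. a y powr p)"
  shows "(LINT y|lebesgue. mollifier r (x - y) * a y) powr p \<le> (LINT y|lebesgue. mollifier r (x - y) * a y powr p)"
proof -
  let ?m = "\<lambda>y. mollifier r (x - y)"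
  define b where "b = (LINT y|lebesgue. ?m y * a y)"
  have i: "integrable lebesgue (\<lambda>y. ?m y * a y)" "integrable lebesgue (\<lambda>y. ?m y * a y powr p)"
    using mollifier_scaleR_integrable[OF r a(2), of x] mollifier_scaleR_integrable[OF r a(3), of x] by simp_all
  have mi: "integrable lebesgue ?m"
    by (rule mollifier_integrable[OF r])
  have b0: "0 \<le> b"
    unfolding b_def using a(1) by (intro integral_nonneg_AE AE_I2) (simp add: mollifier_nonneg[OF r])
  have nn: "0 \<le> (LINT y|lebesgue. ?m y * a y powr p)"
    by (intro integral_nonneg_AE AE_I2) (simp add: mollifier_nonneg[OF r])
  show ?thesis
  proof (cases "b = 0")
    case True
    then show ?thesis using nn by (simp add: b_def[symmetric])
  next
    case False
    with b0 have b: "0 < b" by simp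
    let ?c = "b powr p - p * b powr (p - 1) * b" and ?d = "p * b powr (p - 1)"
    have "(LINT y|lebesgue. ?m y * ?c + ?d * (?m y * a y)) \<le> (LINT y|lebesgue. ?m y * a y powr p)"
    proof (rule integral_mono)
      show "?m y * ?c + ?d * (?m y * a y) \<le> ?m y * a y powr p" for y
      proof -
        have "?m y * (b powr p + p * b powr (p - 1) * (a y - b)) \<le> ?m y * a y powr p"
          by (intro mult_left_mono powr_tangent_le[OF p a(1) b] mollifier_nonneg[OF r])
        then show ?thesis by (simp add: algebra_simps)
      qed
    qed (use i mi in auto)
    moreover have "(LINT y|lebesgue. ?m y * ?c + ?d * (?m y * a y)) = b powr p"
      using i mi integral_mollifier_shift(1)[OF r, of x] by (simp add: b_def[symmetric])
    ultimately show ?thesis by (simp add: b_def)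
  qed
qed

text \<open>Tonelli: for fixed \<open>y\<close> the kernel has mass 1 as a function of
  \<open>x\<close>.\<close>

lemma nn_integral_convol:
  fixes F :: "real^'n \<Rightarrow> real"
  assumes r: "0 < r" and F: "F \<in> borel_measurable lebesgue" "\<And>y. 0 \<le> F y"
  shows "(\<integral>\<^sup>+x. (\<integral>\<^sup>+y. ennreal (mollifier r (x - y) * F y) \<partial>lebesgue) \<partial>lebesgue) = (\<integral>\<^sup>+y. ennreal (F y) \<partial>lebesgue)"
proof -
  \<comment> \<open>The interchange of integrals is carried out over \<open>lborel\<close>, so the
    Lebesgue measurable \<open>F\<close> is replaced by a Borel function equal to it almost
    everywhere.\<close>
  obtain G where G[measurable]: "G \<in> borel_measurable lborel" and FG: "AE y in lborel. F y = G y"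
    using completion_ex_borel_measurable_real[OF F(1)] by blast
  have [measurable]: "mollifier r \<in> borel_measurable (borel :: (real^'n) measure)"
    by (intro borel_measurable_continuous_onI continuous_mollifier)
  have m1: "(\<integral>\<^sup>+x. ennreal (mollifier r (x - y)) \<partial>lborel) = 1" for y :: "real^'n"
  proof -
    have "integrable lebesgue (\<lambda>x. mollifier r (x - y))"
      using integral_mollifier_shift(2)[OF r, of y] not_integrable_integral_eq by fastforce
    then have "(\<integral>\<^sup>+x. ennreal (mollifier r (x - y)) \<partial>lebesgue) = 1"
      using integral_mollifier_shift(2)[OF r, of y]
      by (subst nn_integral_eq_integral) (auto simp: mollifier_nonneg[OF r])
    then show ?thesis by (simp add: nn_integral_completion)
  qed
  have "(\<integral>\<^sup>+x. (\<integral>\<^sup>+y. ennreal (mollifier r (x - y) * F y) \<partial>lborel) \<partial>lborel)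
      = (\<integral>\<^sup>+x. (\<integral>\<^sup>+y. ennreal (mollifier r (x - y)) * ennreal (G y) \<partial>lborel) \<partial>lborel)"
  proof (rule nn_integral_cong, rule nn_integral_cong_AE)
    fix x :: "real^'n" show "AE y in lborel. ennreal (mollifier r (x - y) * F y) = ennreal (mollifier r (x - y)) * ennreal (G y)"
      using FG by eventually_elim (simp add: ennreal_mult' mollifier_nonneg[OF r])
  qed
  also have "\<dots> = (\<integral>\<^sup>+y. (\<integral>\<^sup>+x. ennreal (mollifier r (x - y)) * ennreal (G y) \<partial>lborel) \<partial>lborel)"
    by (rule lborel_pair.Fubini'[symmetric]) measurable
  also have "\<dots> = (\<integral>\<^sup>+y. ennreal (G y) \<partial>lborel)"
    by (intro nn_integral_cong) (simp add: nn_integral_multc m1)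
  also have "\<dots> = (\<integral>\<^sup>+y. ennreal (F y) \<partial>lborel)"
    using FG by (intro nn_integral_cong_AE) (auto elim: eventually_mono)
  finally show ?thesis by (simp add: nn_integral_completion)
qed

text \<open>Young's inequality for a kernel of mass 1: Jensen at each point, then Tonelli in the
  form of \<open>nn_integral_convol\<close>.\<close>

lemma convol_Lp_le:
  fixes f :: "real^'n \<Rightarrow> 'b::euclidean_space"
  assumes r: "0 < r" and p: "1 \<le> p" and f: "f \<in> borel_measurable lebesgue"
    and fp: "integrable lebesgue (\<lambda>x. norm (f x) powr p)"
  shows "integrable lebesgue (\<lambda>x. norm (convol (mollifier r) f x) powr p)"
    "(LINT x|lebesgue. norm (convol (mollifier r) f x) powr p) \<le> (LINT x|lebesgue. norm (f x) powr p)"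
proof -
  have lf: "locint f" by (rule powr_integrable_locint[OF p f fp])
  have ln: "locint (\<lambda>y. norm (f y))"
    using p f fp by (intro powr_integrable_locint[where p = p]) auto
  have lp: "locint (\<lambda>y. norm (f y) powr p)" using fp by (rule integrable_locint)
  have mi: "integrable lebesgue (\<lambda>y. mollifier r (x - y) *\<^sub>R h y)" if "locint h"
    for h :: "real^'n \<Rightarrow> 'c::euclidean_space" and x
    using r that by (rule mollifier_scaleR_integrable)
  have le: "norm (convol (mollifier r) f x) powr p \<le> (LINT y|lebesgue. mollifier r (x - y) * norm (f y) powr p)" for x
  proof -
    have "norm (convol (mollifier r) f x) \<le> (LINT y|lebesgue. mollifier r (x - y) * norm (f y))"
      unfolding convol_def
      by (intro Bochner_Integration.integral_norm_bound_integral mi[OF lf] mi[OF ln, simplified])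
         (simp add: mollifier_nonneg[OF r])
    then have "norm (convol (mollifier r) f x) powr p \<le> (LINT y|lebesgue. mollifier r (x - y) * norm (f y)) powr p"
      using p by (intro powr_mono2) auto
    also have "\<dots> \<le> (LINT y|lebesgue. mollifier r (x - y) * norm (f y) powr p)"
      by (intro jensen_mollifier r p ln lp) simp
    finally show ?thesis .
  qed
  have "(\<integral>\<^sup>+x. ennreal (norm (convol (mollifier r) f x) powr p) \<partial>lebesgue)
      \<le> (\<integral>\<^sup>+x. (\<integral>\<^sup>+y. ennreal (mollifier r (x - y) * norm (f y) powr p) \<partial>lebesgue) \<partial>lebesgue)"
  proof (rule nn_integral_mono)
    fix x
    have "(\<integral>\<^sup>+y. ennreal (mollifier r (x - y) * norm (f y) powr p) \<partial>lebesgue)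
        = ennreal (LINT y|lebesgue. mollifier r (x - y) * norm (f y) powr p)"
      using mi[OF lp, of x] by (intro nn_integral_eq_integral) (auto simp: mollifier_nonneg[OF r])
    then show "ennreal (norm (convol (mollifier r) f x) powr p)
        \<le> (\<integral>\<^sup>+y. ennreal (mollifier r (x - y) * norm (f y) powr p) \<partial>lebesgue)"
      using le by (simp add: ennreal_leI)
  qed
  also have "\<dots> = (\<integral>\<^sup>+y. ennreal (norm (f y) powr p) \<partial>lebesgue)"
    using f by (intro nn_integral_convol r) auto
  also have "\<dots> = ennreal (LINT x|lebesgue. norm (f x) powr p)"
    using fp by (intro nn_integral_eq_integral) auto
  finally have nn: "(\<integral>\<^sup>+x. ennreal (norm (convol (mollifier r) f x) powr p) \<partial>lebesgue)
      \<le> ennreal (LINT x|lebesgue. norm (f x) powr p)" .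
  have c: "convol (mollifier r) f \<in> borel_measurable lebesgue"
    by (intro continuous_lebesgue_measurable convol_continuous[OF continuous_mollifier mollifier_eq_0'[OF r] lf])
  have m: "(\<lambda>x. norm (convol (mollifier r) f x) powr p) \<in> borel_measurable lebesgue"
    using c by measurable
  have "0 \<le> (LINT x|lebesgue. norm (f x) powr p)" by (intro integral_nonneg_AE AE_I2) simp
  from integrable_nn_bounded[OF m _ nn this]
  show "integrable lebesgue (\<lambda>x. norm (convol (mollifier r) f x) powr p)"
    "(LINT x|lebesgue. norm (convol (mollifier r) f x) powr p) \<le> (LINT x|lebesgue. norm (f x) powr p)"
    by auto
qed

lemma convol_mollifier_uniform:
  fixes k :: "real^'n \<Rightarrow> 'b::euclidean_space"
  assumes r: "0 < r" and k: "locint k" and e: "\<And>y. norm (x - y) < r \<Longrightarrow> norm (k y - k x) \<le> e"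
  shows "norm (convol (mollifier r) k x - k x) \<le> e"
proof -
  let ?m = "\<lambda>y. mollifier r (x - y)"
  have mk: "integrable lebesgue (\<lambda>y. ?m y *\<^sub>R k y)"
    using r k by (rule mollifier_scaleR_integrable)
  have mi: "integrable lebesgue ?m"
    by (rule mollifier_integrable[OF r])
  have "convol (mollifier r) k x - k x = (LINT y|lebesgue. ?m y *\<^sub>R k y) - (LINT y|lebesgue. ?m y) *\<^sub>R k x"
    using integral_mollifier_shift(1)[OF r, of x] by (simp add: convol_def)
  also have "\<dots> = (LINT y|lebesgue. ?m y *\<^sub>R k y - ?m y *\<^sub>R k x)"
    using mk mi by simp
  also have "norm \<dots> \<le> (LINT y|lebesgue. ?m y * e)"
  proof (rule Bochner_Integration.integral_norm_bound_integral)
    show "norm (?m y *\<^sub>R k y - ?m y *\<^sub>R k x) \<le> ?m y * e" for y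
    proof (cases "norm (x - y) < r")
      case True
      then show ?thesis
        using mollifier_nonneg[OF r, of "x - y"] mult_left_mono[OF e[OF True], of "?m y"]
        by (simp add: scaleR_diff_right[symmetric])
    qed (simp add: mollifier_eq_0[OF r])
  qed (use mk mi in auto)
  also have "\<dots> = e" using integral_mollifier_shift(1)[OF r, of x] by simp
  finally show ?thesis .
qed

lemma tendsto_small_radius:
  fixes A :: "real \<Rightarrow> real"
  assumes "\<And>e. 0 < e \<Longrightarrow> \<exists>d>0. \<forall>r. 0 < r \<longrightarrow> r < d \<longrightarrow> \<bar>A r\<bar> < e"
  shows "(\<lambda>n. A (inverse (real (Suc n)))) \<longlonglongrightarrow> 0"
proof (rule LIMSEQ_I)
  fix e :: real assume "0 < e"
  then obtain d where d: "0 < d" "\<forall>r. 0 < r \<longrightarrow> r < d \<longrightarrow> \<bar>A r\<bar> < e" using assms by blast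
  have "\<forall>\<^sub>F n in sequentially. inverse (real (Suc n)) < d"
    using LIMSEQ_inverse_real_of_nat d(1) by (rule order_tendstoD)
  then show "\<exists>no. \<forall>n\<ge>no. norm (A (inverse (real (Suc n))) - 0) < e"
    unfolding eventually_sequentially using d(2) by (metis diff_zero inverse_positive_iff_positive of_nat_0_less_iff real_norm_def zero_less_Suc)
qed

lemma powr_mult_le_of_small:
  assumes "0 < p" "0 < e" "0 \<le> (M::real)"
  obtains s where "0 < s" "s powr p * M < e"
proof -
  have "((e / (M + 1)) powr (1 / p)) powr p * M = e / (M + 1) * M"
    using assms by (simp add: powr_powr)
  also have "\<dots> < e" using assms by (simp add: field_simps)
  finally show ?thesis using that[of "(e / (M + 1)) powr (1 / p)"] assms by simp
qed

text \<open>Compare with a continuous compactly supported \<open>k\<close> close to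
  \<open>f\<close>. Mollifying f - k does not increase its L^p size, and for \<open>k\<close> itself
  the convergence is uniform inside a fixed ball, by uniform continuity.\<close>

lemma convol_Lp_tendsto:
  fixes f :: "real^'n \<Rightarrow> 'b::euclidean_space"
  assumes p: "1 \<le> p" and f: "f \<in> borel_measurable lebesgue"
    and fp: "integrable lebesgue (\<lambda>x. norm (f x) powr p)"
  shows "(\<lambda>n. LINT x|lebesgue. norm (convol (mollifier (inverse (Suc n))) f x - f x) powr p) \<longlonglongrightarrow> 0"
proof (rule tendsto_small_radius[where A = "\<lambda>r. LINT x|lebesgue. norm (convol (mollifier r) f x - f x) powr p"])
  fix e :: real assume e: "0 < e"
  \<comment> \<open>The integral of |f - k|^p enters twice: through its convolution with weight 2^p,
    and directly with weight 2^p * 2^p. The uniform error of \<open>k\<close> takes the other half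
    of \<open>e\<close>.\<close>
  define c where "c = 2 powr p * (1 + 2 powr p)"
  have c: "0 < c" by (simp add: c_def add_pos_nonneg)
  obtain k R where k: "continuous_on UNIV k" "\<And>x. norm x > R \<Longrightarrow> k x = 0"
    and ki: "integrable lebesgue (\<lambda>x. norm (f x - k x) powr p)"
    and ke: "(LINT x|lebesgue. norm (f x - k x) powr p) < e / (2 * c)"
    using Lp_approx_continuous[OF p f fp, of "e / (2 * c)"] e c by auto
  let ?I = "\<lambda>x::real^'n. indicator (cball 0 (R + 1)) x :: real"
  define M where "M = (LINT x|lebesgue. ?I x)"
  have M: "0 \<le> M" unfolding M_def by (intro integral_nonneg_AE AE_I2) simp
  obtain s where s: "0 < s" "s powr p * M < e / (2 * 2 powr p * 2 powr p)"
    using powr_mult_le_of_small[of p "e / (2 * 2 powr p * 2 powr p)" M] p e M by auto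
  obtain d where d: "0 < d" "\<And>x y. norm (x - y) < d \<Longrightarrow> norm (k x - k y) < s"
    using compactly_supported_uniformly_continuous[OF k s(1)] by metis
  have lf: "locint f" by (rule powr_integrable_locint[OF p f fp])
  have lk: "locint k" using k(1) by (rule continuous_locint)
  have km: "k \<in> borel_measurable lebesgue" using k(1) by (rule continuous_lebesgue_measurable)
  show "\<exists>d>0. \<forall>r. 0 < r \<longrightarrow> r < d \<longrightarrow> \<bar>LINT x|lebesgue. norm (convol (mollifier r) f x - f x) powr p\<bar> < e"
  proof (intro exI conjI allI impI)
    show "0 < min d 1" using d by simp
    fix r :: real assume r: "0 < r" "r < min d 1"
    let ?m = "mollifier r :: real^'n \<Rightarrow> real"
    have mz: "norm z > r \<Longrightarrow> ?m z = 0" for z by (rule mollifier_eq_0'[OF r(1)])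
    have lin: "convol ?m f x = convol ?m (\<lambda>x. f x - k x) x + convol ?m k x" for x
      using convol_integrable[OF continuous_mollifier mz lf, of r x] convol_integrable[OF continuous_mollifier mz lk, of r x]
      by (simp add: convol_def scaleR_diff_right)
    have unif: "norm (convol ?m k x - k x) powr p \<le> s powr p * ?I x" for x
    proof (cases "norm x \<le> R + 1")
      case True
      have "norm (convol ?m k x - k x) \<le> s"
        using r d(2) by (intro convol_mollifier_uniform lk) (auto simp: norm_minus_commute intro!: less_imp_le)
      then show ?thesis using True p by (auto intro: powr_mono2)
    next
      case False
      have "norm (convol ?m k x - k x) \<le> 0"
      proof (rule convol_mollifier_uniform[OF r(1) lk])
        fix y assume "norm (x - y) < r"
        then have "norm y > R" using False r norm_triangle_ineq2[of x y] by auto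
        then show "norm (k y - k x) \<le> 0" using k(2) False by simp
      qed
      then show ?thesis by simp
    qed
    note Y = convol_Lp_le[OF r(1) p _ ki]
    have fk: "(\<lambda>x. f x - k x) \<in> borel_measurable lebesgue" using f km by measurable
    let ?a = "\<lambda>x. norm (convol ?m (\<lambda>x. f x - k x) x) powr p" and ?b = "\<lambda>x. norm (f x - k x) powr p"
    have le: "norm (convol ?m f x - f x) powr p \<le> 2 powr p * (?a x + 2 powr p * (s powr p * ?I x + ?b x))" for x
    proof -
      have "norm (convol ?m f x - f x) powr p
          = norm (convol ?m (\<lambda>x. f x - k x) x + ((convol ?m k x - k x) + (k x - f x))) powr p"
        by (simp add: lin algebra_simps)
      also have "\<dots> \<le> 2 powr p * (?a x + norm ((convol ?m k x - k x) + (k x - f x)) powr p)"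
        using p by (intro powr_norm_add_le) simp
      also have "\<dots> \<le> 2 powr p * (?a x + 2 powr p * (norm (convol ?m k x - k x) powr p + norm (k x - f x) powr p))"
        using p by (intro mult_left_mono add_left_mono powr_norm_add_le) auto
      also have "\<dots> \<le> 2 powr p * (?a x + 2 powr p * (s powr p * ?I x + ?b x))"
        using unif[of x] by (intro mult_left_mono add_left_mono add_mono) (auto simp: norm_minus_commute)
      finally show ?thesis .
    qed
    have di: "integrable lebesgue (\<lambda>x. 2 powr p * (?a x + 2 powr p * (s powr p * ?I x + ?b x)))"
      by (intro integrable_mult_right Bochner_Integration.integrable_add Y(1) fk ki integrable_indicator_cball)
    have cm: "convol ?m f \<in> borel_measurable lebesgue"
      by (intro continuous_lebesgue_measurable convol_continuous[OF continuous_mollifier mz lf])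
    have ii: "integrable lebesgue (\<lambda>x. norm (convol ?m f x - f x) powr p)"
    proof (rule Bochner_Integration.integrable_bound[OF di])
      show "(\<lambda>x. norm (convol ?m f x - f x) powr p) \<in> borel_measurable lebesgue"
        using cm f by measurable
    qed (use le in \<open>auto intro!: AE_I2 order_trans[OF _ abs_ge_self]\<close>)
    have "(LINT x|lebesgue. norm (convol ?m f x - f x) powr p)
        \<le> (LINT x|lebesgue. 2 powr p * (?a x + 2 powr p * (s powr p * ?I x + ?b x)))"
      by (rule integral_mono[OF ii di le])
    also have "\<dots> = 2 powr p * ((LINT x|lebesgue. ?a x) + 2 powr p * (s powr p * M + (LINT x|lebesgue. ?b x)))"
    proof -
      have i1: "integrable lebesgue (\<lambda>x. s powr p * ?I x + ?b x)"
        by (intro integrable_mult_right Bochner_Integration.integrable_add ki integrable_indicator_cball)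
      then have i2: "integrable lebesgue (\<lambda>x. 2 powr p * (s powr p * ?I x + ?b x))"
        by (rule integrable_mult_right)
      have "(LINT x|lebesgue. s powr p * ?I x + ?b x) = s powr p * M + (LINT x|lebesgue. ?b x)"
        unfolding M_def
        by (subst Bochner_Integration.integral_add)
           (auto intro: integrable_mult_right ki integrable_indicator_cball)
      with i1 i2 Y(1)[OF fk] show ?thesis
        by (simp only: integral_mult_right_zero Bochner_Integration.integral_add)
    qed
    also have "\<dots> \<le> 2 powr p * ((LINT x|lebesgue. ?b x) + 2 powr p * (s powr p * M + (LINT x|lebesgue. ?b x)))"
      using Y(2)[OF fk] by (intro mult_left_mono add_right_mono) auto
    also have "\<dots> = c * (LINT x|lebesgue. ?b x) + 2 powr p * 2 powr p * (s powr p * M)"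
      by (simp add: c_def algebra_simps)
    also have "\<dots> < e / 2 + e / 2"
      using ke s(2) c by (intro add_strict_mono) (simp_all add: field_simps)
    finally have "(LINT x|lebesgue. norm (convol ?m f x - f x) powr p) < e" by simp
    moreover have "0 \<le> (LINT x|lebesgue. norm (convol ?m f x - f x) powr p)"
      by (intro integral_nonneg_AE AE_I2) simp
    ultimately show "\<bar>LINT x|lebesgue. norm (convol ?m f x - f x) powr p\<bar> < e" by simp
  qed
qed

lemma convol_L1_tendsto:
  fixes f :: "real^'n \<Rightarrow> 'b::euclidean_space"
  assumes f: "integrable lebesgue f"
  shows "(\<lambda>n. LINT x|lebesgue. norm (convol (mollifier (inverse (Suc n))) f x - f x)) \<longlonglongrightarrow> 0"
  using convol_Lp_tendsto[of 1 f] f by (auto simp: abs_if)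

text \<open>On the ball of radius \<open>R\<close> a mollifier of radius at most 1 sees only the
  values of \<open>f\<close> on radius R + 1, so \<open>f\<close> may be cut off there and the
  global L^1 statement applies.\<close>

lemma convol_local_tendsto:
  fixes f :: "real^'n \<Rightarrow> 'b::euclidean_space"
  assumes f: "locint f"
  shows "(\<lambda>n. LINT x|lebesgue. indicator (cball 0 R) x *
    norm (convol (mollifier (inverse (Suc n))) f x - f x)) \<longlonglongrightarrow> 0"
proof -
  let ?F = "\<lambda>x. indicator (cball 0 (R + 1)) x *\<^sub>R f x"
  let ?m = "\<lambda>n. mollifier (inverse (real (Suc n)))"
  have F: "integrable lebesgue ?F"
    using f unfolding locint_def set_integrable_def by blast
  have eq: "indicator (cball 0 R) x * norm (convol (?m n) f x - f x)
      = indicator (cball 0 R) x * norm (convol (?m n) ?F x - ?F x)" for x n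
  proof (cases "norm x \<le> R")
    case True
    have "?m n (x - y) *\<^sub>R f y = ?m n (x - y) *\<^sub>R ?F y" for y
    proof (cases "norm y \<le> R + 1")
      case False
      then have "norm (x - y) \<ge> 1"
        using True norm_triangle_ineq2[of y x] by (simp add: norm_minus_commute)
      moreover have "inverse (real (Suc n)) \<le> 1" by (simp add: field_simps)
      ultimately have "?m n (x - y) = 0" by (intro mollifier_eq_0) auto
      then show ?thesis by simp
    qed simp
    then have "convol (?m n) f x = convol (?m n) ?F x"
      unfolding convol_def by presburger
    then show ?thesis using True by simp
  qed simp
  have ci: "integrable lebesgue (\<lambda>x. norm (convol (?m n) ?F x - ?F x))" for n
  proof -
    have "integrable lebesgue (\<lambda>x. norm (convol (?m n) ?F x) powr 1)"
    proof (rule convol_Lp_le(1))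
      show "integrable lebesgue (\<lambda>x. norm (?F x) powr 1)"
        using integrable_norm[OF F] by (simp only: powr_one norm_ge_zero)
    qed (use borel_measurable_integrable[OF F] in auto)
    then have n: "integrable lebesgue (\<lambda>x. norm (convol (?m n) ?F x))"
      by (simp only: powr_one norm_ge_zero)
    have "convol (?m n) ?F \<in> borel_measurable lebesgue"
      by (intro continuous_lebesgue_measurable convol_continuous[where r = "inverse (real (Suc n))"]
          continuous_mollifier integrable_locint F) (auto intro!: mollifier_eq_0')
    from iffD1[OF integrable_norm_iff[OF this] n] have "integrable lebesgue (convol (?m n) ?F)" .
    from integrable_norm[OF Bochner_Integration.integrable_diff[OF this F]] show ?thesis .
  qed
  show ?thesis
    unfolding eq
  proof (rule Lim_null_comparison[OF _ convol_L1_tendsto[OF F]], rule always_eventually, rule allI)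
    fix n
    have "(LINT x|lebesgue. indicator (cball 0 R) x * norm (convol (?m n) ?F x - ?F x))
        \<le> (LINT x|lebesgue. norm (convol (?m n) ?F x - ?F x))"
    proof (rule integral_mono[OF _ ci])
      show "integrable lebesgue (\<lambda>x. indicator (cball 0 R) x * norm (convol (?m n) ?F x - ?F x))"
        using integrable_mult_indicator[OF cball_sets_lebesgue ci[of n], of 0 R] by simp
    qed (simp add: indicator_def)
    moreover have "0 \<le> (LINT x|lebesgue. indicator (cball 0 R) x * norm (convol (?m n) ?F x - ?F x))"
      by (intro integral_nonneg_AE AE_I2) simp
    ultimately show "norm (LINT x|lebesgue. indicator (cball 0 R) x * norm (convol (?m n) ?F x - ?F x))
        \<le> (LINT x|lebesgue. norm (convol (?m n) ?F x - ?F x))" by simp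
  qed
qed

section \<open>Weak gradients\<close>

lemma has_derivative_inner_lim:
  fixes f :: "real^'n \<Rightarrow> real"
  assumes "(f has_derivative (\<lambda>v. v \<bullet> G)) (at x)"
  shows "(\<lambda>n. (f (x + inverse (real (Suc n)) *\<^sub>R v) - f x) / inverse (real (Suc n))) \<longlonglongrightarrow> v \<bullet> G"
proof -
  have "((\<lambda>s. x + s *\<^sub>R v) has_derivative (\<lambda>h. h *\<^sub>R v)) (at 0)"
    by (auto intro!: derivative_eq_intros)
  from has_derivative_compose[OF this, of f "\<lambda>v. v \<bullet> G"] assms
  have "((\<lambda>s. f (x + s *\<^sub>R v)) has_derivative (\<lambda>h. h * (v \<bullet> G))) (at 0)" by simp
  moreover have "(\<lambda>h. h * c) = (*) c" for c :: real by (auto simp: mult.commute)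
  ultimately have "((\<lambda>s. f (x + s *\<^sub>R v)) has_real_derivative v \<bullet> G) (at 0)"
    by (simp add: has_field_derivative_def)
  then have *: "((\<lambda>h. (f (x + h *\<^sub>R v) - f x) / h) \<longlongrightarrow> v \<bullet> G) (at 0)"
    by (simp add: DERIV_def)
  have "filterlim (\<lambda>n. inverse (real (Suc n))) (at 0) sequentially"
    using LIMSEQ_inverse_real_of_nat by (intro filterlim_atI) auto
  from filterlim_compose[OF * this] show ?thesis .
qed

text \<open>By translation invariance every difference quotient of \<open>f\<close> has integral 0,
  and the quotients converge to the directional derivative under a common integrable bound.\<close>

lemma integral_gradient_eq_0:
  fixes f :: "real^'n \<Rightarrow> real"
  assumes f: "\<And>x. (f has_derivative (\<lambda>v. v \<bullet> G x)) (at x)" "\<And>x. norm x > R \<Longrightarrow> f x = 0"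
    and G: "continuous_on UNIV G" "\<And>x. norm x > R \<Longrightarrow> G x = 0"
  shows "(LINT x|lebesgue. G x) = 0"
proof -
  have Gi: "integrable lebesgue G" by (rule integrable_compactly_supported[OF G])
  have fc: "continuous_on UNIV f"
    using f(1) has_derivative_continuous by (blast intro: continuous_at_imp_continuous_on)
  have fb: "f \<in> borel_measurable borel" using fc by (rule borel_measurable_continuous_onI)
  obtain B where B: "0 \<le> B" "\<And>x. norm (G x) \<le> B"
    using compactly_supported_bounded[OF G] by blast
  have "v \<bullet> (LINT x|lebesgue. G x) = 0" for v
  proof -
    let ?h = "\<lambda>n. inverse (real (Suc n))"
    let ?s = "\<lambda>n x. (f (x + ?h n *\<^sub>R v) - f x) / ?h n"
    have h: "0 < ?h n" "?h n \<le> 1" for n by (auto simp: field_simps)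
    have fi: "integrable lebesgue f" by (rule integrable_compactly_supported[OF fc f(2)])
    have ti: "integrable lebesgue (\<lambda>x. f (x + a))" for a
      using shift_support[where x = "- a" and r = R]
      by (intro integrable_compactly_supported[where R = "norm a + R"] continuous_on_compose2[OF fc] f(2))
         (auto intro!: continuous_intros simp: norm_minus_commute add.commute)
    have "(LINT x|lebesgue. f (x + a)) = (LINT x|lebesgue. f x)" for a
    proof -
      have "(\<lambda>x. f (x + a)) \<in> borel_measurable borel" using fb by measurable
      then show ?thesis
        using lborel_integral_translation[OF fb, of a]
        by (simp add: lebesgue_integral_borel(1) fb add.commute[of _ a])
    qed
    then have zero: "(LINT x|lebesgue. ?s n x) = 0" for n
      using ti[of "?h n *\<^sub>R v"] fi by simp
    \<comment> \<open>The mean value theorem bounds the quotient by B |v|. Since the step lengths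
      are at most 1, all quotients vanish outside radius R + |v|.\<close>
    have mv: "\<bar>?s n x\<bar> \<le> (B * norm v) * indicator (cball 0 (R + norm v)) x" for n x
    proof -
      obtain s where s: "0 < s" "s < 1"
        "f (x + ?h n *\<^sub>R v) - f x = (?h n *\<^sub>R v) \<bullet> G (x + s *\<^sub>R (?h n *\<^sub>R v))"
        using mean_value_inner[OF f(1)] by metis
      then have eq: "?s n x = v \<bullet> G (x + s *\<^sub>R (?h n *\<^sub>R v))" using h[of n] by simp
      show ?thesis
      proof (cases "norm x \<le> R + norm v")
        case True
        have "\<bar>v \<bullet> G (x + s *\<^sub>R (?h n *\<^sub>R v))\<bar> \<le> norm v * norm (G (x + s *\<^sub>R (?h n *\<^sub>R v)))"
          by (rule Cauchy_Schwarz_ineq2)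
        also have "\<dots> \<le> norm v * B" using B(2) by (intro mult_left_mono) auto
        finally show ?thesis using True eq by (simp add: mult.commute)
      next
        case False
        have "s * ?h n \<le> 1 * 1" using s h[of n] by (intro mult_mono) auto
        then have "norm (s *\<^sub>R (?h n *\<^sub>R v)) \<le> 1 * norm v"
          unfolding scaleR_scaleR norm_scaleR using s h(1)[of n] by (intro mult_right_mono) auto
        then have "norm (x + s *\<^sub>R (?h n *\<^sub>R v)) > R"
          using False norm_triangle_ineq2[of x "- (s *\<^sub>R (?h n *\<^sub>R v))"] by simp
        then show ?thesis using G(2) eq False by simp
      qed
    qed
    have "(\<lambda>n. LINT x|lebesgue. ?s n x) \<longlonglongrightarrow> (LINT x|lebesgue. v \<bullet> G x)"
    proof (rule integral_dominated_convergence[where w = "\<lambda>x. (B * norm v) * indicator (cball 0 (R + norm v)) x"])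
      show "(\<lambda>x. v \<bullet> G x) \<in> borel_measurable lebesgue" using Gi by measurable
      show "?s n \<in> borel_measurable lebesgue" for n
        using borel_measurable_integrable[OF ti[of "?h n *\<^sub>R v"]] borel_measurable_integrable[OF fi]
        by measurable
      show "integrable lebesgue (\<lambda>x::real^'n. (B * norm v) * indicator (cball 0 (R + norm v)) x :: real)"
        by (intro integrable_mult_right integrable_indicator_cball)
      show "AE x in lebesgue. (\<lambda>n. ?s n x) \<longlonglongrightarrow> v \<bullet> G x"
        using has_derivative_inner_lim[OF f(1)] by (intro AE_I2) auto
    qed (use mv in auto)
    then have "(LINT x|lebesgue. v \<bullet> G x) = 0" using LIMSEQ_unique[OF tendsto_const] unfolding zero by metis
    then show ?thesis using Gi by simp
  qed
  then show ?thesis using inner_eq_zero_iff by blast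
qed

text \<open>The product of \<open>u\<close> and \<open>\<psi>\<close> is C^1 with compact support,
  so its gradient has integral 0.\<close>

lemma integration_by_parts:
  fixes u :: "real^'n \<Rightarrow> real"
  assumes u: "\<And>x. (u has_derivative (\<lambda>v. v \<bullet> G x)) (at x)" "continuous_on UNIV G"
    and \<psi>: "smooth \<psi>" "\<And>x. norm x > R \<Longrightarrow> \<psi> x = 0"
  shows "(LINT x|lebesgue. u x *\<^sub>R grad \<psi> x) = - (LINT x|lebesgue. \<psi> x *\<^sub>R G x)"
proof -
  have uc: "continuous_on UNIV u"
    using u(1) has_derivative_continuous by (blast intro: continuous_at_imp_continuous_on)
  have "(LINT x|lebesgue. u x *\<^sub>R grad \<psi> x + \<psi> x *\<^sub>R G x) = 0"
  proof (rule integral_gradient_eq_0[where f = "\<lambda>x. u x * \<psi> x" and R = R])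
    show "((\<lambda>x. u x * \<psi> x) has_derivative (\<lambda>v. v \<bullet> (u x *\<^sub>R grad \<psi> x + \<psi> x *\<^sub>R G x))) (at x)" for x
      using has_derivative_mult[OF u(1) smooth_has_grad[OF \<psi>(1)], of x]
      by (simp add: inner_add_right mult.commute)
    show "continuous_on UNIV (\<lambda>x. u x *\<^sub>R grad \<psi> x + \<psi> x *\<^sub>R G x)"
      using uc u(2) continuous_on_grad[OF \<psi>(1)] smooth_continuous[OF \<psi>(1)]
      by (intro continuous_intros)
  qed (use \<psi>(2) grad_eq_0_outside[of R \<psi>] in auto)
  moreover have "integrable lebesgue (\<lambda>x. u x *\<^sub>R grad \<psi> x)"
    by (rule locint_mult_continuous'[OF continuous_locint[OF uc] continuous_on_grad[OF \<psi>(1)] grad_eq_0_outside[of R, OF \<psi>(2)]])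
  moreover have "integrable lebesgue (\<lambda>x. \<psi> x *\<^sub>R G x)"
    by (rule locint_mult_continuous[OF continuous_locint[OF u(2)] smooth_continuous[OF \<psi>(1)] \<psi>(2)])
  ultimately show ?thesis by (simp add: eq_neg_iff_add_eq_0)
qed

text \<open>The whole-space weak gradient as a relation: the representative \<open>g\<close> stays
  explicit and the choice made by \<open>weak_grad\<close> is avoided. The calculus of chain rule,
  minimum and maximum is developed for this relation and restricted to \<open>\<Omega>\<close> only
  at the end.\<close>

definition wgrad :: "(real^'n \<Rightarrow> real) \<Rightarrow> (real^'n \<Rightarrow> real^'n) \<Rightarrow> bool" where
  "wgrad u g \<longleftrightarrow> locint u \<and> locint g \<and>
    (\<forall>\<psi> R. smooth \<psi> \<longrightarrow> (\<forall>x. norm x > R \<longrightarrow> \<psi> x = 0) \<longrightarrow>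
      (LINT x|lebesgue. u x *\<^sub>R grad \<psi> x) = - (LINT x|lebesgue. \<psi> x *\<^sub>R g x))"

lemma wgradD:
  assumes "wgrad u g" "smooth \<psi>" "\<forall>x. norm x > R \<longrightarrow> \<psi> x = 0"
  shows "(LINT x|lebesgue. u x *\<^sub>R grad \<psi> x) = - (LINT x|lebesgue. \<psi> x *\<^sub>R g x)"
  using assms unfolding wgrad_def by blast

lemma wgrad_locint: "wgrad u g \<Longrightarrow> locint u" "wgrad u g \<Longrightarrow> locint g"
  by (simp_all add: wgrad_def)

lemma wgrad_C1:
  assumes "\<And>x. (u has_derivative (\<lambda>v. v \<bullet> G x)) (at x)" "continuous_on UNIV G"
  shows "wgrad u G"
proof -
  have "continuous_on UNIV u"
    using assms(1) has_derivative_continuous by (blast intro: continuous_at_imp_continuous_on)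
  then show ?thesis
    unfolding wgrad_def using assms(2)
    by (intro conjI allI impI integration_by_parts[OF assms] continuous_locint) auto
qed

lemma wgrad_smooth: "smooth \<psi> \<Longrightarrow> wgrad \<psi> (grad \<psi>)"
  by (intro wgrad_C1 smooth_has_grad continuous_on_grad)

lemma wgrad_affine: "wgrad (\<lambda>x. x \<bullet> a + c) (\<lambda>_. a)"
  by (rule wgrad_C1) (auto intro!: derivative_eq_intros)

lemma test_integrable:
  assumes "smooth \<psi>" "\<forall>x. norm x > R \<longrightarrow> \<psi> x = 0"
  shows "locint u \<Longrightarrow> integrable lebesgue (\<lambda>x. u x *\<^sub>R grad \<psi> x)"
    "locint g \<Longrightarrow> integrable lebesgue (\<lambda>x. \<psi> x *\<^sub>R g x)"
proof -
  show "integrable lebesgue (\<lambda>x. u x *\<^sub>R grad \<psi> x)" if "locint u"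
    using that assms(2) grad_eq_0_outside[of R \<psi>]
    by (intro locint_mult_continuous'[where R = R] continuous_on_grad[OF assms(1)]) auto
  show "integrable lebesgue (\<lambda>x. \<psi> x *\<^sub>R g x)" if "locint g"
    using that assms(2)
    by (intro locint_mult_continuous[where R = R] smooth_continuous[OF assms(1)]) auto
qed

lemma locint_add: "locint f \<Longrightarrow> locint g \<Longrightarrow> locint (\<lambda>x. f x + g x)"
  unfolding locint_def by (intro allI set_integral_add(1)) auto

lemma locint_cmul:
  assumes "locint f" shows "locint (\<lambda>x. c *\<^sub>R f x)"
  unfolding locint_def set_integrable_def
proof
  fix R
  have "integrable lebesgue (\<lambda>x. c *\<^sub>R (indicat_real (cball 0 R) x *\<^sub>R f x))"
    using assms unfolding locint_def set_integrable_def by (intro integrable_scaleR_right) blast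
  then show "integrable lebesgue (\<lambda>x. indicat_real (cball 0 R) x *\<^sub>R (c *\<^sub>R f x))"
    by (simp only: scaleR_left_commute[of c])
qed

lemma wgrad_add:
  assumes "wgrad u g" "wgrad v h"
  shows "wgrad (\<lambda>x. u x + v x) (\<lambda>x. g x + h x)"
  unfolding wgrad_def
proof (intro conjI allI impI)
  fix \<psi> :: "real^'a \<Rightarrow> real" and R assume \<psi>: "smooth \<psi>" "\<forall>x. norm x > R \<longrightarrow> \<psi> x = 0"
  note ti = test_integrable[OF \<psi>]
  show "(LINT x|lebesgue. (u x + v x) *\<^sub>R grad \<psi> x) = - (LINT x|lebesgue. \<psi> x *\<^sub>R (g x + h x))"
    using wgradD[OF assms(1) \<psi>] wgradD[OF assms(2) \<psi>]
      ti(1)[OF wgrad_locint(1)[OF assms(1)]] ti(2)[OF wgrad_locint(2)[OF assms(1)]]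
      ti(1)[OF wgrad_locint(1)[OF assms(2)]] ti(2)[OF wgrad_locint(2)[OF assms(2)]]
    by (simp add: scaleR_add_left scaleR_add_right)
qed (use assms in \<open>auto intro!: locint_add dest: wgrad_locint\<close>)

lemma wgrad_cmul:
  assumes "wgrad u g"
  shows "wgrad (\<lambda>x. c * u x) (\<lambda>x. c *\<^sub>R g x)"
  unfolding wgrad_def
proof (intro conjI allI impI)
  fix \<psi> :: "real^'a \<Rightarrow> real" and R assume \<psi>: "smooth \<psi>" "\<forall>x. norm x > R \<longrightarrow> \<psi> x = 0"
  have "(LINT x|lebesgue. (c * u x) *\<^sub>R grad \<psi> x) = c *\<^sub>R (LINT x|lebesgue. u x *\<^sub>R grad \<psi> x)"
    by (simp only: scaleR_scaleR[symmetric] integral_scaleR_right)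
  also have "(LINT x|lebesgue. u x *\<^sub>R grad \<psi> x) = - (LINT x|lebesgue. \<psi> x *\<^sub>R g x)"
    using wgradD[OF assms \<psi>(1)] \<psi>(2) by blast
  also have "c *\<^sub>R \<dots> = - (LINT x|lebesgue. \<psi> x *\<^sub>R (c *\<^sub>R g x))"
    by (simp only: scaleR_left_commute[of _ c] integral_scaleR_right scaleR_minus_right)
  finally show "(LINT x|lebesgue. (c * u x) *\<^sub>R grad \<psi> x) = - (LINT x|lebesgue. \<psi> x *\<^sub>R (c *\<^sub>R g x))" .
qed (use assms locint_cmul[of u c] in \<open>auto intro!: locint_cmul dest: wgrad_locint\<close>)

lemma wgrad_uminus: "wgrad u g \<Longrightarrow> wgrad (\<lambda>x. - u x) (\<lambda>x. - g x)"
  using wgrad_cmul[of u g "-1"] by simp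

lemma wgrad_diff: "wgrad u g \<Longrightarrow> wgrad v h \<Longrightarrow> wgrad (\<lambda>x. u x - v x) (\<lambda>x. g x - h x)"
  using wgrad_add[OF _ wgrad_uminus, of u g v h] by simp

lemma locint_cong_AE:
  assumes "locint f" "g \<in> borel_measurable lebesgue" "AE x in lebesgue. f x = g x"
  shows "locint g"
  using assms unfolding locint_def set_integrable_def
proof safe
  fix R
  assume "\<forall>R. integrable lebesgue (\<lambda>x. indicat_real (cball 0 R) x *\<^sub>R f x)"
  then have i: "integrable lebesgue (\<lambda>x. indicat_real (cball 0 R) x *\<^sub>R f x)" by blast
  show "integrable lebesgue (\<lambda>x. indicat_real (cball 0 R) x *\<^sub>R g x)"
  proof (rule integrable_cong_AE_imp[OF i])
    show "(\<lambda>x. indicat_real (cball 0 R) x *\<^sub>R g x) \<in> borel_measurable lebesgue"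
      using assms(2) by measurable
  qed (use assms(3) in \<open>auto elim: eventually_mono\<close>)
qed

text \<open>Allows the boundary datum, which is bounded only almost everywhere, to be exchanged for
  a representative that is bounded at every point.\<close>

lemma wgrad_cong_AE:
  assumes w: "wgrad u g" and m: "v \<in> borel_measurable lebesgue" "h \<in> borel_measurable lebesgue"
    and AE: "AE x in lebesgue. u x = v x" "AE x in lebesgue. g x = h x"
  shows "wgrad v h"
  unfolding wgrad_def
proof (intro conjI allI impI)
  fix \<psi> :: "real^'a \<Rightarrow> real" and R assume \<psi>: "smooth \<psi>" "\<forall>x. norm x > R \<longrightarrow> \<psi> x = 0"
  have mm: "\<psi> \<in> borel_measurable lebesgue" "grad \<psi> \<in> borel_measurable lebesgue"
    "u \<in> borel_measurable lebesgue" "g \<in> borel_measurable lebesgue"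
    using continuous_lebesgue_measurable[OF smooth_continuous[OF \<psi>(1)]]
      continuous_lebesgue_measurable[OF continuous_on_grad[OF \<psi>(1)]]
      locint_measurable[OF wgrad_locint(1)[OF w]] locint_measurable[OF wgrad_locint(2)[OF w]] by auto
  have "(LINT x|lebesgue. v x *\<^sub>R grad \<psi> x) = (LINT x|lebesgue. u x *\<^sub>R grad \<psi> x)"
    using mm m AE(1) by (intro integral_cong_AE) (auto elim: eventually_mono)
  also have "\<dots> = - (LINT x|lebesgue. \<psi> x *\<^sub>R g x)"
    using wgradD[OF w \<psi>(1)] \<psi>(2) by blast
  also have "(LINT x|lebesgue. \<psi> x *\<^sub>R g x) = (LINT x|lebesgue. \<psi> x *\<^sub>R h x)"
    using mm m AE(2) by (intro integral_cong_AE) (auto elim: eventually_mono)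
  finally show "(LINT x|lebesgue. v x *\<^sub>R grad \<psi> x) = - (LINT x|lebesgue. \<psi> x *\<^sub>R h x)" .
qed (use assms locint_cong_AE wgrad_locint in blast)+

text \<open>Mollifying at \<open>x\<close> means testing with y |-> mollifier r (x - y).\<close>

lemma smooth_reflect:
  assumes "smooth k"
  shows "smooth (\<lambda>y. k (x - y))" "grad (\<lambda>y. k (x - y)) y = - grad k (x - y)"
proof -
  have D: "((\<lambda>y. k (x - y)) has_derivative (\<lambda>v. v \<bullet> (- grad k (x - y)))) (at y)" if "smooth k" for k y
  proof -
    have "((\<lambda>y. x - y) has_derivative (\<lambda>v. - v)) (at y)"
      by (auto intro!: derivative_eq_intros)
    from has_derivative_compose[OF this smooth_has_grad[OF that]]
    show ?thesis by simp
  qed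
  show "grad (\<lambda>y. k (x - y)) y = - grad k (x - y)" by (rule grad_eqI[OF D[OF assms]])
  let ?S = "{\<lambda>y. k (x - y) | k. smooth k}"
  show "smooth (\<lambda>y. k (x - y))"
  proof (rule smoothI)
    show "(\<lambda>y. k (x - y)) \<in> ?S" using assms by blast
    fix h :: "real^'a \<Rightarrow> real" and y assume "h \<in> ?S"
    then show "h differentiable (at y)" using D by (auto simp: differentiable_def)
  next
    fix h :: "real^'a \<Rightarrow> real" and v assume "h \<in> ?S"
    then obtain k where k: "h = (\<lambda>y. k (x - y))" "smooth k" by blast
    have "frechet_derivative h (at y) v = frechet_derivative k (at (x - y)) (- v)" for y
      using frechet_derivative_at[OF D[OF k(2)], of y, symmetric] smooth_differentiable[OF k(2)]
      by (simp add: k(1) frechet_derivative_eq_grad)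
    then show "(\<lambda>y. frechet_derivative h (at y) v) \<in> ?S"
      using smooth_frechet_derivative[OF k(2), of "- v"]
      by (intro CollectI exI[of _ "\<lambda>z. frechet_derivative k (at z) (- v)"]) auto
  qed
qed

text \<open>Test the weak gradient identity with the reflected kernel; the sign coming from the
  reflection cancels the sign of the integration by parts.\<close>

lemma grad_mollified:
  assumes w: "wgrad u g" and r: "0 < r"
  shows "smooth (convol (mollifier r) u)" "grad (convol (mollifier r) u) x = convol (mollifier r) g x"
proof -
  note cs = convol_smooth[OF smooth_mollifier mollifier_eq_0'[OF r] wgrad_locint(1)[OF w]]
  show "smooth (convol (mollifier r) u)" by (rule cs(1))
  let ?\<psi> = "\<lambda>y. mollifier r (x - y)"
  have "norm y > norm x + r \<Longrightarrow> ?\<psi> y = 0" for y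
    using shift_support[of x r y] mollifier_eq_0'[OF r] by blast
  then have "\<forall>y. norm y > norm x + r \<longrightarrow> ?\<psi> y = 0" by blast
  from wgradD[OF w smooth_reflect(1)[OF smooth_mollifier] this]
  have "(LINT y|lebesgue. u y *\<^sub>R (- grad (mollifier r) (x - y))) = - (LINT y|lebesgue. ?\<psi> y *\<^sub>R g y)"
    by (simp only: smooth_reflect(2)[OF smooth_mollifier])
  then show "grad (convol (mollifier r) u) x = convol (mollifier r) g x"
    by (simp add: cs(2) convol_def)
qed

lemma integral_tendsto_of_bound:
  fixes K :: "nat \<Rightarrow> 'a \<Rightarrow> 'b::{banach, second_countable_topology}"
  assumes "\<And>n. integrable M (K n)" "integrable M K'" "\<And>n. integrable M (E n)"
    and le: "\<And>n x. norm (K n x - K' x) \<le> E n x" and E: "(\<lambda>n. LINT x|M. E n x) \<longlonglongrightarrow> 0"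
  shows "(\<lambda>n. LINT x|M. K n x) \<longlonglongrightarrow> (LINT x|M. K' x)"
proof (rule LIM_zero_cancel, rule Lim_null_comparison[OF _ E], rule always_eventually, rule allI)
  fix n
  have "norm ((LINT x|M. K n x) - (LINT x|M. K' x)) = norm (LINT x|M. K n x - K' x)"
    using assms by simp
  also have "\<dots> \<le> (LINT x|M. norm (K n x - K' x))" by (rule integral_norm_bound)
  also have "\<dots> \<le> (LINT x|M. E n x)"
    using assms by (intro integral_mono) auto
  finally show "norm ((LINT x|M. K n x) - (LINT x|M. K' x)) \<le> (LINT x|M. E n x)" .
qed

lemma integral_tendsto_0_of_bound:
  fixes K :: "nat \<Rightarrow> 'a \<Rightarrow> real"
  assumes "\<And>n. integrable M (K n)" "\<And>n. integrable M (E n)"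
    and le: "\<And>n x. 0 \<le> K n x" "\<And>n x. K n x \<le> E n x" and E: "(\<lambda>n. LINT x|M. E n x) \<longlonglongrightarrow> 0"
  shows "(\<lambda>n. LINT x|M. K n x) \<longlonglongrightarrow> 0"
proof -
  have "(\<lambda>n. LINT x|M. K n x) \<longlonglongrightarrow> (LINT x|M. 0)"
    using assms by (intro integral_tendsto_of_bound[where E = E]) auto
  then show ?thesis by simp
qed

lemma locint_norm_integrable:
  assumes "locint f" shows "integrable lebesgue (\<lambda>x. indicator (cball 0 R) x * norm (f x))"
proof -
  have "integrable lebesgue (\<lambda>x. indicator (cball 0 R) x *\<^sub>R f x)"
    using assms unfolding locint_def set_integrable_def by blast
  from integrable_norm[OF this] show ?thesis by simp
qed

lemma locint_diff: "locint f \<Longrightarrow> locint g \<Longrightarrow> locint (\<lambda>x. f x - g x)"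
  using locint_add[OF _ locint_cmul, of f g "-1"] by simp

lemma locint_bound:
  fixes f :: "real^'n \<Rightarrow> 'b::euclidean_space" and g :: "real^'n \<Rightarrow> 'c::euclidean_space"
  assumes "locint f" "g \<in> borel_measurable lebesgue" "\<And>x. norm (g x) \<le> norm (f x)"
  shows "locint g"
  unfolding locint_def set_integrable_def
proof
  fix R
  show "integrable lebesgue (\<lambda>x. indicat_real (cball 0 R) x *\<^sub>R g x)"
  proof (rule Bochner_Integration.integrable_bound)
    show "integrable lebesgue (\<lambda>x. indicat_real (cball 0 R) x *\<^sub>R f x)"
      using assms(1) unfolding locint_def set_integrable_def by blast
    show "(\<lambda>x. indicat_real (cball 0 R) x *\<^sub>R g x) \<in> borel_measurable lebesgue"
      using assms(2) by measurable
  qed (use assms(3) in \<open>auto simp: indicator_def\<close>)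
qed

text \<open>Stated for one fixed test function, because the chain rule selects its almost everywhere
  convergent subsequence only after the ball containing the support of \<open>\<psi>\<close> is
  known.\<close>

lemma wgrad_limit_test:
  assumes eq: "\<And>n. (LINT x|lebesgue. u n x *\<^sub>R grad \<psi> x) = - (LINT x|lebesgue. \<psi> x *\<^sub>R g n x)"
    and \<psi>: "smooth \<psi>" "\<forall>x. norm x > R \<longrightarrow> \<psi> x = 0"
    and loc: "\<And>n. locint (u n)" "\<And>n. locint (g n)" "locint u'" "locint g'"
    and lim: "(\<lambda>n. LINT x|lebesgue. indicator (cball 0 R) x * norm (u n x - u' x)) \<longlonglongrightarrow> 0"
      "(\<lambda>n. LINT x|lebesgue. indicator (cball 0 R) x * norm (g n x - g' x)) \<longlonglongrightarrow> 0"
  shows "(LINT x|lebesgue. u' x *\<^sub>R grad \<psi> x) = - (LINT x|lebesgue. \<psi> x *\<^sub>R g' x)"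
proof -
  have \<psi>0: "norm x > R \<Longrightarrow> \<psi> x = 0" for x using \<psi>(2) by blast
  have g0: "norm x > R \<Longrightarrow> grad \<psi> x = 0" for x
    using grad_eq_0_outside[of R \<psi>, OF \<psi>0] by blast
  obtain B1 where B1: "0 \<le> B1" "\<And>x. norm (\<psi> x) \<le> B1"
    using compactly_supported_bounded[of \<psi> R, OF smooth_continuous[OF \<psi>(1)] \<psi>0] by blast
  obtain B2 where B2: "0 \<le> B2" "\<And>x. norm (grad \<psi> x) \<le> B2"
    using compactly_supported_bounded[of "grad \<psi>" R, OF continuous_on_grad[OF \<psi>(1)] g0] by blast
  have "(\<lambda>n. LINT x|lebesgue. u n x *\<^sub>R grad \<psi> x) \<longlonglongrightarrow> (LINT x|lebesgue. u' x *\<^sub>R grad \<psi> x)"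
  proof (rule integral_tendsto_of_bound[where E = "\<lambda>n x. B2 * (indicator (cball 0 R) x * norm (u n x - u' x))"])
    show "norm (u n x *\<^sub>R grad \<psi> x - u' x *\<^sub>R grad \<psi> x) \<le> B2 * (indicator (cball 0 R) x * norm (u n x - u' x))" for n x
      using mult_right_mono[OF B2(2), of "norm (u n x - u' x)" x] g0[of x]
      by (cases "norm x \<le> R") (auto simp: scaleR_diff_left[symmetric] mult.commute)
    show "(\<lambda>n. LINT x|lebesgue. B2 * (indicator (cball 0 R) x * norm (u n x - u' x))) \<longlonglongrightarrow> 0"
      using tendsto_mult_left[OF lim(1), of B2] by simp
    show "integrable lebesgue (\<lambda>x. B2 * (indicator (cball 0 R) x * norm (u n x - u' x)))" for n
      by (intro integrable_mult_right locint_norm_integrable locint_diff loc)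
  qed (intro test_integrable(1)[OF \<psi>] loc)+
  moreover have "(\<lambda>n. LINT x|lebesgue. \<psi> x *\<^sub>R g n x) \<longlonglongrightarrow> (LINT x|lebesgue. \<psi> x *\<^sub>R g' x)"
  proof (rule integral_tendsto_of_bound[where E = "\<lambda>n x. B1 * (indicator (cball 0 R) x * norm (g n x - g' x))"])
    show "norm (\<psi> x *\<^sub>R g n x - \<psi> x *\<^sub>R g' x) \<le> B1 * (indicator (cball 0 R) x * norm (g n x - g' x))" for n x
      using mult_right_mono[OF B1(2), of "norm (g n x - g' x)" x] \<psi>0[of x]
      by (cases "norm x \<le> R") (auto simp: scaleR_diff_right[symmetric])
    show "(\<lambda>n. LINT x|lebesgue. B1 * (indicator (cball 0 R) x * norm (g n x - g' x))) \<longlonglongrightarrow> 0"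
      using tendsto_mult_left[OF lim(2), of B1] by simp
    show "integrable lebesgue (\<lambda>x. B1 * (indicator (cball 0 R) x * norm (g n x - g' x)))" for n
      by (intro integrable_mult_right locint_norm_integrable locint_diff loc)
  qed (intro test_integrable(2)[OF \<psi>] loc)+
  ultimately show ?thesis
    using tendsto_minus LIMSEQ_unique unfolding eq by blast
qed

lemma wgrad_limit:
  assumes "\<And>n. wgrad (u n) (g n)" "locint u'" "locint g'"
    and "\<And>R. (\<lambda>n. LINT x|lebesgue. indicator (cball 0 R) x * norm (u n x - u' x)) \<longlonglongrightarrow> 0"
      "\<And>R. (\<lambda>n. LINT x|lebesgue. indicator (cball 0 R) x * norm (g n x - g' x)) \<longlonglongrightarrow> 0"
  shows "wgrad u' g'"
  unfolding wgrad_def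
proof (intro conjI allI impI)
  fix \<psi> :: "real^'a \<Rightarrow> real" and R assume \<psi>: "smooth \<psi>" "\<forall>x. norm x > R \<longrightarrow> \<psi> x = 0"
  show "(LINT x|lebesgue. u' x *\<^sub>R grad \<psi> x) = - (LINT x|lebesgue. \<psi> x *\<^sub>R g' x)"
    by (rule wgrad_limit_test[OF wgradD[OF assms(1) \<psi>] \<psi>])
       (use assms in \<open>auto dest: wgrad_locint\<close>)
qed (use assms in auto)

section \<open>Chain rule and lattice operations for weak gradients\<close>

lemma DERIV_abs_bound_lipschitz:
  fixes f :: "real \<Rightarrow> real"
  assumes "\<And>s. (f has_real_derivative f' s) (at s)" "\<And>s. \<bar>f' s\<bar> \<le> 1"
  shows "\<bar>f a - f b\<bar> \<le> \<bar>a - b\<bar>"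
  using field_differentiable_bound[of UNIV f f' 1 a b] assms by (auto simp: has_field_derivative_at_within)

text \<open>The rule is classical for the mollifications of \<open>u\<close>. In the limit their
  gradients converge in L^1 on balls, whereas the factors f'(v_n) converge only almost everywhere
  along a subsequence and are handled by dominated convergence. The bound 1 on f' is a
  normalisation.\<close>

lemma wgrad_chain:
  fixes u :: "real^'n \<Rightarrow> real"
  assumes w: "wgrad u g"
    and f: "\<And>s. (f has_real_derivative f' s) (at s)" "continuous_on UNIV f'" "\<And>s. \<bar>f' s\<bar> \<le> 1"
  shows "wgrad (\<lambda>x. f (u x)) (\<lambda>x. f' (u x) *\<^sub>R g x)"
proof -
  have fc: "continuous_on UNIV f" using f(1) DERIV_continuous_on by blast
  have um: "u \<in> borel_measurable lebesgue" and gm: "g \<in> borel_measurable lebesgue"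
    using w by (auto intro: locint_measurable dest: wgrad_locint)
  note lip = DERIV_abs_bound_lipschitz[OF f(1,3)]
  have comp_meas: "(\<lambda>x. h (v x)) \<in> borel_measurable lebesgue"
    if "continuous_on UNIV h" "v \<in> borel_measurable lebesgue" for h :: "real \<Rightarrow> real" and v :: "real^'n \<Rightarrow> real"
    using measurable_compose[OF that(2) borel_measurable_continuous_onI[OF that(1)]] .
  have lf: "locint (\<lambda>x. f (u x))"
  proof -
    have "locint (\<lambda>x. f (u x) - f 0)"
    proof (rule locint_bound[OF wgrad_locint(1)[OF w]])
      show "(\<lambda>x. f (u x) - f 0) \<in> borel_measurable lebesgue" using comp_meas[OF fc um] by measurable
      show "norm (f (u x) - f 0) \<le> norm (u x)" for x using lip[of "u x" 0] by simp
    qed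
    from locint_add[OF this continuous_locint[OF continuous_on_const[of UNIV "f 0"]]]
    show ?thesis by simp
  qed
  have fgb: "norm (f' a *\<^sub>R b) \<le> norm b" for a and b :: "real^'n"
    using f(3)[of a] mult_right_mono[of "\<bar>f' a\<bar>" 1 "norm b"] by simp
  have lg: "locint (\<lambda>x. f' (u x) *\<^sub>R g x)"
  proof (rule locint_bound[OF wgrad_locint(2)[OF w] _ fgb])
    show "(\<lambda>x. f' (u x) *\<^sub>R g x) \<in> borel_measurable lebesgue"
      using comp_meas[OF f(2) um] gm by measurable
  qed
  define v where "v n = convol (mollifier (inverse (real (Suc n)))) u" for n
  define h where "h n = convol (mollifier (inverse (real (Suc n)))) g" for n
  have v: "smooth (v n)" "grad (v n) = h n" for n
    unfolding v_def h_def using grad_mollified[OF w, of "inverse (real (Suc n))"] by auto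
  have vm: "v n \<in> borel_measurable lebesgue" for n
    using continuous_lebesgue_measurable[OF smooth_continuous[OF v(1)]] .
  have hc: "continuous_on UNIV (h n)" for n using continuous_on_grad[OF v(1), of UNIV n] v(2) by simp
  show ?thesis
    unfolding wgrad_def
  proof (intro conjI allI impI lf lg)
    fix \<psi> :: "real^'n \<Rightarrow> real" and R assume \<psi>: "smooth \<psi>" "\<forall>x. norm x > R \<longrightarrow> \<psi> x = 0"
    let ?I = "\<lambda>x::real^'n. indicator (cball 0 R) x :: real"
    have limu: "(\<lambda>n. LINT x|lebesgue. ?I x * norm (v n x - u x)) \<longlonglongrightarrow> 0"
      unfolding v_def by (rule convol_local_tendsto[OF wgrad_locint(1)[OF w]])
    have limg: "(\<lambda>n. LINT x|lebesgue. ?I x * norm (h n x - g x)) \<longlonglongrightarrow> 0"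
      unfolding h_def by (rule convol_local_tendsto[OF wgrad_locint(2)[OF w]])
    have "\<exists>r. strict_mono r \<and> (AE x in lebesgue. (\<lambda>n. ?I x * norm (v (r n) x - u x)) \<longlonglongrightarrow> 0)"
    proof (rule tendsto_L1_AE_subseq)
      show "integrable lebesgue (\<lambda>x. ?I x * norm (v n x - u x))" for n
        using locint_norm_integrable[OF locint_diff[OF continuous_locint[OF smooth_continuous[OF v(1)]] wgrad_locint(1)[OF w]]] .
    qed (use limu in auto)
    then obtain r :: "nat \<Rightarrow> nat" where r: "strict_mono r"
      "AE x in lebesgue. (\<lambda>n. ?I x * norm (v (r n) x - u x)) \<longlonglongrightarrow> 0" by blast
    show "(LINT x|lebesgue. f (u x) *\<^sub>R grad \<psi> x) = - (LINT x|lebesgue. \<psi> x *\<^sub>R (f' (u x) *\<^sub>R g x))"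
    proof (rule wgrad_limit_test[OF _ \<psi>])
      fix n
      have D: "((\<lambda>x. f (v (r n) x)) has_derivative (\<lambda>y. y \<bullet> (f' (v (r n) x) *\<^sub>R h (r n) x))) (at x)" for x
        using has_derivative_compose[OF smooth_has_grad[OF v(1)[of "r n"]] f(1)[unfolded has_field_derivative_def], of x]
        by (simp add: v(2) mult.commute)
      have C: "continuous_on UNIV (\<lambda>x. f' (v (r n) x) *\<^sub>R h (r n) x)"
        by (intro continuous_on_scaleR hc continuous_on_compose2[OF f(2) smooth_continuous[OF v(1)]]) auto
      note W = wgrad_C1[OF D C]
      show "(LINT x|lebesgue. f (v (r n) x) *\<^sub>R grad \<psi> x)
          = - (LINT x|lebesgue. \<psi> x *\<^sub>R (f' (v (r n) x) *\<^sub>R h (r n) x))"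
        by (rule wgradD[OF W \<psi>])
      show "locint (\<lambda>x. f (v (r n) x))" "locint (\<lambda>x. f' (v (r n) x) *\<^sub>R h (r n) x)"
        using wgrad_locint[OF W] by auto
    next
      show "locint (\<lambda>x. f (u x))" "locint (\<lambda>x. f' (u x) *\<^sub>R g x)" by (fact lf lg)+
      have uv: "integrable lebesgue (\<lambda>x. ?I x * norm (v n x - u x))" for n
        using locint_norm_integrable[OF locint_diff[OF continuous_locint[OF smooth_continuous[OF v(1)]] wgrad_locint(1)[OF w]]] .
      have hg: "integrable lebesgue (\<lambda>x. ?I x * norm (h n x - g x))" for n
        using locint_norm_integrable[OF locint_diff[OF continuous_locint[OF hc] wgrad_locint(2)[OF w]]] .
      show "(\<lambda>n. LINT x|lebesgue. ?I x * norm (f (v (r n) x) - f (u x))) \<longlonglongrightarrow> 0"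
      proof (rule integral_tendsto_0_of_bound)
        show "integrable lebesgue (\<lambda>x. ?I x * norm (f (v (r n) x) - f (u x)))" for n
          by (intro locint_norm_integrable locint_diff lf continuous_locint
              continuous_on_compose2[OF fc smooth_continuous[OF v(1)]]) auto
        show "?I x * norm (f (v (r n) x) - f (u x)) \<le> ?I x * norm (v (r n) x - u x)" for n x
          using lip by (intro mult_left_mono) auto
        show "(\<lambda>n. LINT x|lebesgue. ?I x * norm (v (r n) x - u x)) \<longlonglongrightarrow> 0"
          using LIMSEQ_subseq_LIMSEQ[OF limu r(1)] by (simp add: o_def)
      qed (use uv in auto)
      \<comment> \<open>The difference of the products splits into f'(v_n) (h_n - g), bounded by
        |h_n - g|, and (f'(v_n) - f'(u)) g. The norm of the second part is \<open>?D\<close>, which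
        2 |g| dominates.\<close>
      let ?D = "\<lambda>n x. ?I x * (\<bar>f' (v (r n) x) - f' (u x)\<bar> * norm (g x))"
      have Dm: "?D n \<in> borel_measurable lebesgue" for n
        using comp_meas[OF f(2) um] comp_meas[OF f(2) vm[of "r n"]] gm by measurable
      have Db: "norm (?D n x) \<le> 2 * (?I x * norm (g x))" for n x
      proof -
        have "\<bar>f' (v (r n) x) - f' (u x)\<bar> \<le> 2" using f(3)[of "v (r n) x"] f(3)[of "u x"] by linarith
        then have "\<bar>f' (v (r n) x) - f' (u x)\<bar> * norm (g x) \<le> 2 * norm (g x)" by (intro mult_right_mono) auto
        then show ?thesis by (auto simp: indicator_def)
      qed
      have gi: "integrable lebesgue (\<lambda>x. 2 * (?I x * norm (g x)))"
        by (intro integrable_mult_right locint_norm_integrable wgrad_locint(2)[OF w])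
      have Di: "integrable lebesgue (?D n)" for n
      proof (rule Bochner_Integration.integrable_bound[OF gi Dm], rule AE_I2)
        fix x show "norm (?D n x) \<le> norm (2 * (?I x * norm (g x)))"
          unfolding real_norm_def[of "2 * _"] by (rule order_trans[OF Db abs_ge_self])
      qed
      have "(\<lambda>n. LINT x|lebesgue. ?D n x) \<longlonglongrightarrow> (LINT x::real^'n|lebesgue. (0::real))"
      proof (rule integral_dominated_convergence[OF _ Dm gi])
        show "AE x in lebesgue. (\<lambda>n. ?D n x) \<longlonglongrightarrow> 0"
          using r(2)
        proof eventually_elim
          case (elim x)
          show ?case
          proof (cases "norm x \<le> R")
            case True
            then have "(\<lambda>n. norm (v (r n) x - u x)) \<longlonglongrightarrow> 0" using elim by simp
            from LIM_zero_cancel[OF tendsto_norm_zero_cancel[OF this]]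
            have lim: "(\<lambda>n. v (r n) x) \<longlonglongrightarrow> u x" .
            have "isCont f' (u x)" using f(2) by (simp add: continuous_on_eq_continuous_at)
            from tendsto_rabs_zero[OF LIM_zero[OF isCont_tendsto_compose[OF this lim]]]
            have "(\<lambda>n. \<bar>f' (v (r n) x) - f' (u x)\<bar>) \<longlonglongrightarrow> 0" .
            from tendsto_mult_left[OF tendsto_mult_right[OF this, of "norm (g x)"], of "?I x"]
            show ?thesis by simp
          qed simp
        qed
      qed (use Db in auto)
      then have D0: "(\<lambda>n. LINT x|lebesgue. ?D n x) \<longlonglongrightarrow> 0" by simp
      have hr: "(\<lambda>n. LINT x|lebesgue. ?I x * norm (h (r n) x - g x)) \<longlonglongrightarrow> 0"
        using LIMSEQ_subseq_LIMSEQ[OF limg r(1)] by (simp add: o_def)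
      have E0: "(\<lambda>n. LINT x|lebesgue. ?I x * norm (h (r n) x - g x) + ?D n x) \<longlonglongrightarrow> 0"
        using tendsto_add[OF hr D0] hg Di by simp
      show "(\<lambda>n. LINT x|lebesgue. ?I x * norm (f' (v (r n) x) *\<^sub>R h (r n) x - f' (u x) *\<^sub>R g x)) \<longlonglongrightarrow> 0"
      proof (rule Lim_null_comparison[OF _ E0], rule always_eventually, rule allI)
        fix n
        have lhs: "integrable lebesgue (\<lambda>x. ?I x * norm (f' (v (r n) x) *\<^sub>R h (r n) x - f' (u x) *\<^sub>R g x))"
          by (intro locint_norm_integrable locint_diff lg continuous_locint continuous_on_scaleR hc
              continuous_on_compose2[OF f(2) smooth_continuous[OF v(1)]]) auto
        have "(LINT x|lebesgue. ?I x * norm (f' (v (r n) x) *\<^sub>R h (r n) x - f' (u x) *\<^sub>R g x))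
            \<le> (LINT x|lebesgue. ?I x * norm (h (r n) x - g x) + ?D n x)"
        proof (rule integral_mono[OF lhs Bochner_Integration.integrable_add[OF hg Di]])
          fix x
          have "f' (v (r n) x) *\<^sub>R h (r n) x - f' (u x) *\<^sub>R g x
              = f' (v (r n) x) *\<^sub>R (h (r n) x - g x) + (f' (v (r n) x) - f' (u x)) *\<^sub>R g x"
            by (simp add: algebra_simps)
          also have "norm \<dots> \<le> norm (h (r n) x - g x) + \<bar>f' (v (r n) x) - f' (u x)\<bar> * norm (g x)"
            by (intro norm_triangle_mono fgb) simp
          finally show "?I x * norm (f' (v (r n) x) *\<^sub>R h (r n) x - f' (u x) *\<^sub>R g x)
              \<le> ?I x * norm (h (r n) x - g x) + ?D n x"
            by (auto simp: indicator_def)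
        qed
        moreover have "0 \<le> (LINT x|lebesgue. ?I x * norm (f' (v (r n) x) *\<^sub>R h (r n) x - f' (u x) *\<^sub>R g x))"
          by (intro integral_nonneg_AE AE_I2) simp
        ultimately show "norm (LINT x|lebesgue. ?I x * norm (f' (v (r n) x) *\<^sub>R h (r n) x - f' (u x) *\<^sub>R g x))
            \<le> (LINT x|lebesgue. ?I x * norm (h (r n) x - g x) + ?D n x)" by simp
      qed
    qed
  qed
qed

lemma max_sq_deriv: "((\<lambda>s::real. (max s 0)\<^sup>2) has_real_derivative 2 * max s 0) (at s)"
proof -
  consider "s > 0" | "s < 0" | "s = 0" by linarith
  then show ?thesis
  proof cases
    case 1
    have "eventually (\<lambda>s. (max s 0)\<^sup>2 = s\<^sup>2) (nhds s)"
      using eventually_nhds_in_open[of "{0<..}" s] 1 by (auto elim!: eventually_mono)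
    moreover have "((\<lambda>s. s\<^sup>2) has_real_derivative 2 * max s 0) (at s)"
      using 1 by (auto intro!: derivative_eq_intros)
    ultimately show ?thesis by (subst DERIV_cong_ev[OF refl _ refl])
  next
    case 2
    have "eventually (\<lambda>s::real. (max s 0)\<^sup>2 = 0) (nhds s)"
      using eventually_nhds_in_open[of "{..<0}" s] 2 by (auto elim!: eventually_mono)
    then show ?thesis using 2 by (subst DERIV_cong_ev[OF refl _ refl, where g = "\<lambda>_. 0"]) auto
  next
    case 3
    have "((\<lambda>h::real. max h 0) \<longlongrightarrow> max 0 0) (at 0)" by (intro tendsto_intros)
    then have l: "((\<lambda>h::real. max h 0) \<longlongrightarrow> 0) (at 0)" by simp
    have "((\<lambda>h::real. (max h 0)\<^sup>2 / h) \<longlongrightarrow> 0) (at 0)"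
      by (rule Lim_transform_eventually[OF l])
         (auto simp: eventually_at_filter max_def power2_eq_square)
    then show ?thesis using 3 by (simp add: DERIV_def)
  qed
qed

text \<open>A C^1 approximation of the positive part, uniformly within \<open>d\<close>. Its
  derivative lies between 0 and 1, is 0 for s <= 0, and tends to 1 for s > 0 as \<open>d\<close>
  tends to 0; the square root of a squared positive part has no corner at 0 once \<open>d\<close> is
  added.\<close>

definition pos_smooth :: "real \<Rightarrow> real \<Rightarrow> real" where
  "pos_smooth d s = sqrt ((max s 0)\<^sup>2 + d\<^sup>2) - d"

lemma pos_smooth_deriv:
  assumes "0 < d"
  shows "(pos_smooth d has_real_derivative max s 0 / sqrt ((max s 0)\<^sup>2 + d\<^sup>2)) (at s)"
proof -
  have q: "0 < (max s 0)\<^sup>2 + d\<^sup>2" using assms by (intro add_nonneg_pos) auto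
  have "((\<lambda>s. (max s 0)\<^sup>2 + d\<^sup>2) has_real_derivative 2 * max s 0) (at s)"
    using DERIV_add[OF max_sq_deriv DERIV_const] by simp
  note D = DERIV_chain2[OF DERIV_real_sqrt[OF q] this]
  have eq: "inverse z / 2 * (2 * m) = m / z" for z m :: real by (cases "z = 0") (simp_all add: field_simps)
  from DERIV_diff[OF D[unfolded eq] DERIV_const[of d]]
  show ?thesis unfolding pos_smooth_def by (simp only: diff_zero)
qed

lemma pos_smooth_deriv_le:
  assumes "0 < d"
  shows "\<bar>max s 0 / sqrt ((max s 0)\<^sup>2 + d\<^sup>2)\<bar> \<le> 1"
proof -
  have "max s 0 \<le> sqrt ((max s 0)\<^sup>2 + d\<^sup>2)" by (intro real_le_rsqrt) simp
  then show ?thesis using assms by (simp add: divide_le_eq_1 add_nonneg_pos)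
qed

lemma pos_smooth_approx:
  assumes "0 < d"
  shows "\<bar>pos_smooth d s - max s 0\<bar> \<le> d"
proof -
  have "max s 0 \<le> sqrt ((max s 0)\<^sup>2 + d\<^sup>2)" by (intro real_le_rsqrt) simp
  moreover have "sqrt ((max s 0)\<^sup>2 + d\<^sup>2) \<le> max s 0 + d"
    using assms by (intro real_le_lsqrt) (auto simp: power2_sum)
  ultimately show ?thesis unfolding pos_smooth_def by linarith
qed

text \<open>Apply the chain rule to \<open>pos_smooth\<close> and let \<open>d\<close> tend to 0.
  The derivatives already vanish on {u <= 0}, which is why the limit carries gradient 0 on the level
  set u = 0 as well.\<close>

lemma wgrad_pos_part:
  fixes u :: "real^'n \<Rightarrow> real"
  assumes w: "wgrad u g"
  shows "wgrad (\<lambda>x. max (u x) 0) (\<lambda>x. if u x > 0 then g x else 0)"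
proof -
  have um: "u \<in> borel_measurable lebesgue" and gm: "g \<in> borel_measurable lebesgue"
    using w by (auto intro: locint_measurable dest: wgrad_locint)
  let ?d = "\<lambda>n. inverse (real (Suc n))"
  let ?f' = "\<lambda>n s. max s 0 / sqrt ((max s 0)\<^sup>2 + (?d n)\<^sup>2)"
  have d: "0 < ?d n" for n by simp
  have Q: "0 < (max s 0)\<^sup>2 + (?d n)\<^sup>2" for s n using d[of n] by (intro add_nonneg_pos) auto
  have f'c: "continuous_on UNIV (?f' n)" for n
  proof (intro continuous_intros ballI)
    show "sqrt ((max s 0)\<^sup>2 + (?d n)\<^sup>2) \<noteq> 0" for s using Q[of s n] by simp
  qed
  have W: "wgrad (\<lambda>x. pos_smooth (?d n) (u x)) (\<lambda>x. ?f' n (u x) *\<^sub>R g x)" for n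
    by (rule wgrad_chain[OF w pos_smooth_deriv[OF d] f'c pos_smooth_deriv_le[OF d]])
  let ?G = "\<lambda>x. if u x > 0 then g x else 0"
  have Gm: "?G \<in> borel_measurable lebesgue" using um gm by measurable
  have lu: "locint (\<lambda>x. max (u x) 0)"
  proof (rule locint_bound[OF wgrad_locint(1)[OF w]])
    show "(\<lambda>x. max (u x) 0) \<in> borel_measurable lebesgue" using um by measurable
  qed (simp add: max_def)
  have lG: "locint ?G" by (rule locint_bound[OF wgrad_locint(2)[OF w] Gm]) simp
  show ?thesis
  proof (rule wgrad_limit[OF W lu lG])
    fix R
    let ?I = "\<lambda>x::real^'n. indicator (cball 0 R) x :: real"
    have I0: "(\<lambda>n. LINT x|lebesgue. ?d n * ?I x) \<longlonglongrightarrow> 0"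
      using tendsto_mult_right[OF LIMSEQ_inverse_real_of_nat, of "LINT x|lebesgue. ?I x"] by simp
    show "(\<lambda>n. LINT x|lebesgue. ?I x * norm (pos_smooth (?d n) (u x) - max (u x) 0)) \<longlonglongrightarrow> 0"
    proof (rule Lim_null_comparison[OF _ I0], rule always_eventually, rule allI)
      fix n
      have "(LINT x|lebesgue. ?I x * norm (pos_smooth (?d n) (u x) - max (u x) 0)) \<le> (LINT x|lebesgue. ?d n * ?I x)"
      proof (rule integral_mono)
        show "integrable lebesgue (\<lambda>x. ?I x * norm (pos_smooth (?d n) (u x) - max (u x) 0))"
          by (intro locint_norm_integrable locint_diff lu wgrad_locint(1)[OF W])
        show "integrable lebesgue (\<lambda>x. ?d n * ?I x)"
          by (intro integrable_mult_right integrable_indicator_cball)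
        show "?I x * norm (pos_smooth (?d n) (u x) - max (u x) 0) \<le> ?d n * ?I x" for x
          using pos_smooth_approx[OF d, of n "u x"] by (auto simp: indicator_def)
      qed
      moreover have "0 \<le> (LINT x|lebesgue. ?I x * norm (pos_smooth (?d n) (u x) - max (u x) 0))"
        by (intro integral_nonneg_AE AE_I2) simp
      ultimately show "norm (LINT x|lebesgue. ?I x * norm (pos_smooth (?d n) (u x) - max (u x) 0))
          \<le> (LINT x|lebesgue. ?d n * ?I x)" by simp
    qed
    have gi: "integrable lebesgue (\<lambda>x. 2 * (?I x * norm (g x)))"
      by (intro integrable_mult_right locint_norm_integrable wgrad_locint(2)[OF w])
    have "(\<lambda>n. LINT x|lebesgue. ?I x * norm (?f' n (u x) *\<^sub>R g x - ?G x)) \<longlonglongrightarrow> (LINT x::real^'n|lebesgue. (0::real))"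
    proof (rule integral_dominated_convergence[OF _ _ gi])
      show "(\<lambda>x. ?I x * norm (?f' n (u x) *\<^sub>R g x - ?G x)) \<in> borel_measurable lebesgue" for n
        by (rule borel_measurable_integrable[OF locint_norm_integrable[OF locint_diff[OF wgrad_locint(2)[OF W] lG]]])
      show "AE x in lebesgue. norm (?I x * norm (?f' n (u x) *\<^sub>R g x - ?G x)) \<le> 2 * (?I x * norm (g x))" for n
      proof (rule AE_I2)
        fix x
        have "norm (?f' n (u x) *\<^sub>R g x) \<le> 1 * norm (g x)"
          unfolding norm_scaleR by (intro mult_right_mono) (use pos_smooth_deriv_le[OF d] in auto)
        moreover have "norm (?G x) \<le> norm (g x)" by simp
        ultimately have "norm (?f' n (u x) *\<^sub>R g x - ?G x) \<le> 2 * norm (g x)"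
          using norm_triangle_ineq4[of "?f' n (u x) *\<^sub>R g x" "?G x"] by linarith
        then show "norm (?I x * norm (?f' n (u x) *\<^sub>R g x - ?G x)) \<le> 2 * (?I x * norm (g x))"
          by (auto simp: indicator_def)
      qed
      show "AE x in lebesgue. (\<lambda>n. ?I x * norm (?f' n (u x) *\<^sub>R g x - ?G x)) \<longlonglongrightarrow> 0"
      proof (rule AE_I2)
        fix x
        have "(\<lambda>n. ?f' n (u x)) \<longlonglongrightarrow> (if u x > 0 then 1 else 0)"
        proof (cases "u x > 0")
          case True
          have "(\<lambda>n. ?f' n (u x)) \<longlonglongrightarrow> max (u x) 0 / sqrt ((max (u x) 0)\<^sup>2 + 0\<^sup>2)"
            using True by (intro tendsto_intros LIMSEQ_inverse_real_of_nat) auto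
          then show ?thesis using True by simp
        qed simp
        then have "(\<lambda>n. ?f' n (u x) *\<^sub>R g x) \<longlonglongrightarrow> (if u x > 0 then 1 else 0) *\<^sub>R g x"
          by (intro tendsto_intros)
        then have "(\<lambda>n. ?f' n (u x) *\<^sub>R g x) \<longlonglongrightarrow> ?G x" by (cases "u x > 0") simp_all
        then have "(\<lambda>n. norm (?f' n (u x) *\<^sub>R g x - ?G x)) \<longlonglongrightarrow> 0"
          by (rule tendsto_norm_zero[OF LIM_zero])
        from tendsto_mult_left[OF this, of "?I x"]
        show "(\<lambda>n. ?I x * norm (?f' n (u x) *\<^sub>R g x - ?G x)) \<longlonglongrightarrow> 0" by simp
      qed
    qed simp
    then show "(\<lambda>n. LINT x|lebesgue. ?I x * norm (?f' n (u x) *\<^sub>R g x - ?G x)) \<longlonglongrightarrow> 0" by simp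
  qed
qed

lemma wgrad_min:
  assumes "wgrad u g" "wgrad v h"
  shows "wgrad (\<lambda>x. min (u x) (v x)) (\<lambda>x. if v x < u x then h x else g x)"
proof -
  have "wgrad (\<lambda>x. u x - max (u x - v x) 0) (\<lambda>x. g x - (if u x - v x > 0 then g x - h x else 0))"
    by (intro wgrad_diff wgrad_pos_part assms)
  moreover have "(\<lambda>x. u x - max (u x - v x) 0) = (\<lambda>x. min (u x) (v x))"
    "(\<lambda>x. g x - (if u x - v x > 0 then g x - h x else 0)) = (\<lambda>x. if v x < u x then h x else g x)"
    by (auto simp: fun_eq_iff)
  ultimately show ?thesis by simp
qed

lemma wgrad_max:
  assumes "wgrad u g" "wgrad v h"
  shows "wgrad (\<lambda>x. max (u x) (v x)) (\<lambda>x. if v x > u x then h x else g x)"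
proof -
  have "wgrad (\<lambda>x. u x + max (v x - u x) 0) (\<lambda>x. g x + (if v x - u x > 0 then h x - g x else 0))"
    by (intro wgrad_add wgrad_diff wgrad_pos_part assms)
  moreover have "(\<lambda>x. u x + max (v x - u x) 0) = (\<lambda>x. max (u x) (v x))"
    "(\<lambda>x. g x + (if v x - u x > 0 then h x - g x else 0)) = (\<lambda>x. if v x > u x then h x else g x)"
    by (auto simp: fun_eq_iff)
  ultimately show ?thesis by simp
qed

section \<open>Test functions and weak gradients on an open set\<close>

lemma test_functionsI:
  assumes "smooth \<psi>" "compact K" "K \<subseteq> \<Omega>" "\<And>x. x \<notin> K \<Longrightarrow> \<psi> x = 0"
  shows "\<psi> \<in> test_functions \<Omega>"
proof -
  have sub: "closure {x. \<psi> x \<noteq> 0} \<subseteq> K"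
    using assms by (intro closure_minimal compact_imp_closed) auto
  moreover have "{x. \<psi> x \<noteq> 0} \<subseteq> K" using assms(4) by blast
  then have "compact (closure {x. \<psi> x \<noteq> 0})"
    unfolding compact_closure by (rule bounded_subset[OF compact_imp_bounded[OF assms(2)]])
  ultimately show ?thesis
    using assms(1,3) unfolding test_functions_def smooth_def by blast
qed

lemma test_functionsE:
  assumes "\<psi> \<in> test_functions \<Omega>"
  obtains K R where "smooth \<psi>" "compact K" "K \<subseteq> \<Omega>" "\<And>x. x \<notin> K \<Longrightarrow> \<psi> x = 0"
    "\<And>x. x \<notin> K \<Longrightarrow> grad \<psi> x = 0" "\<forall>x. norm x > R \<longrightarrow> \<psi> x = 0"
proof -
  define K where "K = closure {x. \<psi> x \<noteq> 0}"
  have C: "smooth \<psi> \<and> compact K \<and> K \<subseteq> \<Omega>"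
    using assms unfolding test_functions_def smooth_def mem_Collect_eq K_def .
  note KC = C[THEN conjunct1] C[THEN conjunct2, THEN conjunct1] C[THEN conjunct2, THEN conjunct2]
  have 0: "\<psi> x = 0" if "x \<notin> K" for x
    using that subsetD[OF closure_subset, of x "{x. \<psi> x \<noteq> 0}"] K_def by auto
  have g0: "grad \<psi> x = 0" if "x \<notin> K" for x
  proof (rule grad_eqI)
    have "((\<lambda>_. 0) has_derivative (\<lambda>v. v \<bullet> (0::real^'a))) (at x)" by simp
    then show "(\<psi> has_derivative (\<lambda>v. v \<bullet> 0)) (at x)"
    proof (rule has_derivative_transform_within_open[where s = "- K"])
      show "open (- K)" by (simp add: K_def open_Compl)
    qed (use that 0 in auto)
  qed
  obtain R where "\<And>x. x \<in> K \<Longrightarrow> norm x \<le> R"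
    using compact_imp_bounded[OF KC(2)] unfolding bounded_iff by blast
  then have "\<forall>x. norm x > R \<longrightarrow> \<psi> x = 0" using 0 by force
  then show ?thesis using that KC 0 g0 by blast
qed

lemma test_functions_smooth: "\<psi> \<in> test_functions \<Omega> \<Longrightarrow> smooth \<psi>"
  by (erule test_functionsE)

lemma test_functions_outside:
  "\<psi> \<in> test_functions \<Omega> \<Longrightarrow> x \<notin> \<Omega> \<Longrightarrow> \<psi> x = 0"
  "\<psi> \<in> test_functions \<Omega> \<Longrightarrow> x \<notin> \<Omega> \<Longrightarrow> grad \<psi> x = 0"
  by (meson subsetD test_functionsE)+

lemma set_integrable_locint:
  "set_integrable lebesgue K f \<Longrightarrow> locint (\<lambda>x. indicator K x *\<^sub>R f x)"
  unfolding set_integrable_def by (rule integrable_locint)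

lemma test_locally_integrable:
  assumes "\<psi> \<in> test_functions \<Omega>"
  shows "locally_integrable \<Omega> f \<Longrightarrow> integrable lebesgue (\<lambda>x. \<psi> x *\<^sub>R f x)"
    "locally_integrable \<Omega> u \<Longrightarrow> integrable lebesgue (\<lambda>x. u x *\<^sub>R grad \<psi> x)"
proof -
  obtain K R where K: "smooth \<psi>" "compact K" "K \<subseteq> \<Omega>" "\<And>x. x \<notin> K \<Longrightarrow> \<psi> x = 0"
    "\<And>x. x \<notin> K \<Longrightarrow> grad \<psi> x = 0" "\<forall>x. norm x > R \<longrightarrow> \<psi> x = 0"
    using test_functionsE[OF assms] by metis
  show "integrable lebesgue (\<lambda>x. \<psi> x *\<^sub>R f x)" if "locally_integrable \<Omega> f"
  proof -
    have "locint (\<lambda>x. indicator K x *\<^sub>R f x)"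
      using that K(2,3) by (intro set_integrable_locint) (auto simp: locally_integrable_def)
    from test_integrable(2)[OF K(1,6) this]
    have "integrable lebesgue (\<lambda>x. \<psi> x *\<^sub>R indicat_real K x *\<^sub>R f x)" .
    moreover have "(\<lambda>x. \<psi> x *\<^sub>R indicat_real K x *\<^sub>R f x) = (\<lambda>x. \<psi> x *\<^sub>R f x)"
      using K(4) by (auto simp: indicator_def fun_eq_iff)
    ultimately show ?thesis by simp
  qed
  show "integrable lebesgue (\<lambda>x. u x *\<^sub>R grad \<psi> x)" if "locally_integrable \<Omega> u"
  proof -
    have "locint (\<lambda>x. indicator K x *\<^sub>R u x)"
      using that K(2,3) by (intro set_integrable_locint) (auto simp: locally_integrable_def)
    from test_integrable(1)[OF K(1,6) this]
    have "integrable lebesgue (\<lambda>x. (indicat_real K x *\<^sub>R u x) *\<^sub>R grad \<psi> x)" .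
    moreover have "(\<lambda>x. (indicat_real K x *\<^sub>R u x) *\<^sub>R grad \<psi> x) = (\<lambda>x. u x *\<^sub>R grad \<psi> x)"
      using K(5) by (auto simp: indicator_def fun_eq_iff)
    ultimately show ?thesis by simp
  qed
qed

lemma integral_vec_nth:
  fixes f :: "'a \<Rightarrow> real^'n"
  assumes "integrable M f"
  shows "(LINT x|M. f x $ i) = (LINT x|M. f x) $ i"
  using integral_bounded_linear[OF bounded_linear_vec_nth assms] by simp

text \<open>Test functions and their gradients vanish outside \<open>\<Omega>\<close>, so the
  integrals extend to the whole space. Local integrability makes the vector integrands integrable,
  which is needed to exchange integral and component.\<close>

lemma has_weak_gradient_iff:
  assumes \<Omega>: "open \<Omega>"
  shows "has_weak_gradient \<Omega> u g \<longleftrightarrow> locally_integrable \<Omega> u \<and> locally_integrable \<Omega> g \<and>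
    (\<forall>\<psi> \<in> test_functions \<Omega>. (LINT x|lebesgue. u x *\<^sub>R grad \<psi> x) = - (LINT x|lebesgue. \<psi> x *\<^sub>R g x))"
proof -
  have *: "(\<forall>i. (LINT x|lebesgue_on \<Omega>. u x * frechet_derivative \<psi> (at x) (axis i 1)) =
        - (LINT x|lebesgue_on \<Omega>. g x $ i * \<psi> x)) \<longleftrightarrow>
      (LINT x|lebesgue. u x *\<^sub>R grad \<psi> x) = - (LINT x|lebesgue. \<psi> x *\<^sub>R g x)"
    if \<psi>: "\<psi> \<in> test_functions \<Omega>" and li: "locally_integrable \<Omega> u" "locally_integrable \<Omega> g" for \<psi>
  proof -
    have S: "\<Omega> \<inter> space lebesgue \<in> sets lebesgue" using \<Omega> by simp
    note i = test_locally_integrable(2)[OF \<psi> li(1)] test_locally_integrable(1)[OF \<psi> li(2)]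
    have "(LINT x|lebesgue_on \<Omega>. u x * frechet_derivative \<psi> (at x) (axis i 1))
        = (LINT x|lebesgue. (u x *\<^sub>R grad \<psi> x) $ i)" for i
      unfolding integral_restrict_space[OF S]
    proof (rule Bochner_Integration.integral_cong[OF refl])
      fix x
      have "frechet_derivative \<psi> (at x) (axis i 1) = grad \<psi> x $ i" by (simp add: grad_def)
      then show "indicat_real \<Omega> x *\<^sub>R (u x * frechet_derivative \<psi> (at x) (axis i 1)) = (u x *\<^sub>R grad \<psi> x) $ i"
        using test_functions_outside(2)[OF \<psi>, of x] by (auto simp: indicator_def)
    qed
    moreover have "(LINT x|lebesgue_on \<Omega>. g x $ i * \<psi> x) = (LINT x|lebesgue. (\<psi> x *\<^sub>R g x) $ i)" for i
      unfolding integral_restrict_space[OF S]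
      using test_functions_outside(1)[OF \<psi>]
      by (intro Bochner_Integration.integral_cong) (auto simp: indicator_def)
    ultimately show ?thesis
      by (simp only: integral_vec_nth[OF i(1)] integral_vec_nth[OF i(2)] vec_eq_iff uminus_vec_def vec_lambda_beta)
  qed
  show ?thesis unfolding has_weak_gradient_def using * by blast
qed

lemma locint_locally_integrable:
  assumes "locint f" shows "locally_integrable \<Omega> f"
  unfolding locally_integrable_def
proof (intro allI impI)
  fix K assume K: "compact K \<and> K \<subseteq> \<Omega>"
  then obtain R where "K \<subseteq> cball 0 R"
    using compact_imp_bounded[of K] unfolding bounded_iff by (meson mem_cball_0 subsetI)
  then show "f absolutely_integrable_on K"
    using assms K set_integrable_subset[of lebesgue "cball 0 R" f K]
    by (auto simp: locint_def borel_compact lmeasurable_compact)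
qed

lemma locally_integrable_UNIV: "locally_integrable UNIV f \<longleftrightarrow> locint f"
  using locint_locally_integrable[of f UNIV] by (auto simp: locally_integrable_def locint_def)

lemma wgrad_has_weak_gradient:
  assumes "open \<Omega>" "wgrad u g" shows "has_weak_gradient \<Omega> u g"
  unfolding has_weak_gradient_iff[OF assms(1)]
  using assms(2) wgradD[OF assms(2)]
  by (auto intro!: locint_locally_integrable dest: wgrad_locint elim!: test_functionsE)

lemma has_weak_gradient_UNIV:
  assumes "has_weak_gradient UNIV u g" shows "wgrad u g"
proof -
  have "\<psi> \<in> test_functions UNIV" if "smooth \<psi>" "\<forall>x. norm x > R \<longrightarrow> \<psi> x = 0" for \<psi> R
    using that by (intro test_functionsI[where K = "cball 0 R"]) auto
  then show ?thesis
    using assms unfolding has_weak_gradient_iff[OF open_UNIV] wgrad_def locally_integrable_UNIV by blast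
qed

text \<open>The fundamental lemma of the calculus of variations. Near each point, mollifier kernels
  of small radius are test functions of \<open>\<Omega>\<close>, so the mollifications of
  \<open>f\<close> vanish there, and they converge to \<open>f\<close> in L^1.\<close>

lemma AE_eq_0_of_test_functions:
  fixes f :: "real^'n \<Rightarrow> 'b::euclidean_space"
  assumes \<Omega>: "open \<Omega>" and f: "locally_integrable \<Omega> f"
    and zero: "\<And>\<psi>. \<psi> \<in> test_functions \<Omega> \<Longrightarrow> (LINT x|lebesgue. \<psi> x *\<^sub>R f x) = 0"
  shows "AE x in lebesgue. x \<in> \<Omega> \<longrightarrow> f x = 0"
proof -
  have local: "\<exists>\<rho>>0. AE y in lebesgue. y \<in> ball x \<rho> \<longrightarrow> f y = 0" if x: "x \<in> \<Omega>" for x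
  proof -
    obtain e where e: "0 < e" "cball x e \<subseteq> \<Omega>" using \<Omega> x open_contains_cball by blast
    \<comment> \<open>Half of the distance is used for the position of \<open>y\<close> and half for
      the radius of the kernel, so that the support of the kernel stays inside
      \<open>cball x e\<close>.\<close>
    define \<rho> where "\<rho> = e / 2"
    have \<rho>: "0 < \<rho>" "e = \<rho> + \<rho>" using e by (auto simp: \<rho>_def)
    let ?F = "\<lambda>y. indicator (cball x e) y *\<^sub>R f y"
    have F: "integrable lebesgue ?F"
      using f e(2) unfolding locally_integrable_def set_integrable_def by auto
    let ?m = "\<lambda>n. mollifier (inverse (real (Suc n)))"
    have lF: "locint ?F" by (rule integrable_locint[OF F])
    have conv0: "convol (mollifier r) ?F y = 0" if r: "0 < r" "r < \<rho>" and y: "y \<in> ball x \<rho>" for r y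
    proof -
      have sub: "cball y r \<subseteq> cball x e"
        using y r \<rho> by (intro cball_subset_cball_iff[THEN iffD2]) (auto simp: dist_commute)
      have "(\<lambda>z. mollifier r (y - z)) \<in> test_functions \<Omega>"
        using sub e(2) mollifier_eq_0'[OF r(1), where 'a = 'n]
        by (intro test_functionsI[where K = "cball y r"] smooth_reflect(1) smooth_mollifier)
           (auto simp: dist_norm)
      from zero[OF this] have "(LINT z|lebesgue. mollifier r (y - z) *\<^sub>R f z) = 0" .
      moreover have "mollifier r (y - z) *\<^sub>R ?F z = mollifier r (y - z) *\<^sub>R f z" for z
      proof (cases "z \<in> cball x e")
        case False
        then have "z \<notin> cball y r" using sub by blast
        then show ?thesis using mollifier_eq_0'[OF r(1), of "y - z"] by (simp add: dist_norm)
      qed simp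
      ultimately show ?thesis unfolding convol_def by presburger
    qed
    have "(LINT y|lebesgue. indicator (ball x \<rho>) y * norm (?F y)) = 0"
    proof -
      have "\<forall>\<^sub>F n in sequentially. inverse (real (Suc n)) < \<rho>"
        using LIMSEQ_inverse_real_of_nat \<rho>(1) by (rule order_tendstoD)
      then have "\<forall>\<^sub>F n in sequentially. (LINT y|lebesgue. indicator (ball x \<rho>) y * norm (?F y))
          \<le> (LINT y|lebesgue. norm (convol (?m n) ?F y - ?F y))"
      proof eventually_elim
        case (elim n)
        have r: "0 < inverse (real (Suc n))" by simp
        have c1: "integrable lebesgue (\<lambda>y. norm (convol (?m n) ?F y) powr 1)"
          using convol_Lp_le(1)[OF r, of 1 ?F] F integrable_norm[OF F] borel_measurable_integrable[OF F]
          by (simp only: powr_one norm_ge_zero order_refl)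
        have cm: "convol (?m n) ?F \<in> borel_measurable lebesgue"
          by (intro continuous_lebesgue_measurable convol_continuous[OF continuous_mollifier mollifier_eq_0'[OF r] lF])
        have ci: "integrable lebesgue (convol (?m n) ?F)"
          using c1 by (intro iffD1[OF integrable_norm_iff[OF cm]]) (simp only: powr_one norm_ge_zero)
        show ?case
        proof (rule integral_mono)
          show "integrable lebesgue (\<lambda>y. indicator (ball x \<rho>) y * norm (?F y))"
            using integrable_mult_indicator[OF _ integrable_norm[OF F], of "ball x \<rho>"] by simp
          show "integrable lebesgue (\<lambda>y. norm (convol (?m n) ?F y - ?F y))"
            by (rule integrable_norm[OF Bochner_Integration.integrable_diff[OF ci F]])
          show "indicator (ball x \<rho>) y * norm (?F y) \<le> norm (convol (?m n) ?F y - ?F y)" for y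
            using conv0[OF r elim, of y] by (cases "y \<in> ball x \<rho>") simp_all
        qed
      qed
      then have "(LINT y|lebesgue. indicator (ball x \<rho>) y * norm (?F y)) \<le> 0"
        using tendsto_lowerbound[OF convol_L1_tendsto[OF F]] by simp
      moreover have "0 \<le> (LINT y|lebesgue. indicator (ball x \<rho>) y * norm (?F y))"
        by (intro integral_nonneg_AE AE_I2) simp
      ultimately show ?thesis by (rule antisym)
    qed
    moreover have "integrable lebesgue (\<lambda>y. indicator (ball x \<rho>) y * norm (?F y))"
      using integrable_mult_indicator[OF _ integrable_norm[OF F], of "ball x \<rho>"] by simp
    ultimately have "AE y in lebesgue. indicator (ball x \<rho>) y * norm (?F y) = 0"
      by (subst (asm) integral_nonneg_eq_0_iff_AE) auto
    then have "AE y in lebesgue. y \<in> ball x \<rho> \<longrightarrow> f y = 0"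
    proof eventually_elim
      case (elim y)
      show ?case
      proof
        assume y: "y \<in> ball x \<rho>"
        then have "y \<in> cball x e" using \<rho> by simp
        with elim y show "f y = 0" by simp
      qed
    qed
    then show ?thesis using \<rho>(1) by blast
  qed
  then obtain \<rho> where \<rho>: "\<And>x. x \<in> \<Omega> \<Longrightarrow> 0 < \<rho> x" "\<And>x. x \<in> \<Omega> \<Longrightarrow> AE y in lebesgue. y \<in> ball x (\<rho> x) \<longrightarrow> f y = 0"
    by metis
  \<comment> \<open>There is one exceptional null set for each ball; Lindelof reduces the cover of
    \<open>\<Omega>\<close> to countably many balls, so the union of these sets is still
    null.\<close>
  obtain F' where F': "F' \<subseteq> (\<lambda>x. ball x (\<rho> x)) ` \<Omega>" "countable F'" "\<Union>F' = \<Union>((\<lambda>x. ball x (\<rho> x)) ` \<Omega>)"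
    using Lindelof[of "(\<lambda>x. ball x (\<rho> x)) ` \<Omega>"] by auto
  have "AE y in lebesgue. \<forall>B\<in>F'. y \<in> B \<longrightarrow> f y = 0"
    using F'(1) \<rho>(2) by (subst AE_ball_countable[OF F'(2)]) auto
  then show ?thesis
  proof eventually_elim
    case (elim y)
    show ?case
    proof
      assume "y \<in> \<Omega>"
      then have "y \<in> \<Union>F'" using F'(3) \<rho>(1) by force
      then show "f y = 0" using elim by blast
    qed
  qed
qed

lemma locally_integrable_diff:
  "locally_integrable \<Omega> f \<Longrightarrow> locally_integrable \<Omega> g \<Longrightarrow> locally_integrable \<Omega> (\<lambda>x. f x - g x)"
  unfolding locally_integrable_def by (auto intro: set_integral_diff)

lemma weak_gradient_unique:
  assumes \<Omega>: "open \<Omega>" and g: "has_weak_gradient \<Omega> u g" and h: "has_weak_gradient \<Omega> u h"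
  shows "AE x in lebesgue. x \<in> \<Omega> \<longrightarrow> g x = h x"
proof -
  have li: "locally_integrable \<Omega> g" "locally_integrable \<Omega> h"
    using g h by (simp_all add: has_weak_gradient_def)
  have parts: "(LINT x|lebesgue. u x *\<^sub>R grad \<psi> x) = - (LINT x|lebesgue. \<psi> x *\<^sub>R k x)"
    if "has_weak_gradient \<Omega> u k" "\<psi> \<in> test_functions \<Omega>" for k \<psi>
    using that unfolding has_weak_gradient_iff[OF \<Omega>] by blast
  have "AE x in lebesgue. x \<in> \<Omega> \<longrightarrow> g x - h x = 0"
  proof (rule AE_eq_0_of_test_functions[OF \<Omega>])
    show "locally_integrable \<Omega> (\<lambda>x. g x - h x)" using li by (rule locally_integrable_diff)
    fix \<psi> assume \<psi>: "\<psi> \<in> test_functions \<Omega>"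
    have eq: "(LINT x|lebesgue. \<psi> x *\<^sub>R g x) = (LINT x|lebesgue. \<psi> x *\<^sub>R h x)"
      using parts[OF g \<psi>] parts[OF h \<psi>] by simp
    have i: "integrable lebesgue (\<lambda>x. \<psi> x *\<^sub>R g x)" "integrable lebesgue (\<lambda>x. \<psi> x *\<^sub>R h x)"
      using li by (auto intro: test_locally_integrable(1)[OF \<psi>])
    show "(LINT x|lebesgue. \<psi> x *\<^sub>R (g x - h x)) = 0"
      unfolding scaleR_diff_right by (simp only: Bochner_Integration.integral_diff[OF i] eq diff_self)
  qed
  then show ?thesis by eventually_elim auto
qed

lemma wgrad_unique:
  assumes "wgrad u g" "wgrad u h" shows "AE x in lebesgue. g x = h x"
  using weak_gradient_unique[OF open_UNIV wgrad_has_weak_gradient[OF open_UNIV assms(1)]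
      wgrad_has_weak_gradient[OF open_UNIV assms(2)]] by simp

text \<open>Compare the gradients of \<open>u\<close> and of \<open>max u 0 - max (-u) 0\<close>.\<close>
lemma wgrad_zero_level:
  assumes "wgrad u g" shows "AE x in lebesgue. u x = 0 \<longrightarrow> g x = 0"
proof -
  have "wgrad (\<lambda>x. max (u x) 0 - max (- u x) 0) (\<lambda>x. (if u x > 0 then g x else 0) - (if - u x > 0 then - g x else 0))"
    by (intro wgrad_diff wgrad_pos_part wgrad_uminus assms)
  moreover have "(\<lambda>x. max (u x) 0 - max (- u x) 0) = u" by (auto simp: fun_eq_iff max_def)
  ultimately have "wgrad u (\<lambda>x. (if u x > 0 then g x else 0) - (if - u x > 0 then - g x else 0))" by simp
  from wgrad_unique[OF assms this] show ?thesis by eventually_elim auto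
qed

section \<open>Limits of test functions\<close>

lemma smooth_diff:
  assumes "smooth f" "smooth g"
  shows "smooth (\<lambda>x. f x - g x)" "grad (\<lambda>x. f x - g x) x = grad f x - grad g x"
proof -
  have D: "((\<lambda>x. f x - g x) has_derivative (\<lambda>v. v \<bullet> (grad f x - grad g x))) (at x)"
    if "smooth f" "smooth g" for f g :: "real^'a \<Rightarrow> real" and x
    using has_derivative_diff[OF smooth_has_grad[OF that(1)] smooth_has_grad[OF that(2)], of x]
    by (simp add: inner_diff_right)
  show "grad (\<lambda>x. f x - g x) x = grad f x - grad g x" by (rule grad_eqI[OF D[OF assms]])
  let ?S = "{\<lambda>x::real^'a. f x - g x | f g. smooth f \<and> smooth g}"
  show "smooth (\<lambda>x. f x - g x)"
  proof (rule smoothI)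
    show "(\<lambda>x. f x - g x) \<in> ?S" using assms by blast
    fix h :: "real^'a \<Rightarrow> real" and x assume "h \<in> ?S"
    then show "h differentiable (at x)" using D by (auto simp: differentiable_def)
  next
    fix h :: "real^'a \<Rightarrow> real" and v assume "h \<in> ?S"
    then obtain f g where h: "h = (\<lambda>x. f x - g x)" "smooth f" "smooth g" by blast
    have "frechet_derivative h (at x) v = frechet_derivative f (at x) v - frechet_derivative g (at x) v" for x
      using frechet_derivative_at[OF D[OF h(2,3)], of x, symmetric] smooth_differentiable[OF h(2)] smooth_differentiable[OF h(3)]
      by (simp add: h(1) frechet_derivative_eq_grad inner_diff_right)
    then show "(\<lambda>x. frechet_derivative h (at x) v) \<in> ?S"
      using smooth_frechet_derivative[OF h(2), of v] smooth_frechet_derivative[OF h(3), of v]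
      by (intro CollectI exI[of _ "\<lambda>x. frechet_derivative f (at x) v"] exI[of _ "\<lambda>x. frechet_derivative g (at x) v"]) auto
  qed
qed

lemma test_functions_diff:
  assumes "\<psi> \<in> test_functions \<Omega>" "\<theta> \<in> test_functions \<Omega>"
  shows "(\<lambda>x. \<psi> x - \<theta> x) \<in> test_functions \<Omega>"
proof -
  obtain K where K: "smooth \<psi>" "compact K" "K \<subseteq> \<Omega>" "\<And>x. x \<notin> K \<Longrightarrow> \<psi> x = 0"
    using test_functionsE[OF assms(1)] by metis
  obtain L where L: "smooth \<theta>" "compact L" "L \<subseteq> \<Omega>" "\<And>x. x \<notin> L \<Longrightarrow> \<theta> x = 0"
    using test_functionsE[OF assms(2)] by metis
  show ?thesis
    by (rule test_functionsI[where K = "K \<union> L"]) (use K L smooth_diff in auto)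
qed

section \<open>L^p on the whole space, and the functions with zero boundary values\<close>

definition in_Lp :: "real \<Rightarrow> (real^'n \<Rightarrow> 'b::euclidean_space) \<Rightarrow> bool" where
  "in_Lp p f \<longleftrightarrow> f \<in> borel_measurable lebesgue \<and> integrable lebesgue (\<lambda>x. norm (f x) powr p)"

text \<open>The p-th power of the L^p norm: convergence to 0 is the same, and roots are
  avoided.\<close>

definition Lp_int :: "real \<Rightarrow> (real^'n \<Rightarrow> 'b::euclidean_space) \<Rightarrow> real" where
  "Lp_int p f = (LINT x|lebesgue. norm (f x) powr p)"

lemma in_LpD: "in_Lp p f \<Longrightarrow> f \<in> borel_measurable lebesgue" "in_Lp p f \<Longrightarrow> integrable lebesgue (\<lambda>x. norm (f x) powr p)"
  by (auto simp: in_Lp_def)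

lemma Lp_int_nonneg: "0 \<le> Lp_int p f"
  unfolding Lp_int_def by (intro integral_nonneg_AE AE_I2) simp

lemma in_Lp_bound:
  assumes "in_Lp p f" "0 \<le> p" "g \<in> borel_measurable lebesgue" "\<And>x. norm (g x) \<le> norm (f x)"
  shows "in_Lp p g" "Lp_int p g \<le> Lp_int p f"
proof -
  have le: "norm (g x) powr p \<le> norm (f x) powr p" for x using assms(2,4) by (intro powr_mono2) auto
  have i: "integrable lebesgue (\<lambda>x. norm (g x) powr p)"
  proof (rule Bochner_Integration.integrable_bound[OF in_LpD(2)[OF assms(1)]])
    show "(\<lambda>x. norm (g x) powr p) \<in> borel_measurable lebesgue" using assms(3) by measurable
  qed (use le in auto)
  show "in_Lp p g" using assms(3) i by (simp add: in_Lp_def)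
  show "Lp_int p g \<le> Lp_int p f"
    unfolding Lp_int_def by (rule integral_mono[OF i in_LpD(2)[OF assms(1)] le])
qed

lemma in_Lp_add:
  fixes f g :: "real^'n \<Rightarrow> 'b::euclidean_space"
  assumes "in_Lp p f" "in_Lp p g" "0 \<le> p"
  shows "in_Lp p (\<lambda>x. f x + g x)" "Lp_int p (\<lambda>x. f x + g x) \<le> 2 powr p * (Lp_int p f + Lp_int p g)"
proof -
  have s: "integrable lebesgue (\<lambda>x. 2 powr p * (norm (f x) powr p + norm (g x) powr p))"
    by (intro integrable_mult_right Bochner_Integration.integrable_add in_LpD(2) assms)
  have m: "(\<lambda>x. f x + g x) \<in> borel_measurable lebesgue"
    using in_LpD(1)[OF assms(1)] in_LpD(1)[OF assms(2)] by measurable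
  have i: "integrable lebesgue (\<lambda>x. norm (f x + g x) powr p)"
  proof (rule Bochner_Integration.integrable_bound[OF s])
    show "(\<lambda>x. norm (f x + g x) powr p) \<in> borel_measurable lebesgue" using m by measurable
    show "AE x in lebesgue. norm (norm (f x + g x) powr p) \<le> norm (2 powr p * (norm (f x) powr p + norm (g x) powr p))"
      using powr_norm_add_le[OF assms(3)] by (intro AE_I2) simp
  qed
  show "in_Lp p (\<lambda>x. f x + g x)" using m i by (simp add: in_Lp_def)
  have "Lp_int p (\<lambda>x. f x + g x) \<le> (LINT x|lebesgue. 2 powr p * (norm (f x) powr p + norm (g x) powr p))"
    unfolding Lp_int_def by (rule integral_mono[OF i s powr_norm_add_le[OF assms(3)]])
  also have "\<dots> = 2 powr p * (Lp_int p f + Lp_int p g)"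
    unfolding Lp_int_def using in_LpD(2)[OF assms(1)] in_LpD(2)[OF assms(2)] by simp
  finally show "Lp_int p (\<lambda>x. f x + g x) \<le> 2 powr p * (Lp_int p f + Lp_int p g)" .
qed

lemma in_Lp_uminus: "in_Lp p (\<lambda>x. - f x) \<longleftrightarrow> in_Lp p f" "Lp_int p (\<lambda>x. - f x) = Lp_int p f"
proof -
  have "(\<lambda>x. - f x) \<in> borel_measurable lebesgue \<longleftrightarrow> f \<in> borel_measurable lebesgue"
    using borel_measurable_uminus[of "\<lambda>x. - f x" lebesgue] borel_measurable_uminus[of f lebesgue] by auto
  then show "in_Lp p (\<lambda>x. - f x) \<longleftrightarrow> in_Lp p f" "Lp_int p (\<lambda>x. - f x) = Lp_int p f"
    by (simp_all add: in_Lp_def Lp_int_def)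
qed

lemma in_Lp_diff:
  assumes "in_Lp p f" "in_Lp p g" "0 \<le> p"
  shows "in_Lp p (\<lambda>x. f x - g x)" "Lp_int p (\<lambda>x. f x - g x) \<le> 2 powr p * (Lp_int p f + Lp_int p g)"
  using in_Lp_add[of p f "\<lambda>x. - g x"] assms by (simp_all add: in_Lp_uminus)

lemma in_Lp_triangle:
  assumes "in_Lp p (\<lambda>x. f x - g x)" "in_Lp p (\<lambda>x. g x - h x)" "0 \<le> p"
  shows "Lp_int p (\<lambda>x. f x - h x) \<le> 2 powr p * (Lp_int p (\<lambda>x. f x - g x) + Lp_int p (\<lambda>x. g x - h x))"
  using in_Lp_add(2)[OF assms] by simp

lemma Lp_int_commute: "Lp_int p (\<lambda>x. f x - g x) = Lp_int p (\<lambda>x. g x - f x)"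
  unfolding Lp_int_def by (simp add: norm_minus_commute)

lemma in_Lp_locint: "1 \<le> p \<Longrightarrow> in_Lp p f \<Longrightarrow> locint f"
  unfolding in_Lp_def by (rule powr_integrable_locint) auto

lemma in_Lp_compactly_supported:
  fixes f :: "real^'n \<Rightarrow> 'b::euclidean_space"
  assumes "continuous_on UNIV f" "\<And>x. norm x > R \<Longrightarrow> f x = 0" "0 < p"
  shows "in_Lp p f"
proof -
  have "integrable lebesgue (\<lambda>x. norm (f x) powr p)"
    using assms by (intro integrable_compactly_supported[where R = R] continuous_on_powr') (auto intro!: continuous_intros)
  then show ?thesis using assms by (simp add: in_Lp_def continuous_lebesgue_measurable)
qed

text \<open>Above \<open>e\<close> the power a^(1-p) is at most e^(1-p), because the exponent is not
  positive. The inequality plays the part of Hoelder in passing from L^p to L^1 on balls.\<close>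

lemma le_add_powr:
  assumes "1 \<le> p" "0 < e" "0 \<le> (a::real)"
  shows "a \<le> e + e powr (1 - p) * a powr p"
proof (cases "a \<le> e")
  case False
  then have a: "0 < a" using assms by linarith
  have "a = a powr (1 - p) * a powr p" using a by (simp add: powr_add[symmetric])
  also have "\<dots> \<le> e powr (1 - p) * a powr p"
    using False assms by (intro mult_right_mono powr_mono2') auto
  finally show ?thesis using assms by linarith
qed (simp add: add_increasing2)

lemma Lp_tendsto_local_L1:
  fixes f :: "nat \<Rightarrow> real^'n \<Rightarrow> 'b::euclidean_space"
  assumes p: "1 \<le> p" and L: "\<And>n. in_Lp p (\<lambda>x. f n x - g x)" and lim: "(\<lambda>n. Lp_int p (\<lambda>x. f n x - g x)) \<longlonglongrightarrow> 0"
  shows "(\<lambda>n. LINT x|lebesgue. indicator (cball 0 R) x * norm (f n x - g x)) \<longlonglongrightarrow> 0"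
proof (rule LIMSEQ_I)
  fix d :: real assume d: "0 < d"
  let ?I = "\<lambda>x::real^'n. indicator (cball 0 R) x :: real"
  define M where "M = (LINT x|lebesgue. ?I x)"
  have M: "0 \<le> M" unfolding M_def by (intro integral_nonneg_AE AE_I2) simp
  \<comment> \<open>\<open>M\<close> is the volume of the ball, so the constant term of
    \<open>le_add_powr\<close> contributes at most d / 2; the 1 keeps the denominator
    positive.\<close>
  define e where "e = d / (2 * (M + 1))"
  have e: "0 < e" using d M by (simp add: e_def)
  have "\<forall>\<^sub>F n in sequentially. Lp_int p (\<lambda>x. f n x - g x) < d / (2 * e powr (1 - p))"
    using lim d e by (intro order_tendstoD(2)[OF lim]) simp
  then obtain N where N: "\<And>n. n \<ge> N \<Longrightarrow> Lp_int p (\<lambda>x. f n x - g x) < d / (2 * e powr (1 - p))"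
    by (auto simp: eventually_sequentially)
  have "norm ((LINT x|lebesgue. ?I x * norm (f n x - g x)) - 0) < d" if n: "n \<ge> N" for n
  proof -
    have i1: "integrable lebesgue (\<lambda>x. ?I x * norm (f n x - g x))"
      by (rule locint_norm_integrable[OF in_Lp_locint[OF p L]])
    have i2: "integrable lebesgue (\<lambda>x. e * ?I x)"
      by (intro integrable_mult_right integrable_indicator_cball)
    have i3: "integrable lebesgue (\<lambda>x. e powr (1 - p) * norm (f n x - g x) powr p)"
      by (intro integrable_mult_right in_LpD(2)[OF L])
    have "(LINT x|lebesgue. ?I x * norm (f n x - g x))
        \<le> (LINT x|lebesgue. e * ?I x + e powr (1 - p) * norm (f n x - g x) powr p)"
    proof (rule integral_mono[OF i1 Bochner_Integration.integrable_add[OF i2 i3]])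
      show "?I x * norm (f n x - g x) \<le> e * ?I x + e powr (1 - p) * norm (f n x - g x) powr p" for x
        using le_add_powr[OF p e, of "norm (f n x - g x)"] by (cases "x \<in> cball 0 R") auto
    qed
    also have "\<dots> = e * M + e powr (1 - p) * Lp_int p (\<lambda>x. f n x - g x)"
      unfolding M_def Lp_int_def Bochner_Integration.integral_add[OF i2 i3] by simp
    also have "\<dots> < d / 2 + d / 2"
    proof (rule add_le_less_mono)
      show "e * M \<le> d / 2" using d M by (simp add: e_def field_simps)
      have "e powr (1 - p) * Lp_int p (\<lambda>x. f n x - g x) < e powr (1 - p) * (d / (2 * e powr (1 - p)))"
        using N[OF n] e by (intro mult_strict_left_mono) auto
      then show "e powr (1 - p) * Lp_int p (\<lambda>x. f n x - g x) < d / 2" using e by simp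
    qed
    finally have "(LINT x|lebesgue. ?I x * norm (f n x - g x)) < d" by simp
    moreover have "0 \<le> (LINT x|lebesgue. ?I x * norm (f n x - g x))"
      by (intro integral_nonneg_AE AE_I2) simp
    ultimately show ?thesis by simp
  qed
  then show "\<exists>no. \<forall>n\<ge>no. norm ((LINT x|lebesgue. ?I x * norm (f n x - g x)) - 0) < d" by blast
qed

text \<open>Pairs of (the zero extension of) an element of \<open>W1p_0 p \<Omega>\<close> and its gradient.\<close>
definition W0 :: "real \<Rightarrow> (real^'n) set \<Rightarrow> (real^'n \<Rightarrow> real) \<Rightarrow> (real^'n \<Rightarrow> real^'n) \<Rightarrow> bool" where
  "W0 p \<Omega> v g \<longleftrightarrow> in_Lp p v \<and> in_Lp p g \<and> (\<forall>x. x \<notin> \<Omega> \<longrightarrow> v x = 0 \<and> g x = 0) \<and>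
    (\<forall>e>0. \<exists>\<psi> \<in> test_functions \<Omega>. Lp_int p (\<lambda>x. \<psi> x - v x) < e \<and> Lp_int p (\<lambda>x. grad \<psi> x - g x) < e)"

lemma W0D:
  assumes "W0 p \<Omega> v g"
  shows "in_Lp p v" "in_Lp p g" "x \<notin> \<Omega> \<Longrightarrow> v x = 0" "x \<notin> \<Omega> \<Longrightarrow> g x = 0"
  using assms by (auto simp: W0_def)

lemma test_in_Lp:
  assumes "\<psi> \<in> test_functions \<Omega>" "0 < p"
  shows "in_Lp p \<psi>" "in_Lp p (grad \<psi>)"
proof -
  obtain R where R: "smooth \<psi>" "\<forall>x. norm x > R \<longrightarrow> \<psi> x = 0"
    using test_functionsE[OF assms(1)] by metis
  show "in_Lp p \<psi>" using R assms(2) by (intro in_Lp_compactly_supported[where R = R] smooth_continuous) auto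
  show "in_Lp p (grad \<psi>)"
    using R assms(2) grad_eq_0_outside[of R \<psi>]
    by (intro in_Lp_compactly_supported[where R = R] continuous_on_grad) auto
qed

lemma W0_sequence:
  assumes "W0 p \<Omega> v g"
  obtains \<psi> where "\<And>n. \<psi> n \<in> test_functions \<Omega>"
    "(\<lambda>n. Lp_int p (\<lambda>x. \<psi> n x - v x)) \<longlonglongrightarrow> 0" "(\<lambda>n. Lp_int p (\<lambda>x. grad (\<psi> n) x - g x)) \<longlonglongrightarrow> 0"
proof -
  have "\<exists>\<psi> \<in> test_functions \<Omega>. Lp_int p (\<lambda>x. \<psi> x - v x) < inverse (real (Suc n)) \<and> Lp_int p (\<lambda>x. grad \<psi> x - g x) < inverse (real (Suc n))" for n
    using assms by (simp add: W0_def)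
  then obtain \<psi> where \<psi>: "\<And>n. \<psi> n \<in> test_functions \<Omega>" "\<And>n. Lp_int p (\<lambda>x. \<psi> n x - v x) < inverse (real (Suc n))"
    "\<And>n. Lp_int p (\<lambda>x. grad (\<psi> n) x - g x) < inverse (real (Suc n))" by metis
  show ?thesis
  proof (rule that[OF \<psi>(1)])
    show "(\<lambda>n. Lp_int p (\<lambda>x. \<psi> n x - v x)) \<longlonglongrightarrow> 0"
      by (rule Lim_null_comparison[OF _ LIMSEQ_inverse_real_of_nat])
         (use \<psi>(2) in \<open>simp add: Lp_int_nonneg less_imp_le del: of_nat_Suc\<close>)
    show "(\<lambda>n. Lp_int p (\<lambda>x. grad (\<psi> n) x - g x)) \<longlonglongrightarrow> 0"
      by (rule Lim_null_comparison[OF _ LIMSEQ_inverse_real_of_nat])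
         (use \<psi>(3) in \<open>simp add: Lp_int_nonneg less_imp_le del: of_nat_Suc\<close>)
  qed
qed

text \<open>Test functions of \<open>\<Omega>\<close> are smooth on the whole space, so their limit
  has a weak gradient there too: extension by zero creates nothing at the boundary, whatever its
  shape.\<close>

lemma W0_wgrad:
  assumes p: "1 \<le> p" and W: "W0 p \<Omega> v g"
  shows "wgrad v g"
proof -
  obtain \<psi> where \<psi>: "\<And>n. \<psi> n \<in> test_functions \<Omega>"
    "(\<lambda>n. Lp_int p (\<lambda>x. \<psi> n x - v x)) \<longlonglongrightarrow> 0" "(\<lambda>n. Lp_int p (\<lambda>x. grad (\<psi> n) x - g x)) \<longlonglongrightarrow> 0"
    using W0_sequence[OF W] by blast
  have L: "in_Lp p (\<lambda>x. \<psi> n x - v x)" "in_Lp p (\<lambda>x. grad (\<psi> n) x - g x)" for n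
    using test_in_Lp[OF \<psi>(1)] W0D(1,2)[OF W] p by (auto intro!: in_Lp_diff)
  show ?thesis
    by (rule wgrad_limit[OF wgrad_smooth[OF test_functions_smooth[OF \<psi>(1)]]
          in_Lp_locint[OF p W0D(1)[OF W]] in_Lp_locint[OF p W0D(2)[OF W]]
          Lp_tendsto_local_L1[OF p L(1) \<psi>(2)] Lp_tendsto_local_L1[OF p L(2) \<psi>(3)]])
qed

lemma W0_diff:
  assumes p: "0 < p" and W: "W0 p \<Omega> v g" "W0 p \<Omega> w h"
  shows "W0 p \<Omega> (\<lambda>x. v x - w x) (\<lambda>x. g x - h x)"
  unfolding W0_def
proof (intro conjI allI impI)
  show "in_Lp p (\<lambda>x. v x - w x)" "in_Lp p (\<lambda>x. g x - h x)"
    using W0D(1,2)[OF W(1)] W0D(1,2)[OF W(2)] p by (auto intro!: in_Lp_diff)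
  fix e :: real assume e: "0 < e"
  define d where "d = e / (2 * 2 powr p)"
  have d: "0 < d" using e by (simp add: d_def)
  obtain \<psi> where \<psi>: "\<psi> \<in> test_functions \<Omega>" "Lp_int p (\<lambda>x. \<psi> x - v x) < d" "Lp_int p (\<lambda>x. grad \<psi> x - g x) < d"
    using W(1) d by (auto simp: W0_def)
  obtain \<theta> where \<theta>: "\<theta> \<in> test_functions \<Omega>" "Lp_int p (\<lambda>x. \<theta> x - w x) < d" "Lp_int p (\<lambda>x. grad \<theta> x - h x) < d"
    using W(2) d by (auto simp: W0_def)
  have L: "in_Lp p (\<lambda>x. \<psi> x - v x)" "in_Lp p (\<lambda>x. \<theta> x - w x)" "in_Lp p (\<lambda>x. grad \<psi> x - g x)" "in_Lp p (\<lambda>x. grad \<theta> x - h x)"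
    using test_in_Lp[OF \<psi>(1) p] test_in_Lp[OF \<theta>(1) p] W0D(1,2)[OF W(1)] W0D(1,2)[OF W(2)] p
    by (auto intro!: in_Lp_diff)
  have fin: "2 powr p * (a + b) < e" if "a < d" "b < d" for a b
  proof -
    have "2 powr p * (a + b) < 2 powr p * (d + d)" using that by (intro mult_strict_left_mono) auto
    then show ?thesis by (simp add: d_def)
  qed
  have "Lp_int p (\<lambda>x. (\<psi> x - \<theta> x) - (v x - w x)) = Lp_int p (\<lambda>x. (\<psi> x - v x) - (\<theta> x - w x))"
    by (simp add: algebra_simps)
  also have "\<dots> \<le> 2 powr p * (Lp_int p (\<lambda>x. \<psi> x - v x) + Lp_int p (\<lambda>x. \<theta> x - w x))"
    using p by (intro in_Lp_diff(2) L) auto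
  also have "\<dots> < e" by (rule fin[OF \<psi>(2) \<theta>(2)])
  finally have 1: "Lp_int p (\<lambda>x. (\<psi> x - \<theta> x) - (v x - w x)) < e" .
  have "Lp_int p (\<lambda>x. (grad \<psi> x - grad \<theta> x) - (g x - h x)) = Lp_int p (\<lambda>x. (grad \<psi> x - g x) - (grad \<theta> x - h x))"
    by (simp add: algebra_simps)
  also have "\<dots> \<le> 2 powr p * (Lp_int p (\<lambda>x. grad \<psi> x - g x) + Lp_int p (\<lambda>x. grad \<theta> x - h x))"
    using p by (intro in_Lp_diff(2) L) auto
  also have "\<dots> < e" by (rule fin[OF \<psi>(3) \<theta>(3)])
  finally have 2: "Lp_int p (\<lambda>x. grad (\<lambda>x. \<psi> x - \<theta> x) x - (g x - h x)) < e"
    using smooth_diff(2)[OF test_functions_smooth[OF \<psi>(1)] test_functions_smooth[OF \<theta>(1)]] by simp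
  show "\<exists>\<psi>\<in>test_functions \<Omega>. Lp_int p (\<lambda>x. \<psi> x - (v x - w x)) < e \<and> Lp_int p (\<lambda>x. grad \<psi> x - (g x - h x)) < e"
    by (intro bexI[of _ "\<lambda>x. \<psi> x - \<theta> x"] conjI 1 2 test_functions_diff[OF \<psi>(1) \<theta>(1)])
qed (use W0D(3,4)[OF W(1)] W0D(3,4)[OF W(2)] in auto)

lemma W0_uminus:
  assumes "0 < p" "W0 p \<Omega> v g" shows "W0 p \<Omega> (\<lambda>x. - v x) (\<lambda>x. - g x)"
  using W0_diff[OF assms(1) W0_diff[OF assms(1,2,2)] assms(2)] by simp

lemma W0_limit:
  assumes p: "0 < p" and L: "in_Lp p v" "in_Lp p g" "\<And>x. x \<notin> \<Omega> \<Longrightarrow> v x = 0" "\<And>x. x \<notin> \<Omega> \<Longrightarrow> g x = 0"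
    and W: "\<And>n::nat. W0 p \<Omega> (a n) (b n)"
    and lim: "(\<lambda>n. Lp_int p (\<lambda>x. a n x - v x)) \<longlonglongrightarrow> 0" "(\<lambda>n. Lp_int p (\<lambda>x. b n x - g x)) \<longlonglongrightarrow> 0"
  shows "W0 p \<Omega> v g"
  unfolding W0_def
proof (intro conjI allI impI)
  fix e :: real assume e: "0 < e"
  define d where "d = e / (2 * 2 powr p)"
  have d: "0 < d" using e by (simp add: d_def)
  have "\<forall>\<^sub>F n in sequentially. Lp_int p (\<lambda>x. a n x - v x) < d \<and> Lp_int p (\<lambda>x. b n x - g x) < d"
    by (intro eventually_conj order_tendstoD(2)[OF lim(1) d] order_tendstoD(2)[OF lim(2) d])
  then obtain n where n: "Lp_int p (\<lambda>x. a n x - v x) < d" "Lp_int p (\<lambda>x. b n x - g x) < d"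
    by (auto simp: eventually_sequentially)
  obtain \<psi> where \<psi>: "\<psi> \<in> test_functions \<Omega>" "Lp_int p (\<lambda>x. \<psi> x - a n x) < d" "Lp_int p (\<lambda>x. grad \<psi> x - b n x) < d"
    using W[of n] d by (auto simp: W0_def)
  have Ln: "in_Lp p (\<lambda>x. \<psi> x - a n x)" "in_Lp p (\<lambda>x. grad \<psi> x - b n x)" "in_Lp p (\<lambda>x. a n x - v x)" "in_Lp p (\<lambda>x. b n x - g x)"
    using test_in_Lp[OF \<psi>(1) p] L(1,2) W0D(1,2)[OF W[of n]] p by (auto intro!: in_Lp_diff)
  have fin: "2 powr p * (a + b) < e" if "a < d" "b < d" for a b
  proof -
    have "2 powr p * (a + b) < 2 powr p * (d + d)" using that by (intro mult_strict_left_mono) auto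
    then show ?thesis by (simp add: d_def)
  qed
  have "Lp_int p (\<lambda>x. \<psi> x - v x) < e"
    using in_Lp_triangle[OF Ln(1,3)] p fin[OF \<psi>(2) n(1)] by simp
  moreover have "Lp_int p (\<lambda>x. grad \<psi> x - g x) < e"
    using in_Lp_triangle[OF Ln(2,4)] p fin[OF \<psi>(3) n(2)] by simp
  ultimately show "\<exists>\<psi>\<in>test_functions \<Omega>. Lp_int p (\<lambda>x. \<psi> x - v x) < e \<and> Lp_int p (\<lambda>x. grad \<psi> x - g x) < e"
    using \<psi>(1) by blast
qed (use L in auto)

text \<open>Mollifying with a radius below the distance from \<open>K\<close> to the complement of
  \<open>\<Omega>\<close> yields test functions, and both the function and its gradient converge in
  L^p.\<close>

lemma W0_compact_support:
  assumes p: "1 \<le> p" and w: "wgrad a b" and L: "in_Lp p a" "in_Lp p b" and \<Omega>: "open \<Omega>"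
    and K: "compact K" "K \<subseteq> \<Omega>" "\<And>x. x \<notin> K \<Longrightarrow> a x = 0" "\<And>x. x \<notin> K \<Longrightarrow> b x = 0"
  shows "W0 p \<Omega> a b"
  unfolding W0_def
proof (intro conjI allI impI L)
  show "a x = 0" "b x = 0" if "x \<notin> \<Omega>" for x using that K by auto
  fix e :: real assume e: "0 < e"
  obtain \<rho> where \<rho>: "\<rho> > 0" "(\<Union>x\<in>K. cball x \<rho>) \<subseteq> \<Omega>"
    using compact_subset_open_imp_cball_epsilon_subset[OF K(1) \<Omega> K(2)] by blast
  let ?m = "\<lambda>n. mollifier (inverse (real (Suc n)))"
  have la: "(\<lambda>n. Lp_int p (\<lambda>x. convol (?m n) a x - a x)) \<longlonglongrightarrow> 0"
    unfolding Lp_int_def by (rule convol_Lp_tendsto[OF p in_LpD[OF L(1)]])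
  have lb: "(\<lambda>n. Lp_int p (\<lambda>x. convol (?m n) b x - b x)) \<longlonglongrightarrow> 0"
    unfolding Lp_int_def by (rule convol_Lp_tendsto[OF p in_LpD[OF L(2)]])
  have "\<forall>\<^sub>F n in sequentially. inverse (real (Suc n)) < \<rho> \<and> Lp_int p (\<lambda>x. convol (?m n) a x - a x) < e
      \<and> Lp_int p (\<lambda>x. convol (?m n) b x - b x) < e"
    by (intro eventually_conj order_tendstoD(2)[OF la e] order_tendstoD(2)[OF lb e]
        order_tendstoD(2)[OF LIMSEQ_inverse_real_of_nat \<rho>(1)])
  then obtain n where n: "inverse (real (Suc n)) < \<rho>" "Lp_int p (\<lambda>x. convol (?m n) a x - a x) < e"
    "Lp_int p (\<lambda>x. convol (?m n) b x - b x) < e"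
    by (auto simp only: eventually_sequentially)
  have r: "0 < inverse (real (Suc n))" by simp
  let ?K = "{x + y | x y. x \<in> K \<and> y \<in> cball 0 \<rho>}"
  have "convol (?m n) a \<in> test_functions \<Omega>"
  proof (rule test_functionsI[where K = ?K])
    show "smooth (convol (?m n) a)" by (rule grad_mollified(1)[OF w r])
    show "compact ?K" by (intro compact_sums K(1) compact_cball)
    have "x + y \<in> \<Omega>" if "x \<in> K" "norm y \<le> \<rho>" for x y
    proof -
      have "x + y \<in> cball x \<rho>" using that by (simp add: dist_norm)
      then show ?thesis using \<rho>(2) that(1) by blast
    qed
    then show "?K \<subseteq> \<Omega>" by auto
    fix x assume x: "x \<notin> ?K"
    have "?m n (x - y) *\<^sub>R a y = 0" for y
    proof (cases "y \<in> K")
      case True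
      have "norm (x - y) > \<rho>"
      proof (rule ccontr)
        assume "\<not> norm (x - y) > \<rho>"
        then have "x = y + (x - y) \<and> y \<in> K \<and> (x - y) \<in> cball 0 \<rho>" using True by simp
        then show False using x by blast
      qed
      then show ?thesis using mollifier_eq_0'[OF r, of "x - y"] n(1) by simp
    qed (simp add: K(3))
    then show "convol (?m n) a x = 0" unfolding convol_def by (simp only: integral_zero)
  qed
  moreover have "grad (convol (?m n) a) = convol (?m n) b"
    using grad_mollified(2)[OF w r] by (simp add: fun_eq_iff)
  ultimately show "\<exists>\<psi>\<in>test_functions \<Omega>. Lp_int p (\<lambda>x. \<psi> x - a x) < e \<and> Lp_int p (\<lambda>x. grad \<psi> x - b x) < e"
    using n(2,3) by metis
qed

lemma in_Lp_norm: "in_Lp p f \<Longrightarrow> in_Lp p (\<lambda>x. norm (f x))"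
  unfolding in_Lp_def by (auto intro: borel_measurable_norm)

text \<open>Because \<open>\<zeta>\<close> is nonnegative, the positive part of \<psi> - \<zeta>
  vanishes wherever a test function \<psi> does, so it has compact support in
  \<open>\<Omega>\<close>; then \<psi> runs through a sequence converging to \<open>v\<close>. Only
  local L^p bounds are asked of \<open>h\<close>, since the gradients used later may be merely
  bounded.\<close>

lemma W0_trunc:
  assumes p: "1 \<le> p" and \<Omega>: "open \<Omega>" "bounded \<Omega>" and W: "W0 p \<Omega> v g"
    and w: "wgrad \<zeta> h" and \<zeta>: "\<And>x. 0 \<le> \<zeta> x" and hp: "\<And>R. in_Lp p (\<lambda>x. indicator (cball 0 R) x *\<^sub>R h x)"
  shows "W0 p \<Omega> (\<lambda>x. max (v x - \<zeta> x) 0) (\<lambda>x. if \<zeta> x < v x then g x - h x else 0)"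
proof -
  have p0: "0 < p" "0 \<le> p" using p by auto
  obtain R where R: "\<And>x. x \<in> \<Omega> \<Longrightarrow> norm x \<le> R" using \<Omega>(2) unfolding bounded_iff by blast
  let ?I = "\<lambda>x::real^'a. indicator (cball 0 R) x :: real"
  obtain \<phi> where \<phi>: "\<And>n. \<phi> n \<in> test_functions \<Omega>"
    "(\<lambda>n. Lp_int p (\<lambda>x. \<phi> n x - v x)) \<longlonglongrightarrow> 0" "(\<lambda>n. Lp_int p (\<lambda>x. grad (\<phi> n) x - g x)) \<longlonglongrightarrow> 0"
    using W0_sequence[OF W] by blast
  have L: "in_Lp p (\<lambda>x. \<phi> n x - v x)" "in_Lp p (\<lambda>x. grad (\<phi> n) x - g x)" for n
    using test_in_Lp[OF \<phi>(1)] W0D(1,2)[OF W] p by (auto intro!: in_Lp_diff)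
  \<comment> \<open>Almost everywhere convergence is needed to control the sets {\<zeta> <
    \<psi>_n}, on which the gradients of the truncated test functions live.\<close>
  have "\<exists>r. strict_mono r \<and> (AE x in lebesgue. (\<lambda>n. ?I x * norm (\<phi> (r n) x - v x)) \<longlonglongrightarrow> 0)"
  proof (rule tendsto_L1_AE_subseq)
    show "integrable lebesgue (\<lambda>x. ?I x * norm (\<phi> n x - v x))" for n
      by (rule locint_norm_integrable[OF in_Lp_locint[OF p L(1)]])
    show "(\<lambda>n. LINT x|lebesgue. norm (?I x * norm (\<phi> n x - v x))) \<longlonglongrightarrow> 0"
      using Lp_tendsto_local_L1[OF p L(1) \<phi>(2), of R] by simp
  qed
  then obtain r :: "nat \<Rightarrow> nat" where r: "strict_mono r"
    "AE x in lebesgue. (\<lambda>n. ?I x * norm (\<phi> (r n) x - v x)) \<longlonglongrightarrow> 0" by blast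
  define \<psi> where "\<psi> n = \<phi> (r n)" for n
  have \<psi>: "\<psi> n \<in> test_functions \<Omega>" for n by (simp add: \<psi>_def \<phi>(1))
  have lim: "(\<lambda>n. Lp_int p (\<lambda>x. \<psi> n x - v x)) \<longlonglongrightarrow> 0" "(\<lambda>n. Lp_int p (\<lambda>x. grad (\<psi> n) x - g x)) \<longlonglongrightarrow> 0"
    unfolding \<psi>_def using LIMSEQ_subseq_LIMSEQ[OF \<phi>(2) r(1)] LIMSEQ_subseq_LIMSEQ[OF \<phi>(3) r(1)] by (simp_all add: o_def)
  have L\<psi>: "in_Lp p (\<lambda>x. \<psi> n x - v x)" "in_Lp p (\<lambda>x. grad (\<psi> n) x - g x)" for n
    unfolding \<psi>_def by (rule L)+
  have vm: "v \<in> borel_measurable lebesgue" and gm: "g \<in> borel_measurable lebesgue"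
    using W0D(1,2)[OF W] by (auto dest: in_LpD)
  have \<zeta>m: "\<zeta> \<in> borel_measurable lebesgue" and hm: "h \<in> borel_measurable lebesgue"
    using w by (auto intro: locint_measurable dest: wgrad_locint)
  have \<psi>m: "\<psi> n \<in> borel_measurable lebesgue" and d\<psi>m: "grad (\<psi> n) \<in> borel_measurable lebesgue" for n
    using test_in_Lp[OF \<psi> p0(1)] by (auto dest: in_LpD)
  have v_in: "x \<in> \<Omega>" if "\<zeta> x < v x" for x using W0D(3)[OF W, of x] \<zeta>[of x] that by fastforce
  have \<psi>_in: "x \<in> \<Omega>" if "\<zeta> x < \<psi> n x" for x n
    using test_functions_outside(1)[OF \<psi>[of n], of x] \<zeta>[of x] that by fastforce
  have I1: "?I x = 1" if "x \<in> \<Omega>" for x using R[OF that] by simp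
  let ?a = "\<lambda>x. max (v x - \<zeta> x) 0" and ?b = "\<lambda>x. if \<zeta> x < v x then g x - h x else 0"
  let ?an = "\<lambda>n x. max (\<psi> n x - \<zeta> x) 0" and ?bn = "\<lambda>n x. if \<zeta> x < \<psi> n x then grad (\<psi> n) x - h x else 0"
  have wn: "wgrad (?an n) (?bn n)" for n
    using wgrad_pos_part[OF wgrad_diff[OF wgrad_smooth[OF test_functions_smooth[OF \<psi>]] w], of n] by simp
  have gradb: "in_Lp p (\<lambda>x. if \<zeta> x < f x then k x - h x else 0)"
    if "f \<in> borel_measurable lebesgue" "in_Lp p k" "\<And>x. \<zeta> x < f x \<Longrightarrow> x \<in> \<Omega>" for f and k :: "real^'a \<Rightarrow> real^'a"
  proof (rule in_Lp_bound(1)[where f = "\<lambda>x. norm (k x) + norm (?I x *\<^sub>R h x)"])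
    show "in_Lp p (\<lambda>x. norm (k x) + norm (?I x *\<^sub>R h x))"
      by (intro in_Lp_add(1) in_Lp_norm hp that p0)
    show "(\<lambda>x. if \<zeta> x < f x then k x - h x else 0) \<in> borel_measurable lebesgue"
      using that(1) in_LpD(1)[OF that(2)] \<zeta>m hm by measurable
    show "norm (if \<zeta> x < f x then k x - h x else 0) \<le> norm (norm (k x) + norm (?I x *\<^sub>R h x))" for x
    proof (cases "\<zeta> x < f x")
      case True
      then have "?I x = 1" using I1 that(3) by blast
      then show ?thesis using True norm_triangle_ineq4[of "k x" "h x"] by simp
    qed simp
  qed (use p0 in auto)
  have La: "in_Lp p ?a"
  proof (rule in_Lp_bound(1)[OF W0D(1)[OF W] p0(2)])
    show "?a \<in> borel_measurable lebesgue" using vm \<zeta>m by measurable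
    show "norm (?a x) \<le> norm (v x)" for x using \<zeta>[of x] by (simp add: max_def)
  qed
  have Lan: "in_Lp p (?an n)" for n
  proof (rule in_Lp_bound(1)[OF test_in_Lp(1)[OF \<psi>[of n] p0(1)] p0(2)])
    show "?an n \<in> borel_measurable lebesgue" using \<psi>m[of n] \<zeta>m by measurable
    show "norm (?an n x) \<le> norm (\<psi> n x)" for x using \<zeta>[of x] by (simp add: max_def)
  qed
  have Lb: "in_Lp p ?b" by (rule gradb[OF vm W0D(2)[OF W] v_in])
  have Lbn: "in_Lp p (?bn n)" for n by (rule gradb[OF \<psi>m test_in_Lp(2)[OF \<psi> p0(1)] \<psi>_in])
  have Wn: "W0 p \<Omega> (?an n) (?bn n)" for n
  proof -
    obtain K where K: "compact K" "K \<subseteq> \<Omega>" "\<And>x. x \<notin> K \<Longrightarrow> \<psi> n x = 0"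
      using test_functionsE[OF \<psi>[of n]] by metis
    show ?thesis
    proof (rule W0_compact_support[OF p wn Lan Lbn \<Omega>(1) K(1,2)])
      fix x assume "x \<notin> K"
      then have "\<psi> n x = 0" by (rule K(3))
      then show "?an n x = 0" "?bn n x = 0" using \<zeta>[of x] by auto
    qed
  qed
  have lima: "(\<lambda>n. Lp_int p (\<lambda>x. ?an n x - ?a x)) \<longlonglongrightarrow> 0"
  proof (rule Lim_null_comparison[OF _ lim(1)], rule always_eventually, rule allI)
    fix n
    have "Lp_int p (\<lambda>x. ?an n x - ?a x) \<le> Lp_int p (\<lambda>x. \<psi> n x - v x)"
    proof (rule in_Lp_bound(2)[OF L\<psi>(1) p0(2)])
      show "(\<lambda>x. ?an n x - ?a x) \<in> borel_measurable lebesgue" using \<psi>m \<zeta>m vm by measurable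
    qed (auto simp: max_def)
    then show "norm (Lp_int p (\<lambda>x. ?an n x - ?a x)) \<le> Lp_int p (\<lambda>x. \<psi> n x - v x)"
      using Lp_int_nonneg[of p "\<lambda>x. ?an n x - ?a x"] by simp
  qed
  \<comment> \<open>The difference of the gradients is \<open>?s + ?t\<close>: in \<open>?s\<close>
    the gradient moves while the set is that of \<psi>_n, in \<open>?t\<close> the gradient is that
    of the limit and only the set moves.\<close>
  let ?s = "\<lambda>n x. if \<zeta> x < \<psi> n x then grad (\<psi> n) x - g x else 0"
  let ?t = "\<lambda>n x. (if \<zeta> x < \<psi> n x then g x - h x else 0) - (if \<zeta> x < v x then g x - h x else 0)"
  have Lt1: "in_Lp p (\<lambda>x. if \<zeta> x < \<psi> n x then g x - h x else 0)" for n
    by (rule gradb[OF \<psi>m W0D(2)[OF W] \<psi>_in])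
  have Lt: "in_Lp p (?t n)" for n by (rule in_Lp_diff(1)[OF Lt1 Lb p0(2)])
  have sm: "?s n \<in> borel_measurable lebesgue" for n using \<zeta>m \<psi>m[of n] d\<psi>m[of n] gm by measurable
  have Ls: "in_Lp p (?s n)" "Lp_int p (?s n) \<le> Lp_int p (\<lambda>x. grad (\<psi> n) x - g x)" for n
    using in_Lp_bound[OF L\<psi>(2)[of n] p0(2) sm[of n]] by auto
  let ?d = "\<lambda>x. ?I x *\<^sub>R (g x - h x)"
  have Ld: "in_Lp p ?d"
  proof -
    have "in_Lp p (\<lambda>x. ?I x *\<^sub>R g x)"
      by (rule in_Lp_bound(1)[OF W0D(2)[OF W] p0(2)]) (use gm in \<open>measurable, auto simp: indicator_def\<close>)
    from in_Lp_diff(1)[OF this hp[of R] p0(2)] show ?thesis by (simp add: scaleR_diff_right)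
  qed
  have limt: "(\<lambda>n. Lp_int p (?t n)) \<longlonglongrightarrow> 0"
  proof -
    have "(\<lambda>n. LINT x|lebesgue. norm (?t n x) powr p) \<longlonglongrightarrow> (LINT x::real^'a|lebesgue. (0::real))"
    proof (rule integral_dominated_convergence[OF _ _ in_LpD(2)[OF Ld]])
      show "(\<lambda>x. norm (?t n x) powr p) \<in> borel_measurable lebesgue" for n
        using in_LpD(2)[OF Lt[of n]] by (rule borel_measurable_integrable)
      show "AE x in lebesgue. norm (norm (?t n x) powr p) \<le> norm (?d x) powr p" for n
      proof (rule AE_I2)
        fix x
        have "norm (?t n x) \<le> norm (?d x)"
          using I1 v_in[of x] \<psi>_in[of x n] by (cases "x \<in> \<Omega>") (auto simp: norm_minus_commute)
        then have "norm (?t n x) powr p \<le> norm (?d x) powr p" using p by (intro powr_mono2) auto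
        then show "norm (norm (?t n x) powr p) \<le> norm (?d x) powr p" by simp
      qed
      \<comment> \<open>Off the set v = \<zeta> the indicator functions eventually agree. On that
        set they may oscillate forever, but there the gradient of v - \<zeta> vanishes.\<close>
      have "AE x in lebesgue. v x - \<zeta> x = 0 \<longrightarrow> g x - h x = 0"
        by (rule wgrad_zero_level[OF wgrad_diff[OF W0_wgrad[OF p W] w]])
      with r(2) show "AE x in lebesgue. (\<lambda>n. norm (?t n x) powr p) \<longlonglongrightarrow> 0"
      proof eventually_elim
        case (elim x)
        show ?case
        proof (cases "x \<in> \<Omega> \<and> v x \<noteq> \<zeta> x")
          case False
          then have "g x - h x = 0 \<or> x \<notin> \<Omega>" using elim(2) by force
          then have "?t n x = 0" for n
            using v_in[of x] \<psi>_in[of x n] by auto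
          then show ?thesis by simp
        next
          case True
          then have "(\<lambda>n. norm (\<psi> n x - v x)) \<longlonglongrightarrow> 0" using elim(1) I1 by (simp add: \<psi>_def)
          from LIM_zero_cancel[OF tendsto_norm_zero_cancel[OF this]]
          have l: "(\<lambda>n. \<psi> n x) \<longlonglongrightarrow> v x" .
          have "\<forall>\<^sub>F n in sequentially. (\<zeta> x < \<psi> n x) = (\<zeta> x < v x)"
          proof (cases "\<zeta> x < v x")
            case True
            then show ?thesis using order_tendstoD(1)[OF l] by simp
          next
            case False
            then have "v x < \<zeta> x" using \<open>x \<in> \<Omega> \<and> v x \<noteq> \<zeta> x\<close> by simp
            from order_tendstoD(2)[OF l this] False show ?thesis by (auto elim: eventually_mono)
          qed
          then have "\<forall>\<^sub>F n in sequentially. norm (?t n x) powr p = 0" by eventually_elim auto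
          then show ?thesis by (rule tendsto_eventually)
        qed
      qed
    qed simp
    then show ?thesis by (simp add: Lp_int_def)
  qed
  have limb: "(\<lambda>n. Lp_int p (\<lambda>x. ?bn n x - ?b x)) \<longlonglongrightarrow> 0"
  proof (rule Lim_null_comparison, rule always_eventually, rule allI)
    fix n
    have "(\<lambda>x. ?bn n x - ?b x) = (\<lambda>x. ?s n x + ?t n x)" by (auto simp: fun_eq_iff)
    then have "Lp_int p (\<lambda>x. ?bn n x - ?b x) \<le> 2 powr p * (Lp_int p (?s n) + Lp_int p (?t n))"
      using in_Lp_add(2)[OF Ls(1)[of n] Lt[of n] p0(2)] by simp
    also have "\<dots> \<le> 2 powr p * (Lp_int p (\<lambda>x. grad (\<psi> n) x - g x) + Lp_int p (?t n))"
      using Ls(2)[of n] by (intro mult_left_mono add_right_mono) auto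
    finally show "norm (Lp_int p (\<lambda>x. ?bn n x - ?b x)) \<le> 2 powr p * (Lp_int p (\<lambda>x. grad (\<psi> n) x - g x) + Lp_int p (?t n))"
      using Lp_int_nonneg[of p "\<lambda>x. ?bn n x - ?b x"] by simp
  next
    show "(\<lambda>n. 2 powr p * (Lp_int p (\<lambda>x. grad (\<psi> n) x - g x) + Lp_int p (?t n))) \<longlonglongrightarrow> 0"
      using tendsto_mult_left[OF tendsto_add[OF lim(2) limt], of "2 powr p"] by simp
  qed
  show ?thesis
  proof (rule W0_limit[OF p0(1) La Lb _ _ Wn lima limb])
    show "?a x = 0" "?b x = 0" if "x \<notin> \<Omega>" for x
      using that v_in[of x] W0D(3)[OF W that] \<zeta>[of x] by auto
  qed
qed

text \<open>Gradients of test functions have integral 0, and on the bounded set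
  \<open>\<Omega>\<close> convergence in L^p implies convergence of the integrals.\<close>

lemma W0_integral_gradient:
  assumes p: "1 \<le> p" and \<Omega>: "bounded \<Omega>" and W: "W0 p \<Omega> v g"
  shows "integrable lebesgue g" "(LINT x|lebesgue. g x) = 0"
proof -
  obtain R where R: "\<And>x. x \<in> \<Omega> \<Longrightarrow> norm x \<le> R" using \<Omega> unfolding bounded_iff by blast
  have lg: "locint g" by (rule in_Lp_locint[OF p W0D(2)[OF W]])
  have "(\<lambda>x. indicator (cball 0 R) x *\<^sub>R g x) = g"
    using W0D(4)[OF W] R by (auto simp: fun_eq_iff indicator_def)
  moreover have "integrable lebesgue (\<lambda>x. indicator (cball 0 R) x *\<^sub>R g x)"
    using lg unfolding locint_def set_integrable_def by blast
  ultimately show gi: "integrable lebesgue g" by simp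
  obtain \<psi> where \<psi>: "\<And>n. \<psi> n \<in> test_functions \<Omega>"
    "(\<lambda>n. Lp_int p (\<lambda>x. \<psi> n x - v x)) \<longlonglongrightarrow> 0" "(\<lambda>n. Lp_int p (\<lambda>x. grad (\<psi> n) x - g x)) \<longlonglongrightarrow> 0"
    using W0_sequence[OF W] by blast
  have L: "in_Lp p (\<lambda>x. grad (\<psi> n) x - g x)" for n
    using test_in_Lp[OF \<psi>(1)] W0D(1,2)[OF W] p by (auto intro!: in_Lp_diff)
  have zero: "(LINT x|lebesgue. grad (\<psi> n) x) = 0" and gi': "integrable lebesgue (grad (\<psi> n))" for n
  proof -
    obtain S where S: "smooth (\<psi> n)" "\<forall>x. norm x > S \<longrightarrow> \<psi> n x = 0"
      using test_functionsE[OF \<psi>(1)[of n]] by metis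
    then have g0: "\<And>x. norm x > S \<Longrightarrow> grad (\<psi> n) x = 0" using grad_eq_0_outside[of S "\<psi> n"] by blast
    show "(LINT x|lebesgue. grad (\<psi> n) x) = 0"
      using S g0 by (intro integral_gradient_eq_0[where f = "\<psi> n" and R = S] smooth_has_grad continuous_on_grad) auto
    show "integrable lebesgue (grad (\<psi> n))"
      by (rule integrable_compactly_supported[OF continuous_on_grad[OF S(1)] g0])
  qed
  have "(\<lambda>n. LINT x|lebesgue. grad (\<psi> n) x) \<longlonglongrightarrow> (LINT x|lebesgue. g x)"
  proof (rule integral_tendsto_of_bound[where E = "\<lambda>n x. indicator (cball 0 R) x * norm (grad (\<psi> n) x - g x)"])
    show "integrable lebesgue (\<lambda>x. indicator (cball 0 R) x * norm (grad (\<psi> n) x - g x))" for n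
      by (rule locint_norm_integrable[OF in_Lp_locint[OF p L]])
    show "(\<lambda>n. LINT x|lebesgue. indicator (cball 0 R) x * norm (grad (\<psi> n) x - g x)) \<longlonglongrightarrow> 0"
      by (rule Lp_tendsto_local_L1[OF p L \<psi>(3)])
    show "norm (grad (\<psi> n) x - g x) \<le> indicator (cball 0 R) x * norm (grad (\<psi> n) x - g x)" for n x
      using R test_functions_outside(2)[OF \<psi>(1), of x n] W0D(4)[OF W, of x]
      by (cases "x \<in> \<Omega>") auto
  qed (use gi gi' in auto)
  then show "(LINT x|lebesgue. g x) = 0"
    using LIMSEQ_unique[OF tendsto_const] unfolding zero by metis
qed

section \<open>Passage between the spaces on \<open>\<Omega>\<close> and zero extensions\<close>

lemma Lp_iff_in_Lp:
  assumes "open \<Omega>" "0 \<le> p"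
  shows "f \<in> Lp p \<Omega> \<longleftrightarrow> in_Lp p (\<lambda>x. indicator \<Omega> x *\<^sub>R f x)"
proof -
  have S: "\<Omega> \<inter> space lebesgue \<in> sets lebesgue" using assms(1) by simp
  have "norm (indicat_real \<Omega> x *\<^sub>R f x) powr p = indicat_real \<Omega> x *\<^sub>R (norm (f x) powr p)" for x
    by (simp add: indicator_def)
  then show ?thesis
    by (simp only: Lp_def in_Lp_def mem_Collect_eq borel_measurable_restrict_space_iff[OF S] integrable_restrict_space[OF S])
qed

lemma integral_lebesgue_on_powr:
  assumes "open \<Omega>"
  shows "(LINT x|lebesgue_on \<Omega>. norm (f x) powr p) = Lp_int p (\<lambda>x. indicator \<Omega> x *\<^sub>R f x)"
proof -
  have S: "\<Omega> \<inter> space lebesgue \<in> sets lebesgue" using assms(1) by simp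
  have "norm (indicat_real \<Omega> x *\<^sub>R f x) powr p = indicat_real \<Omega> x *\<^sub>R (norm (f x) powr p)" for x
    by (simp add: indicator_def)
  then show ?thesis unfolding Lp_int_def by (simp only: integral_restrict_space[OF S])
qed

text \<open>Exhaust \<open>\<Omega>\<close> by compact sets, on each of which \<open>f\<close> is
  integrable; the values of \<open>f\<close> outside \<open>\<Omega>\<close> are arbitrary and are
  masked by the indicator.\<close>

lemma locally_integrable_measurable:
  fixes f :: "real^'n \<Rightarrow> 'b::euclidean_space"
  assumes "open \<Omega>" "locally_integrable \<Omega> f"
  shows "(\<lambda>x. indicator \<Omega> x *\<^sub>R f x) \<in> borel_measurable lebesgue"
proof -
  obtain C :: "nat \<Rightarrow> (real^'n) set" where C: "\<And>n. compact (C n)" "\<And>n. C n \<subseteq> \<Omega>"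
    "\<And>n. C n \<subseteq> interior (C (Suc n))" "\<Union>(range C) = \<Omega>"
    using open_Union_compact_subsets[OF assms(1)] by metis
  have mono: "C m \<subseteq> C n" if "m \<le> n" for m n
    using lift_Suc_mono_le[of C, OF _ that] C(3) interior_subset by (metis order_trans)
  show ?thesis
  proof (rule borel_measurable_LIMSEQ_metric)
    show "(\<lambda>x. indicator (C n) x *\<^sub>R f x) \<in> borel_measurable lebesgue" for n
      using assms(2) C(1,2) unfolding locally_integrable_def set_integrable_def
      by (blast intro: borel_measurable_integrable)
    show "(\<lambda>n. indicator (C n) x *\<^sub>R f x) \<longlonglongrightarrow> indicator \<Omega> x *\<^sub>R f x" for x
    proof (cases "x \<in> \<Omega>")
      case True
      then obtain m where m: "x \<in> C m" using C(4) by blast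
      have "\<forall>\<^sub>F n in sequentially. indicator (C n) x *\<^sub>R f x = indicator \<Omega> x *\<^sub>R f x"
        using eventually_ge_at_top[of m]
      proof eventually_elim
        case (elim n)
        then show ?case using mono[OF elim] m True by auto
      qed
      then show ?thesis by (rule tendsto_eventually)
    next
      case False
      then have "x \<notin> C n" for n using C(2) by blast
      then show ?thesis using False by simp
    qed
  qed
qed

lemma Lp_int_cong_AE:
  assumes "f \<in> borel_measurable lebesgue" "g \<in> borel_measurable lebesgue" "AE x in lebesgue. f x = g x"
  shows "Lp_int p f = Lp_int p g"
  unfolding Lp_int_def
proof (rule integral_cong_AE)
  show "(\<lambda>x. norm (f x) powr p) \<in> borel_measurable lebesgue" "(\<lambda>x. norm (g x) powr p) \<in> borel_measurable lebesgue"
    using assms(1,2) by measurable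
qed (use assms(3) in \<open>auto elim: eventually_mono\<close>)

lemma in_Lp_cong_AE:
  assumes "in_Lp p f" "g \<in> borel_measurable lebesgue" "AE x in lebesgue. f x = g x"
  shows "in_Lp p g"
  unfolding in_Lp_def
proof (intro conjI assms(2) integrable_cong_AE_imp[OF in_LpD(2)[OF assms(1)]])
  show "(\<lambda>x. norm (g x) powr p) \<in> borel_measurable lebesgue"
    using assms(2) by measurable
qed (use assms(3) in \<open>auto elim: eventually_mono\<close>)

lemma weak_grad_AE:
  assumes "open \<Omega>" "has_weak_gradient \<Omega> u g"
  shows "has_weak_gradient \<Omega> u (weak_grad \<Omega> u)" "AE x in lebesgue. x \<in> \<Omega> \<longrightarrow> weak_grad \<Omega> u x = g x"
    "(\<lambda>x. indicator \<Omega> x *\<^sub>R weak_grad \<Omega> u x) \<in> borel_measurable lebesgue"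
proof -
  show w: "has_weak_gradient \<Omega> u (weak_grad \<Omega> u)"
    unfolding weak_grad_def by (rule someI[of "has_weak_gradient \<Omega> u", OF assms(2)])
  show "AE x in lebesgue. x \<in> \<Omega> \<longrightarrow> weak_grad \<Omega> u x = g x"
    by (rule weak_gradient_unique[OF assms(1) w assms(2)])
  show "(\<lambda>x. indicator \<Omega> x *\<^sub>R weak_grad \<Omega> u x) \<in> borel_measurable lebesgue"
    using w unfolding has_weak_gradient_def by (intro locally_integrable_measurable assms(1)) auto
qed

text \<open>Frees the norm from the choice hidden in \<open>weak_grad\<close>: by uniqueness any
  weak gradient at hand may be inserted.\<close>

lemma W1p_norm_eq:
  assumes "open \<Omega>" "has_weak_gradient \<Omega> u g"
  shows "W1p_norm p \<Omega> u = (Lp_int p (\<lambda>x. indicator \<Omega> x *\<^sub>R u x) + Lp_int p (\<lambda>x. indicator \<Omega> x *\<^sub>R g x)) powr (1 / p)"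
proof -
  note W = weak_grad_AE[OF assms]
  have "Lp_int p (\<lambda>x. indicator \<Omega> x *\<^sub>R weak_grad \<Omega> u x) = Lp_int p (\<lambda>x. indicator \<Omega> x *\<^sub>R g x)"
  proof (rule Lp_int_cong_AE[OF W(3)])
    show "(\<lambda>x. indicator \<Omega> x *\<^sub>R g x) \<in> borel_measurable lebesgue"
      using assms(2) unfolding has_weak_gradient_def by (intro locally_integrable_measurable assms(1)) auto
    show "AE x in lebesgue. indicat_real \<Omega> x *\<^sub>R weak_grad \<Omega> u x = indicat_real \<Omega> x *\<^sub>R g x"
      using W(2) by eventually_elim (auto simp: indicator_def)
  qed
  moreover have "(LINT x|lebesgue_on \<Omega>. \<bar>u x\<bar> powr p) = Lp_int p (\<lambda>x. indicator \<Omega> x *\<^sub>R u x)"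
    using integral_lebesgue_on_powr[OF assms(1), of u p] by (simp only: real_norm_def)
  ultimately show ?thesis
    unfolding W1p_norm_def by (simp only: integral_lebesgue_on_powr[OF assms(1)])
qed

lemma has_weak_gradient_diff:
  assumes "open \<Omega>" "has_weak_gradient \<Omega> u g" "has_weak_gradient \<Omega> v h"
  shows "has_weak_gradient \<Omega> (\<lambda>x. u x - v x) (\<lambda>x. g x - h x)"
proof -
  have li: "locally_integrable \<Omega> u" "locally_integrable \<Omega> g" "locally_integrable \<Omega> v" "locally_integrable \<Omega> h"
    using assms(2,3) by (simp_all add: has_weak_gradient_def)
  have parts: "(LINT x|lebesgue. u x *\<^sub>R grad \<psi> x) = - (LINT x|lebesgue. \<psi> x *\<^sub>R k x)"
    if "has_weak_gradient \<Omega> u k" "\<psi> \<in> test_functions \<Omega>" for u k \<psi>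
    using that unfolding has_weak_gradient_iff[OF assms(1)] by blast
  show ?thesis
    unfolding has_weak_gradient_iff[OF assms(1)]
  proof (intro conjI ballI locally_integrable_diff li)
    fix \<psi> assume \<psi>: "\<psi> \<in> test_functions \<Omega>"
    note i = test_locally_integrable(2)[OF \<psi> li(1)] test_locally_integrable(2)[OF \<psi> li(3)]
      test_locally_integrable(1)[OF \<psi> li(2)] test_locally_integrable(1)[OF \<psi> li(4)]
    show "(LINT x|lebesgue. (u x - v x) *\<^sub>R grad \<psi> x) = - (LINT x|lebesgue. \<psi> x *\<^sub>R (g x - h x))"
      unfolding scaleR_diff_left scaleR_diff_right Bochner_Integration.integral_diff[OF i(1,2)]
        Bochner_Integration.integral_diff[OF i(3,4)] parts[OF assms(2) \<psi>] parts[OF assms(3) \<psi>] by simp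
  qed
qed

lemma has_weak_gradient_cong_AE:
  assumes \<Omega>: "open \<Omega>" and w: "has_weak_gradient \<Omega> u g"
    and u': "(\<lambda>x. indicator \<Omega> x *\<^sub>R u' x) \<in> borel_measurable lebesgue" "AE x in lebesgue. x \<in> \<Omega> \<longrightarrow> u' x = u x"
  shows "has_weak_gradient \<Omega> u' g"
proof -
  have li: "locally_integrable \<Omega> u" "locally_integrable \<Omega> g"
    using w by (simp_all add: has_weak_gradient_def)
  have um: "(\<lambda>x. indicator \<Omega> x *\<^sub>R u x) \<in> borel_measurable lebesgue"
    by (rule locally_integrable_measurable[OF \<Omega> li(1)])
  show ?thesis
    unfolding has_weak_gradient_iff[OF \<Omega>]
  proof (intro conjI ballI li)
    show "locally_integrable \<Omega> u'"
      unfolding locally_integrable_def set_integrable_def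
    proof (intro allI impI)
      fix K assume K: "compact K \<and> K \<subseteq> \<Omega>"
      then have "integrable lebesgue (\<lambda>x. indicat_real K x *\<^sub>R u x)"
        using li(1) unfolding locally_integrable_def set_integrable_def by blast
      then show "integrable lebesgue (\<lambda>x. indicat_real K x *\<^sub>R u' x)"
      proof (rule integrable_cong_AE_imp)
        have Km[measurable]: "K \<in> sets lebesgue" using K by (simp add: borel_compact)
        have "(\<lambda>x. indicat_real K x *\<^sub>R (indicat_real \<Omega> x *\<^sub>R u' x)) \<in> borel_measurable lebesgue"
          using u'(1) by measurable
        moreover have "(\<lambda>x. indicat_real K x *\<^sub>R (indicat_real \<Omega> x *\<^sub>R u' x)) = (\<lambda>x. indicat_real K x *\<^sub>R u' x)"
          using K by (auto simp: fun_eq_iff indicator_def)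
        ultimately show "(\<lambda>x. indicat_real K x *\<^sub>R u' x) \<in> borel_measurable lebesgue" by simp
        show "AE x in lebesgue. indicat_real K x *\<^sub>R u x = indicat_real K x *\<^sub>R u' x"
          using u'(2) by eventually_elim (use K in \<open>auto simp: indicator_def\<close>)
      qed
    qed
    fix \<psi> assume \<psi>: "\<psi> \<in> test_functions \<Omega>"
    have gm: "grad \<psi> \<in> borel_measurable lebesgue"
      by (rule continuous_lebesgue_measurable[OF continuous_on_grad[OF test_functions_smooth[OF \<psi>]]])
    have eq: "k x *\<^sub>R grad \<psi> x = (indicator \<Omega> x *\<^sub>R k x) *\<^sub>R grad \<psi> x" for k :: "real^'a \<Rightarrow> real" and x
      using test_functions_outside(2)[OF \<psi>, of x] by (auto simp: indicator_def)
    have "(LINT x|lebesgue. u' x *\<^sub>R grad \<psi> x) = (LINT x|lebesgue. u x *\<^sub>R grad \<psi> x)"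
    proof (subst (1 2) eq, rule integral_cong_AE)
      show "(\<lambda>x. (indicat_real \<Omega> x *\<^sub>R u' x) *\<^sub>R grad \<psi> x) \<in> borel_measurable lebesgue"
        by (rule borel_measurable_scaleR[OF u'(1) gm])
      show "(\<lambda>x. (indicat_real \<Omega> x *\<^sub>R u x) *\<^sub>R grad \<psi> x) \<in> borel_measurable lebesgue"
        by (rule borel_measurable_scaleR[OF um gm])
      show "AE x in lebesgue. (indicat_real \<Omega> x *\<^sub>R u' x) *\<^sub>R grad \<psi> x = (indicat_real \<Omega> x *\<^sub>R u x) *\<^sub>R grad \<psi> x"
        using u'(2) by eventually_elim (auto simp: indicator_def)
    qed
    also have "\<dots> = - (LINT x|lebesgue. \<psi> x *\<^sub>R g x)"
      using w \<psi> unfolding has_weak_gradient_iff[OF \<Omega>] by blast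
    finally show "(LINT x|lebesgue. u' x *\<^sub>R grad \<psi> x) = - (LINT x|lebesgue. \<psi> x *\<^sub>R g x)" .
  qed
qed

lemma powr_less_iff:
  assumes "0 < p" "0 \<le> (a::real)" "0 < e"
  shows "a powr (1 / p) < e \<longleftrightarrow> a < e powr p"
proof -
  have "(a powr (1 / p)) powr p = a" using assms by (cases "a = 0") (auto simp: powr_powr)
  then show ?thesis using powr_less_mono2[of p "a powr (1 / p)" e] powr_mono2[of p e "a powr (1 / p)"] assms
    by (cases "a powr (1 / p) < e") auto
qed

lemma W1p_0_imp_W0:
  assumes p: "1 \<le> p" and \<Omega>: "open \<Omega>" and v: "v \<in> W1p_0 p \<Omega>"
  obtains g where "has_weak_gradient \<Omega> v g" "W0 p \<Omega> (\<lambda>x. indicator \<Omega> x *\<^sub>R v x) (\<lambda>x. indicator \<Omega> x *\<^sub>R g x)"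
proof -
  have p0: "0 < p" "0 \<le> p" using p by auto
  obtain g where g: "v \<in> Lp p \<Omega>" "g \<in> Lp p \<Omega>" "has_weak_gradient \<Omega> v g"
    and app: "\<And>e. 0 < e \<Longrightarrow> \<exists>\<psi>\<in>test_functions \<Omega>. W1p_norm p \<Omega> (\<lambda>x. v x - \<psi> x) < e"
    using v by (auto simp: W1p_0_def W1p_def)
  have "W0 p \<Omega> (\<lambda>x. indicator \<Omega> x *\<^sub>R v x) (\<lambda>x. indicator \<Omega> x *\<^sub>R g x)"
    unfolding W0_def
  proof (intro conjI allI impI)
    show "in_Lp p (\<lambda>x. indicat_real \<Omega> x *\<^sub>R v x)" "in_Lp p (\<lambda>x. indicat_real \<Omega> x *\<^sub>R g x)"
      using g(1,2) unfolding Lp_iff_in_Lp[OF \<Omega> p0(2)] by auto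
    fix e :: real assume e: "0 < e"
    \<comment> \<open>The norm is the p-th root of a sum of two nonnegative integrals, so this
      threshold puts each of them below \<open>e\<close>.\<close>
    obtain \<psi> where \<psi>: "\<psi> \<in> test_functions \<Omega>" "W1p_norm p \<Omega> (\<lambda>x. v x - \<psi> x) < e powr (1 / p)"
      using app[of "e powr (1 / p)"] e by auto
    have w: "has_weak_gradient \<Omega> (\<lambda>x. v x - \<psi> x) (\<lambda>x. g x - grad \<psi> x)"
      by (intro has_weak_gradient_diff \<Omega> g(3) wgrad_has_weak_gradient wgrad_smooth test_functions_smooth[OF \<psi>(1)])
    have "(Lp_int p (\<lambda>x. indicator \<Omega> x *\<^sub>R (v x - \<psi> x)) + Lp_int p (\<lambda>x. indicator \<Omega> x *\<^sub>R (g x - grad \<psi> x))) powr (1 / p) < e powr (1 / p)"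
      using \<psi>(2) unfolding W1p_norm_eq[OF \<Omega> w] .
    then have "Lp_int p (\<lambda>x. indicator \<Omega> x *\<^sub>R (v x - \<psi> x)) + Lp_int p (\<lambda>x. indicator \<Omega> x *\<^sub>R (g x - grad \<psi> x)) < (e powr (1 / p)) powr p"
      using p0 e by (subst (asm) powr_less_iff) (auto intro!: add_nonneg_nonneg Lp_int_nonneg)
    also have "\<dots> = e" using p0 e by (simp add: powr_powr)
    finally have less: "Lp_int p (\<lambda>x. indicator \<Omega> x *\<^sub>R (v x - \<psi> x)) + Lp_int p (\<lambda>x. indicator \<Omega> x *\<^sub>R (g x - grad \<psi> x)) < e" .
    have "(\<lambda>x. \<psi> x - indicat_real \<Omega> x *\<^sub>R v x) = (\<lambda>x. - (indicator \<Omega> x *\<^sub>R (v x - \<psi> x)))"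
      "(\<lambda>x. grad \<psi> x - indicat_real \<Omega> x *\<^sub>R g x) = (\<lambda>x. - (indicator \<Omega> x *\<^sub>R (g x - grad \<psi> x)))"
      using test_functions_outside[OF \<psi>(1)] by (auto simp: fun_eq_iff indicator_def)
    then have eq: "Lp_int p (\<lambda>x. \<psi> x - indicat_real \<Omega> x *\<^sub>R v x) = Lp_int p (\<lambda>x. indicator \<Omega> x *\<^sub>R (v x - \<psi> x))"
      "Lp_int p (\<lambda>x. grad \<psi> x - indicat_real \<Omega> x *\<^sub>R g x) = Lp_int p (\<lambda>x. indicator \<Omega> x *\<^sub>R (g x - grad \<psi> x))"
      by (simp_all only: in_Lp_uminus(2))
    show "\<exists>\<psi>\<in>test_functions \<Omega>. Lp_int p (\<lambda>x. \<psi> x - indicat_real \<Omega> x *\<^sub>R v x) < e \<and> Lp_int p (\<lambda>x. grad \<psi> x - indicat_real \<Omega> x *\<^sub>R g x) < e"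
      using \<psi>(1) less Lp_int_nonneg[of p "\<lambda>x. indicator \<Omega> x *\<^sub>R (v x - \<psi> x)"]
        Lp_int_nonneg[of p "\<lambda>x. indicator \<Omega> x *\<^sub>R (g x - grad \<psi> x)"]
      by (intro bexI[of _ \<psi>]) (auto simp only: eq)
  qed auto
  with g(3) show ?thesis by (rule that)
qed

lemma W0_imp_W1p_0:
  assumes p: "1 \<le> p" and \<Omega>: "open \<Omega>" and W: "W0 p \<Omega> v g"
    and f: "(\<lambda>x. indicator \<Omega> x *\<^sub>R f x) \<in> borel_measurable lebesgue" "AE x in lebesgue. x \<in> \<Omega> \<longrightarrow> f x = v x"
  shows "f \<in> W1p_0 p \<Omega>" "has_weak_gradient \<Omega> f g"
proof -
  have p0: "0 < p" "0 \<le> p" using p by auto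
  show w: "has_weak_gradient \<Omega> f g"
    by (rule has_weak_gradient_cong_AE[OF \<Omega> wgrad_has_weak_gradient[OF \<Omega> W0_wgrad[OF p W]] f])
  have Iv: "(\<lambda>x. indicat_real \<Omega> x *\<^sub>R v x) = v" "(\<lambda>x. indicat_real \<Omega> x *\<^sub>R g x) = g"
    using W0D(3,4)[OF W] by (auto simp: fun_eq_iff indicator_def)
  have AE: "AE x in lebesgue. v x = indicat_real \<Omega> x *\<^sub>R f x"
    using f(2) by eventually_elim (use W0D(3)[OF W] in \<open>auto simp: indicator_def\<close>)
  have fL: "f \<in> Lp p \<Omega>"
    unfolding Lp_iff_in_Lp[OF \<Omega> p0(2)] by (rule in_Lp_cong_AE[OF W0D(1)[OF W] f(1) AE])
  have gL: "g \<in> Lp p \<Omega>" unfolding Lp_iff_in_Lp[OF \<Omega> p0(2)] Iv(2) by (rule W0D(2)[OF W])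
  have "\<exists>\<psi>\<in>test_functions \<Omega>. W1p_norm p \<Omega> (\<lambda>x. f x - \<psi> x) < e" if e: "0 < e" for e
  proof -
    have "0 < e powr p / 2" using e by simp
    then obtain \<psi> where \<psi>: "\<psi> \<in> test_functions \<Omega>" "Lp_int p (\<lambda>x. \<psi> x - v x) < e powr p / 2"
      "Lp_int p (\<lambda>x. grad \<psi> x - g x) < e powr p / 2"
      using W unfolding W0_def by blast
    have w': "has_weak_gradient \<Omega> (\<lambda>x. f x - \<psi> x) (\<lambda>x. g x - grad \<psi> x)"
      by (intro has_weak_gradient_diff \<Omega> w wgrad_has_weak_gradient wgrad_smooth test_functions_smooth[OF \<psi>(1)])
    have pm: "\<psi> \<in> borel_measurable lebesgue"
      by (rule continuous_lebesgue_measurable[OF smooth_continuous[OF test_functions_smooth[OF \<psi>(1)]]])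
    have "(\<lambda>x. indicat_real \<Omega> x *\<^sub>R (f x - \<psi> x)) = (\<lambda>x. indicat_real \<Omega> x *\<^sub>R f x - \<psi> x)"
      using test_functions_outside(1)[OF \<psi>(1)] by (auto simp: fun_eq_iff indicator_def)
    then have "Lp_int p (\<lambda>x. indicator \<Omega> x *\<^sub>R (f x - \<psi> x)) = Lp_int p (\<lambda>x. indicat_real \<Omega> x *\<^sub>R f x - \<psi> x)"
      by simp
    also have "\<dots> = Lp_int p (\<lambda>x. v x - \<psi> x)"
    proof (rule Lp_int_cong_AE)
      show "(\<lambda>x. indicat_real \<Omega> x *\<^sub>R f x - \<psi> x) \<in> borel_measurable lebesgue"
        by (rule borel_measurable_diff[OF f(1) pm])
      show "(\<lambda>x. v x - \<psi> x) \<in> borel_measurable lebesgue"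
        by (rule borel_measurable_diff[OF in_LpD(1)[OF W0D(1)[OF W]] pm])
    qed (use AE in \<open>auto elim: eventually_mono\<close>)
    also have "\<dots> < e powr p / 2" using \<psi>(2) by (simp only: Lp_int_commute[of p v])
    finally have 1: "Lp_int p (\<lambda>x. indicator \<Omega> x *\<^sub>R (f x - \<psi> x)) < e powr p / 2" .
    have "(\<lambda>x. indicat_real \<Omega> x *\<^sub>R (g x - grad \<psi> x)) = (\<lambda>x. g x - grad \<psi> x)"
      using test_functions_outside(2)[OF \<psi>(1)] W0D(4)[OF W] by (auto simp: fun_eq_iff indicator_def)
    then have 2: "Lp_int p (\<lambda>x. indicator \<Omega> x *\<^sub>R (g x - grad \<psi> x)) < e powr p / 2"
      using \<psi>(3) by (simp only: Lp_int_commute[of p g])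
    have "W1p_norm p \<Omega> (\<lambda>x. f x - \<psi> x) < e"
      unfolding W1p_norm_eq[OF \<Omega> w'] using 1 2 p0 e
      by (subst powr_less_iff) (auto intro!: add_nonneg_nonneg Lp_int_nonneg)
    then show ?thesis using \<psi>(1) by blast
  qed
  then show "f \<in> W1p_0 p \<Omega>" using fL gL w by (auto simp: W1p_0_def W1p_def)
qed

section \<open>Truncation\<close>

text \<open>The slope \<open>q\<close> maximizes the concave function \<open>q \<mapsto> (INF \<xi>. L \<xi> - q \<bullet> \<xi>)\<close>; if \<open>0\<close> could be
  separated from the set of almost contact points, then tilting \<open>q\<close> would increase it.\<close>
lemma affine_minorant_almost_contact:
  fixes L :: "real^'n \<Rightarrow> real"
  assumes L: "continuous_on UNIV L" and sup: "\<And>M. \<exists>R. \<forall>\<xi>. norm \<xi> \<ge> R \<longrightarrow> M * norm \<xi> \<le> L \<xi>"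
  obtains q g F where "finite F" "0 \<in> convex hull F" "\<And>\<xi>. g + q \<bullet> \<xi> \<le> L \<xi>" "\<And>\<xi>. \<xi> \<in> F \<Longrightarrow> L \<xi> \<le> g + q \<bullet> \<xi> + 1"
proof -
  \<comment> \<open>Minus the convex conjugate of \<open>L\<close>. An infimum of affine functions
    of \<open>q\<close> is concave, hence continuous once it is finite everywhere.\<close>
  define f where "f q = (INF \<xi>. L \<xi> - q \<bullet> \<xi>)" for q
  have bdd: "bdd_below (range (\<lambda>\<xi>. L \<xi> - q \<bullet> \<xi>))" for q
  proof -
    obtain R where R: "\<And>\<xi>. norm \<xi> \<ge> R \<Longrightarrow> norm q * norm \<xi> \<le> L \<xi>" using sup[of "norm q"] by blast
    have "compact ((\<lambda>\<xi>. L \<xi> - q \<bullet> \<xi>) ` cball 0 R)"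
      by (intro compact_continuous_image continuous_intros continuous_on_subset[OF L]) auto
    from compact_imp_bounded[OF this]
    obtain B where B: "\<And>\<xi>. norm \<xi> \<le> R \<Longrightarrow> \<bar>L \<xi> - q \<bullet> \<xi>\<bar> \<le> B"
      unfolding bounded_iff by fastforce
    have "min 0 (- B) \<le> L \<xi> - q \<bullet> \<xi>" for \<xi>
    proof (cases "norm \<xi> \<le> R")
      case True
      then show ?thesis using B[OF True] by linarith
    next
      case False
      then have "norm q * norm \<xi> \<le> L \<xi>" using R by simp
      then show ?thesis using Cauchy_Schwarz_ineq2[of q \<xi>] by linarith
    qed
    then show ?thesis by (intro bdd_belowI[of _ "min 0 (- B)"]) auto
  qed
  have f_le: "f q \<le> L \<xi> - q \<bullet> \<xi>" for q \<xi>
    unfolding f_def by (rule cINF_lower[OF bdd]) simp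
  have f_ge: "a \<le> f q" if "\<And>\<xi>. a \<le> L \<xi> - q \<bullet> \<xi>" for a q
    unfolding f_def by (rule cINF_greatest) (use that in auto)
  have "convex_on UNIV (\<lambda>q. - f q)"
  proof (rule convex_onI)
    fix t x y assume t: "0 < t" "t < (1::real)"
    have "(1 - t) * f x + t * f y \<le> f ((1 - t) *\<^sub>R x + t *\<^sub>R y)"
    proof (rule f_ge)
      fix \<xi>
      have "(1 - t) * f x + t * f y \<le> (1 - t) * (L \<xi> - x \<bullet> \<xi>) + t * (L \<xi> - y \<bullet> \<xi>)"
        using t by (intro add_mono mult_left_mono f_le) auto
      also have "\<dots> = L \<xi> - ((1 - t) *\<^sub>R x + t *\<^sub>R y) \<bullet> \<xi>"
        by (simp add: inner_add_left algebra_simps)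
      finally show "(1 - t) * f x + t * f y \<le> L \<xi> - ((1 - t) *\<^sub>R x + t *\<^sub>R y) \<bullet> \<xi>" .
    qed
    then show "- f ((1 - t) *\<^sub>R x + t *\<^sub>R y) \<le> (1 - t) * - f x + t * - f y" by simp
  qed simp
  then have "continuous_on UNIV (\<lambda>q. - f q)" by (rule convex_on_continuous[OF open_UNIV])
  then have fc: "continuous_on UNIV f" using continuous_on_minus by fastforce
  have "compact (L ` cball 0 1)"
    by (intro compact_continuous_image continuous_on_subset[OF L]) auto
  from compact_imp_bounded[OF this] obtain B where B: "\<And>\<xi>. norm \<xi> \<le> 1 \<Longrightarrow> L \<xi> \<le> B"
    unfolding bounded_iff by (metis abs_le_iff imageI mem_cball_0 real_norm_def)
  have coercive: "f q \<le> B - norm q" for q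
  proof (cases "q = 0")
    case True
    then show ?thesis using f_le[of q 0] B[of 0] by simp
  next
    case False
    have "f q \<le> L (q /\<^sub>R norm q) - q \<bullet> (q /\<^sub>R norm q)" by (rule f_le)
    moreover have "q \<bullet> (q /\<^sub>R norm q) = norm q"
      using False by (simp add: power2_norm_eq_inner[symmetric] power2_eq_square)
    moreover have "L (q /\<^sub>R norm q) \<le> B" using False by (intro B) simp
    ultimately show ?thesis by linarith
  qed
  define r where "r = \<bar>B - f 0\<bar>"
  obtain q where q: "q \<in> cball 0 r" "\<And>q'. q' \<in> cball 0 r \<Longrightarrow> f q' \<le> f q"
    using continuous_attains_sup[of "cball 0 r" f] continuous_on_subset[OF fc] by (auto simp: r_def)
  have qmax: "f q' \<le> f q" for q'
  proof (cases "norm q' \<le> r")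
    case False
    then have "f q' \<le> f 0" using coercive[of q'] by (auto simp: r_def)
    also have "f 0 \<le> f q" using q(2)[of 0] by (simp add: r_def)
    finally show ?thesis .
  qed (use q(2) in simp)
  define S where "S = {\<xi>. L \<xi> \<le> f q + q \<bullet> \<xi> + 1}"
  \<comment> \<open>Besides |q|, which absorbs the linear term, the slope has a reserve of |f q| + 2
    per unit of |\<xi>|. This bounds \<open>S\<close>, and one unit of it can be spent on the tilt
    of \<open>q\<close> below.\<close>
  obtain R where R: "\<And>\<xi>. norm \<xi> \<ge> R \<Longrightarrow> (norm q + \<bar>f q\<bar> + 2) * norm \<xi> \<le> L \<xi>"
    using sup[of "norm q + \<bar>f q\<bar> + 2"] by blast
  have far: "(\<bar>f q\<bar> + 2) * norm \<xi> \<le> L \<xi> - q \<bullet> \<xi>" if "norm \<xi> \<ge> max R 1" for \<xi>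
  proof -
    have "q \<bullet> \<xi> \<le> norm q * norm \<xi>" by (rule norm_cauchy_schwarz)
    then show ?thesis using R[of \<xi>] that by (simp add: algebra_simps)
  qed
  have bS: "norm \<xi> \<le> max R 1" if "\<xi> \<in> S" for \<xi>
  proof (rule ccontr)
    assume n: "\<not> norm \<xi> \<le> max R 1"
    then have "(\<bar>f q\<bar> + 2) * 1 \<le> (\<bar>f q\<bar> + 2) * norm \<xi>" by (intro mult_left_mono) auto
    also have "\<dots> \<le> L \<xi> - q \<bullet> \<xi>" using n by (intro far) linarith
    finally have "\<bar>f q\<bar> + 2 \<le> L \<xi> - q \<bullet> \<xi>" by simp
    then show False using that by (simp add: S_def)
  qed
  have "closed S" unfolding S_def by (intro closed_Collect_le continuous_intros L)
  moreover have "bounded S" using bS unfolding bounded_iff by blast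
  ultimately have "compact S" by (simp add: compact_eq_bounded_closed)
  have "0 \<in> convex hull S"
  proof (rule ccontr)
    assume "0 \<notin> convex hull S"
    moreover have "closed (convex hull S)"
      using \<open>compact S\<close> by (intro compact_imp_closed compact_convex_hull)
    ultimately obtain a b where ab: "a \<noteq> 0" "0 < b" "\<And>\<xi>. \<xi> \<in> convex hull S \<Longrightarrow> b < a \<bullet> \<xi>"
      using separating_hyperplane_closed_0[of "convex hull S"] convex_convex_hull by metis
    define R' where "R' = max R 1"
    \<comment> \<open>With this size the tilt changes values by at most 1/2 on the ball of radius
      \<open>R'\<close> and adds a slope of at most 1.\<close>
    define e where "e = 1 / (2 * norm a * R')"
    have R': "1 \<le> R'" by (simp add: R'_def)
    have e: "0 < e" "e * norm a \<le> 1" "e * norm a * R' = 1 / 2"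
      using ab(1) R' by (auto simp: e_def field_simps)
    \<comment> \<open>Tilting by \<open>e a\<close> gains at least \<open>e b\<close> on
      \<open>S\<close>. Off \<open>S\<close> but inside radius \<open>R'\<close> there was slack 1,
      of which at most 1/2 is lost; farther out the superlinear reserve wins. So \<open>f\<close>
      would exceed its maximum.\<close>
    have "f q + min (1 / 2) (e * b) \<le> f (q - e *\<^sub>R a)"
    proof (rule f_ge)
      fix \<xi>
      have eq: "L \<xi> - (q - e *\<^sub>R a) \<bullet> \<xi> = L \<xi> - q \<bullet> \<xi> + e * (a \<bullet> \<xi>)" by (simp add: inner_diff_left)
      have lower: "- (e * norm a * norm \<xi>) \<le> e * (a \<bullet> \<xi>)"
      proof -
        have "- (norm a * norm \<xi>) \<le> a \<bullet> \<xi>" using Cauchy_Schwarz_ineq2[of a \<xi>] by linarith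
        from mult_left_mono[OF this, of e] e(1) show ?thesis by (simp add: mult.assoc)
      qed
      consider "\<xi> \<in> S" | "\<xi> \<notin> S" "norm \<xi> \<le> R'" | "norm \<xi> > R'" by linarith
      then show "f q + min (1 / 2) (e * b) \<le> L \<xi> - (q - e *\<^sub>R a) \<bullet> \<xi>"
      proof cases
        case 1
        then have "e * b \<le> e * (a \<bullet> \<xi>)" using ab(3)[of \<xi>] e(1) hull_inc[of \<xi> S convex] by (intro mult_left_mono) auto
        then show ?thesis using f_le[of q \<xi>] unfolding eq by linarith
      next
        case 2
        have "e * norm a * norm \<xi> \<le> e * norm a * R'" using 2 e(1) by (intro mult_left_mono) auto
        then have "- (1 / 2) \<le> e * (a \<bullet> \<xi>)" using lower e(3) by linarith
        moreover have "f q + 1 < L \<xi> - q \<bullet> \<xi>" using 2(1) by (simp add: S_def)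
        ultimately show ?thesis unfolding eq by linarith
      next
        case 3
        have "e * norm a * norm \<xi> \<le> 1 * norm \<xi>" using e(2) by (intro mult_right_mono) auto
        then have *: "(\<bar>f q\<bar> + 1) * norm \<xi> \<le> L \<xi> - q \<bullet> \<xi> + e * (a \<bullet> \<xi>)"
          using lower far[of \<xi>] 3 by (simp add: R'_def algebra_simps)
        have "(\<bar>f q\<bar> + 1) * 1 \<le> (\<bar>f q\<bar> + 1) * norm \<xi>" using 3 R' by (intro mult_left_mono) auto
        from order_trans[OF this *] have "\<bar>f q\<bar> + 1 \<le> L \<xi> - q \<bullet> \<xi> + e * (a \<bullet> \<xi>)" by simp
        then show ?thesis unfolding eq by linarith
      qed
    qed
    moreover have "0 < e * b" using e ab by simp
    ultimately show False using qmax[of "q - e *\<^sub>R a"] by linarith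
  qed
  then obtain F where F: "finite F" "F \<subseteq> S" "0 \<in> convex hull F"
    unfolding caratheodory[of S] by blast
  show ?thesis
  proof (rule that[OF F(1,3)])
    show "f q + q \<bullet> \<xi> \<le> L \<xi>" for \<xi> using f_le[of q \<xi>] by linarith
    show "L \<xi> \<le> f q + q \<bullet> \<xi> + 1" if "\<xi> \<in> F" for \<xi> using F(2) that by (auto simp: S_def)
  qed
qed

text \<open>At each point the maximum inherits the slope of one competitor. That
  \<open>G x \<in> F\<close> holds everywhere lets the cost of the modified function be bounded
  point by point.\<close>

lemma wgrad_Max_inner:
  assumes "finite F" "F \<noteq> {}"
  shows "\<exists>G. wgrad (\<lambda>x. Max ((\<lambda>\<xi>. (x - z) \<bullet> \<xi>) ` F)) G \<and> (\<forall>x. G x \<in> F)"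
  using assms
proof (induction rule: finite_ne_induct)
  case (singleton \<xi>)
  have "wgrad (\<lambda>x. (x - z) \<bullet> \<xi>) (\<lambda>_. \<xi>)"
    using wgrad_affine[of \<xi> "- (z \<bullet> \<xi>)"] by (simp add: inner_diff_left)
  then show ?case by (intro exI[of _ "\<lambda>_. \<xi>"]) simp
next
  case (insert \<xi> F)
  then obtain G where G: "wgrad (\<lambda>x. Max ((\<lambda>\<xi>. (x - z) \<bullet> \<xi>) ` F)) G" "\<And>x. G x \<in> F" by blast
  have "wgrad (\<lambda>x. (x - z) \<bullet> \<xi>) (\<lambda>_. \<xi>)"
    using wgrad_affine[of \<xi> "- (z \<bullet> \<xi>)"] by (simp add: inner_diff_left)
  from wgrad_max[OF this G(1)]
  have W: "wgrad (\<lambda>x. max ((x - z) \<bullet> \<xi>) (Max ((\<lambda>\<xi>. (x - z) \<bullet> \<xi>) ` F)))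
    (\<lambda>x. if Max ((\<lambda>\<xi>. (x - z) \<bullet> \<xi>) ` F) > (x - z) \<bullet> \<xi> then G x else \<xi>)" .
  have "(\<lambda>x. max ((x - z) \<bullet> \<xi>) (Max ((\<lambda>\<xi>. (x - z) \<bullet> \<xi>) ` F))) = (\<lambda>x. Max ((\<lambda>\<xi>. (x - z) \<bullet> \<xi>) ` insert \<xi> F))"
    using insert.hyps by (auto simp: fun_eq_iff)
  with W G(2) show ?case by (intro exI[of _ "\<lambda>x. if Max ((\<lambda>\<xi>. (x - z) \<bullet> \<xi>) ` F) > (x - z) \<bullet> \<xi> then G x else \<xi>"]) auto
qed

lemma wgrad_Min:
  assumes "finite Z" "Z \<noteq> {}" "\<And>z. \<exists>G. wgrad (m z) G \<and> (\<forall>x. G x \<in> F)"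
  shows "\<exists>G. wgrad (\<lambda>x. Min ((\<lambda>z. m z x) ` Z)) G \<and> (\<forall>x. G x \<in> F)"
  using assms(1,2)
proof (induction rule: finite_ne_induct)
  case (singleton z)
  then show ?case using assms(3)[of z] by simp
next
  case (insert z Z)
  then obtain G where G: "wgrad (\<lambda>x. Min ((\<lambda>z. m z x) ` Z)) G" "\<And>x. G x \<in> F" by blast
  obtain G' where G': "wgrad (m z) G'" "\<And>x. G' x \<in> F" using assms(3) by blast
  from wgrad_min[OF G'(1) G(1)]
  have W: "wgrad (\<lambda>x. min (m z x) (Min ((\<lambda>z. m z x) ` Z)))
    (\<lambda>x. if Min ((\<lambda>z. m z x) ` Z) < m z x then G x else G' x)" .
  have "(\<lambda>x. min (m z x) (Min ((\<lambda>z. m z x) ` Z))) = (\<lambda>x. Min ((\<lambda>z. m z x) ` insert z Z))"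
    using insert.hyps by (auto simp: fun_eq_iff)
  with W G(2) G'(2) show ?case
    by (intro exI[of _ "\<lambda>x. if Min ((\<lambda>z. m z x) ` Z) < m z x then G x else G' x"]) auto
qed

text \<open>\<open>w\<close> is the minimum, over a fine net of centres \<open>z\<close>, of the cones \<open>Max {(x - z) \<bullet> \<xi> | \<xi>. \<xi> \<in> F}\<close>,
  which are nonnegative because \<open>0 \<in> convex hull F\<close>.\<close>
lemma small_function_with_gradient_in:
  fixes F :: "(real^'n) set"
  assumes F: "finite F" "0 \<in> convex hull F" and B: "bounded B" and e: "0 < e"
  obtains w G where "wgrad w G" "\<And>x. G x \<in> F" "\<And>x. 0 \<le> w x" "\<And>x. x \<in> B \<Longrightarrow> w x \<le> e"
proof -
  have F0: "F \<noteq> {}" using F(2) by auto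
  define m where "m z x = Max ((\<lambda>\<xi>. (x - z) \<bullet> \<xi>) ` F)" for z x :: "real^'n"
  obtain M where M: "0 < M" "\<And>\<xi>. \<xi> \<in> F \<Longrightarrow> norm \<xi> \<le> M"
    using finite_imp_bounded[OF F(1)] unfolding bounded_pos by blast
  have m0: "0 \<le> m z x" for z x
  proof -
    have "convex hull F \<subseteq> {\<xi>. (x - z) \<bullet> \<xi> \<le> m z x}"
      using F(1) by (intro hull_minimal convex_halfspace_le) (auto simp: m_def)
    then show ?thesis using F(2) by auto
  qed
  have mM: "m z x \<le> M * norm (x - z)" for z x
  proof -
    have "(x - z) \<bullet> \<xi> \<le> M * norm (x - z)" if "\<xi> \<in> F" for \<xi>
    proof -
      have "(x - z) \<bullet> \<xi> \<le> norm (x - z) * norm \<xi>" by (rule norm_cauchy_schwarz)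
      also have "\<dots> \<le> norm (x - z) * M" using M(2)[OF that] by (intro mult_left_mono) auto
      finally show ?thesis by (simp add: mult.commute)
    qed
    then show ?thesis unfolding m_def using F(1) F0 by (subst Max_le_iff) auto
  qed
  \<comment> \<open>Each cone grows at most at rate \<open>M\<close> from its centre, so a net of
    mesh e / M keeps the minimum below \<open>e\<close>.\<close>
  have d: "0 < e / M" using e M by simp
  have "compact (closure B)" using B by (rule compact_closure[THEN iffD2])
  then obtain Z0 where Z0: "finite Z0" "closure B \<subseteq> (\<Union>z\<in>Z0. ball z (e / M))"
    using compactE_image[of "closure B" "closure B" "\<lambda>z. ball z (e / M)"] d
    by (metis UN_I centre_in_ball open_ball subsetI)
  \<comment> \<open>The extra centre makes the minimum meaningful even if the net is empty; one more
    nonnegative cone can only lower it.\<close>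
  define Z where "Z = insert 0 Z0"
  have Z: "finite Z" "Z \<noteq> {}" using Z0 by (auto simp: Z_def)
  have "\<exists>G. wgrad (m z) G \<and> (\<forall>x. G x \<in> F)" for z
    unfolding m_def by (rule wgrad_Max_inner[OF F(1) F0])
  from wgrad_Min[where m = m, OF Z this] obtain G where
    G: "wgrad (\<lambda>x. Min ((\<lambda>z. m z x) ` Z)) G" "\<And>x. G x \<in> F" by blast
  show ?thesis
  proof (rule that[OF G])
    show "0 \<le> Min ((\<lambda>z. m z x) ` Z)" for x using Z m0 by (subst Min_ge_iff) auto
    fix x assume "x \<in> B"
    then obtain z where z: "z \<in> Z0" "x \<in> ball z (e / M)" using Z0(2) closure_subset by blast
    have "Min ((\<lambda>z. m z x) ` Z) \<le> m z x" using Z(1) z(1) by (intro Min_le) (auto simp: Z_def)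
    also have "\<dots> \<le> M * norm (x - z)" by (rule mM)
    also have "\<dots> \<le> M * (e / M)" using z(2) M(1) by (intro mult_left_mono) (auto simp: dist_norm norm_minus_commute)
    also have "\<dots> = e" using M by simp
    finally show "Min ((\<lambda>z. m z x) ` Z) \<le> e" .
  qed
qed

text \<open>Replace the indicator of \<open>E\<close> by a mollification \<open>k\<close>; since |G|
  <= M this costs little. Integration by parts then moves the derivative to \<open>k\<close>,
  leaving at most \<open>e\<close> times the integral of |grad k|. The bound \<open>e\<close>
  depends on \<open>E\<close>, \<open>M\<close> and \<open>d\<close> but not on
  \<open>w\<close>.\<close>

lemma integral_gradient_small:
  fixes E :: "(real^'n) set"
  assumes E: "E \<in> sets lebesgue" "E \<subseteq> cball 0 R" and d: "0 < d"
  obtains e where "0 < e" "\<And>w G. wgrad w G \<Longrightarrow> (\<And>x. norm (G x) \<le> M) \<Longrightarrow>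
    (\<And>x. x \<in> cball 0 (R + 1) \<Longrightarrow> \<bar>w x\<bar> \<le> e) \<Longrightarrow> norm (LINT x|lebesgue. indicator E x *\<^sub>R G x) \<le> d"
proof -
  let ?c = "indicator E :: real^'n \<Rightarrow> real"
  have ci: "integrable lebesgue ?c"
    using E by (intro integrable_of_bounded[where B = 1 and R = R]) (auto simp: indicator_def)
  define N where "N = \<bar>M\<bar> + 1"
  have N: "0 < N" by (simp add: N_def)
  have "0 < d / (2 * N)" using d N by simp
  from order_tendstoD(2)[OF convol_L1_tendsto[OF ci] this]
  obtain n where n: "(LINT x|lebesgue. norm (convol (mollifier (inverse (real (Suc n)))) ?c x - ?c x)) < d / (2 * N)"
    by (auto simp only: eventually_sequentially)
  define r where "r = inverse (real (Suc n))"
  have r: "0 < r" "r \<le> 1" by (auto simp: r_def field_simps)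
  define k where "k = convol (mollifier r) ?c"
  have ks: "smooth k"
    unfolding k_def by (rule convol_smooth(1)[OF smooth_mollifier mollifier_eq_0'[OF r(1)] integrable_locint[OF ci]])
  have k0: "\<forall>x. norm x > R + 1 \<longrightarrow> k x = 0"
  proof (intro allI impI)
    fix x :: "real^'n" assume x: "norm x > R + 1"
    have "mollifier r (x - y) *\<^sub>R ?c y = 0" for y
    proof (cases "y \<in> E")
      case True
      then have "norm y \<le> R" using E(2) by auto
      then have "norm (x - y) > 1" using x norm_triangle_ineq2[of x y] by linarith
      then show ?thesis using r mollifier_eq_0'[OF r(1), of "x - y"] by simp
    qed simp
    then show "k x = 0" unfolding k_def convol_def by (simp only: integral_zero)
  qed
  have kc: "continuous_on UNIV k" by (rule smooth_continuous[OF ks])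
  have ki: "integrable lebesgue k" using k0 by (intro integrable_compactly_supported[OF kc]) auto
  have g0: "\<And>x. norm x > R + 1 \<Longrightarrow> grad k x = 0" using grad_eq_0_outside[of "R + 1" k] k0 by blast
  have gi: "integrable lebesgue (\<lambda>x. norm (grad k x))"
    by (rule integrable_norm[OF integrable_compactly_supported[OF continuous_on_grad[OF ks] g0]])
  define A where "A = (LINT x|lebesgue. norm (grad k x))"
  have A: "0 \<le> A" unfolding A_def by (intro integral_nonneg_AE AE_I2) simp
  define e where "e = d / (2 * (A + 1))"
  have e: "0 < e" using d A by (simp add: e_def)
  show ?thesis
  proof (rule that[OF e])
    fix w :: "real^'n \<Rightarrow> real" and G assume W: "wgrad w G" and GM: "\<And>x. norm (G x) \<le> M" and we: "\<And>x. x \<in> cball 0 (R + 1) \<Longrightarrow> \<bar>w x\<bar> \<le> e"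
    have Gm: "G \<in> borel_measurable lebesgue" by (rule locint_measurable[OF wgrad_locint(2)[OF W]])
    have GN: "norm (G x) \<le> N" for x using GM[of x] by (simp add: N_def)
    have cG: "integrable lebesgue (\<lambda>x. ?c x *\<^sub>R G x)"
      using E by (intro locint_mult_integrable[OF wgrad_locint(2)[OF W], where B = 1 and R = R]) (auto simp: indicator_def)
    have kG: "integrable lebesgue (\<lambda>x. k x *\<^sub>R G x)" by (rule test_integrable(2)[OF ks k0 wgrad_locint(2)[OF W]])
    have 1: "norm (LINT x|lebesgue. (k x - ?c x) *\<^sub>R G x) \<le> d / 2"
    proof -
      have "norm (LINT x|lebesgue. (k x - ?c x) *\<^sub>R G x) \<le> (LINT x|lebesgue. N * norm (k x - ?c x))"
      proof (rule Bochner_Integration.integral_norm_bound_integral)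
        show "integrable lebesgue (\<lambda>x. (k x - ?c x) *\<^sub>R G x)"
          unfolding scaleR_diff_left by (rule Bochner_Integration.integrable_diff[OF kG cG])
        show "integrable lebesgue (\<lambda>x. N * norm (k x - ?c x))"
          by (intro integrable_mult_right integrable_norm Bochner_Integration.integrable_diff ki ci)
        show "norm ((k x - ?c x) *\<^sub>R G x) \<le> N * norm (k x - ?c x)" for x
          using mult_left_mono[OF GN[of x], of "\<bar>k x - ?c x\<bar>"] by (simp add: mult.commute)
      qed
      also have "\<dots> = N * (LINT x|lebesgue. norm (k x - ?c x))" by simp
      also have "\<dots> \<le> N * (d / (2 * N))"
        using n by (intro mult_left_mono) (auto simp: k_def r_def N_def)
      also have "\<dots> = d / 2" using N by simp
      finally show ?thesis .
    qed
    have 2: "norm (LINT x|lebesgue. k x *\<^sub>R G x) \<le> d / 2"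
    proof -
      have "(LINT x|lebesgue. k x *\<^sub>R G x) = - (LINT x|lebesgue. w x *\<^sub>R grad k x)"
        using wgradD[OF W ks k0] by simp
      also have "norm \<dots> \<le> (LINT x|lebesgue. e * norm (grad k x))"
        unfolding norm_minus_cancel
      proof (rule Bochner_Integration.integral_norm_bound_integral)
        show "integrable lebesgue (\<lambda>x. w x *\<^sub>R grad k x)" by (rule test_integrable(1)[OF ks k0 wgrad_locint(1)[OF W]])
        show "integrable lebesgue (\<lambda>x. e * norm (grad k x))" by (rule integrable_mult_right[OF gi])
        show "norm (w x *\<^sub>R grad k x) \<le> e * norm (grad k x)" for x
        proof (cases "norm x \<le> R + 1")
          case True
          then show ?thesis using we[of x] by (simp add: mult_right_mono)
        qed (use g0[of x] in simp)
      qed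
      also have "\<dots> = e * A" by (simp add: A_def)
      also have "\<dots> \<le> d / 2" using d A by (simp add: e_def field_simps)
      finally show ?thesis .
    qed
    have "(LINT x|lebesgue. ?c x *\<^sub>R G x) = (LINT x|lebesgue. k x *\<^sub>R G x) - (LINT x|lebesgue. (k x - ?c x) *\<^sub>R G x)"
      unfolding scaleR_diff_left Bochner_Integration.integral_diff[OF kG cG] by simp
    then show "norm (LINT x|lebesgue. ?c x *\<^sub>R G x) \<le> d"
      using 1 2 norm_triangle_ineq4[of "LINT x|lebesgue. k x *\<^sub>R G x" "LINT x|lebesgue. (k x - ?c x) *\<^sub>R G x"] by simp
  qed
qed

text \<open>\<open>\<Psi>\<close> is a sum of hinges max (r - a_n) 0. Taking a_n so large that the
  integral of max (f - a_n) 0 is at most 2^-n makes \<Psi>(f) integrable; a_n >= n makes the sum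
  finite on bounded intervals, hence continuous; and the first k hinges already give asymptotic
  slope k.\<close>

lemma de_la_Vallee_Poussin:
  fixes f :: "'a \<Rightarrow> real"
  assumes f: "integrable M f" "\<And>x. 0 \<le> f x"
  obtains \<Psi> :: "real \<Rightarrow> real" where "continuous_on UNIV \<Psi>" "\<And>r. 0 \<le> \<Psi> r"
    "\<And>K. \<exists>R. \<forall>r. R \<le> r \<longrightarrow> K * r \<le> \<Psi> r" "integrable M (\<lambda>x. \<Psi> (f x))"
proof -
  have "\<exists>a. real n \<le> a \<and> (LINT x|M. max (f x - a) 0) \<le> (1/2) ^ n" for n
  proof -
    have fm: "f \<in> borel_measurable M" using f(1) by auto
    have "(\<lambda>k. LINT x|M. max (f x - real k) 0) \<longlonglongrightarrow> (LINT x|M. 0)"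
    proof (rule integral_dominated_convergence[OF _ _ f(1)])
      show "(\<lambda>x. max (f x - real k) 0) \<in> borel_measurable M" for k using fm by measurable
      show "AE x in M. (\<lambda>k. max (f x - real k) 0) \<longlonglongrightarrow> 0"
      proof (intro AE_I2 tendsto_eventually)
        fix x
        show "\<forall>\<^sub>F k in sequentially. max (f x - real k) 0 = 0"
          using eventually_ge_at_top[of "nat \<lceil>f x\<rceil>"]
        proof eventually_elim
          case (elim k)
          then have "f x \<le> real k" by linarith
          then show ?case by simp
        qed
      qed
      show "AE x in M. norm (max (f x - real k) 0) \<le> f x" for k
        using f(2) by (intro AE_I2) (simp add: max_def)
    qed simp
    then have "\<forall>\<^sub>F k in sequentially. (LINT x|M. max (f x - real k) 0) < (1/2) ^ n"
      by (intro order_tendstoD(2)) auto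
    then have "\<forall>\<^sub>F k in sequentially. (LINT x|M. max (f x - real k) 0) < (1/2) ^ n \<and> n \<le> k"
      using eventually_ge_at_top[of n] by (rule eventually_conj)
    then obtain k where "(LINT x|M. max (f x - real k) 0) < (1/2) ^ n" "n \<le> k"
      by (auto simp: eventually_sequentially)
    then show ?thesis by (intro exI[of _ "real k"]) auto
  qed
  then obtain a where a: "\<And>n. real n \<le> a n" "\<And>n. (LINT x|M. max (f x - a n) 0) \<le> (1/2) ^ n" by metis
  define \<Psi> where "\<Psi> r = (\<Sum>n. max (r - a n) 0)" for r
  have fin: "\<Psi> r = (\<Sum>n<N. max (r - a n) 0)" if "r \<le> real N" for r N
    unfolding \<Psi>_def
  proof (rule suminf_finite)
    fix n assume "n \<notin> {..<N}"
    then have "r \<le> a n" using a(1)[of n] that by simp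
    then show "max (r - a n) 0 = 0" by simp
  qed simp
  have summ: "summable (\<lambda>n. max (r - a n) 0)" for r
  proof (rule summable_finite[of "{..<nat \<lceil>r\<rceil>}"])
    fix n assume "n \<notin> {..<nat \<lceil>r\<rceil>}"
    then have "r \<le> a n" using a(1)[of n] by simp linarith
    then show "max (r - a n) 0 = 0" by simp
  qed simp
  show ?thesis
  proof (rule that[of \<Psi>])
    show "continuous_on UNIV \<Psi>"
    proof (rule continuous_at_imp_continuous_on, intro ballI)
      fix r :: real
      obtain N where N: "r < real N" using reals_Archimedean2 by blast
      have "continuous_on {..<real N} \<Psi>"
      proof (rule continuous_on_eq[where f = "\<lambda>r. \<Sum>n<N. max (r - a n) 0"])
        show "continuous_on {..<real N} (\<lambda>r. \<Sum>n<N. max (r - a n) 0)" by (intro continuous_intros)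
      qed (metis fin less_imp_le lessThan_iff)
      then show "isCont \<Psi> r" using N by (simp add: continuous_on_eq_continuous_at)
    qed
    show "0 \<le> \<Psi> r" for r unfolding \<Psi>_def by (intro suminf_nonneg summ) simp
    show "\<exists>R. \<forall>r. R \<le> r \<longrightarrow> K * r \<le> \<Psi> r" for K
    proof -
      obtain k where k: "K + 1 < real k" using reals_Archimedean2 by blast
      \<comment> \<open>The first \<open>k\<close> hinges sum to at least k r - R. With k > K + 1
        and r >= R this is at least K r.\<close>
      define R where "R = (\<Sum>n<k. a n)"
      have R: "0 \<le> R" unfolding R_def using a(1) by (intro sum_nonneg) (meson of_nat_0_le_iff order_trans)
      have "K * r \<le> \<Psi> r" if r: "R \<le> r" for r
      proof -
        have "(K + 1) * r \<le> real k * r" using k r R by (intro mult_right_mono) auto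
        then have "K * r \<le> real k * r - R" using r by (simp add: algebra_simps)
        also have "\<dots> = (\<Sum>n<k. r - a n)" by (simp add: R_def sum_subtractf)
        also have "\<dots> \<le> (\<Sum>n<k. max (r - a n) 0)" by (intro sum_mono) simp
        also have "\<dots> \<le> \<Psi> r" unfolding \<Psi>_def by (intro sum_le_suminf summ) auto
        finally show ?thesis .
      qed
      then show ?thesis by blast
    qed
    have mm: "(\<lambda>x. max (f x - a n) 0) \<in> borel_measurable M" for n using f(1) by measurable
    have mi: "integrable M (\<lambda>x. max (f x - a n) 0)" for n
    proof (rule Bochner_Integration.integrable_bound[OF f(1) mm])
      have "0 \<le> a n" using a(1)[of n] by (meson of_nat_0_le_iff order_trans)
      then show "AE x in M. norm (max (f x - a n) 0) \<le> norm (f x)"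
        using f(2) by (intro AE_I2) (simp add: max_def)
    qed
    have "(\<integral>\<^sup>+x. ennreal (\<Psi> (f x)) \<partial>M) = (\<integral>\<^sup>+x. (\<Sum>n. ennreal (max (f x - a n) 0)) \<partial>M)"
      unfolding \<Psi>_def by (intro nn_integral_cong suminf_ennreal2[symmetric] summ) simp
    also have "\<dots> = (\<Sum>n. \<integral>\<^sup>+x. ennreal (max (f x - a n) 0) \<partial>M)"
      using mm by (intro nn_integral_suminf) simp
    also have "\<dots> = (\<Sum>n. ennreal (LINT x|M. max (f x - a n) 0))"
      by (intro suminf_cong nn_integral_eq_integral mi) simp
    also have "\<dots> \<le> (\<Sum>n. ennreal ((1/2) ^ n))"
      using a(2) by (intro suminf_le ennreal_leI) auto
    also have "\<dots> = ennreal (\<Sum>n. (1/2) ^ n)" by (intro suminf_ennreal2) (auto intro: summable_geometric)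
    finally have "(\<integral>\<^sup>+x. ennreal (\<Psi> (f x)) \<partial>M) \<le> ennreal (\<Sum>n. (1/2) ^ n)" .
    then have lt: "(\<integral>\<^sup>+x. ennreal (\<Psi> (f x)) \<partial>M) < \<infinity>" using le_less_trans by fastforce
    show "integrable M (\<lambda>x. \<Psi> (f x))"
    proof (rule integrableI_nonneg[OF _ _ lt])
      show "(\<lambda>x. \<Psi> (f x)) \<in> borel_measurable M" unfolding \<Psi>_def using mm by measurable
      show "AE x in M. 0 \<le> \<Psi> (f x)" unfolding \<Psi>_def by (intro AE_I2 suminf_nonneg summ) simp
    qed
  qed
qed

text \<open>For large |\<xi>| the affine function lies below \<open>\<Psi>\<close>, which does not
  depend on the height. Only a compact set of gradients remains, and there \<open>L\<close> is
  uniformly continuous. Radius at least 1 allows |g| to be absorbed into the slope.\<close>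

lemma affine_minorant_stable:
  fixes L :: "real \<times> (real^'n) \<Rightarrow> real"
  assumes L: "continuous_on UNIV L" and \<Psi>: "\<And>K. \<exists>R. \<forall>r. R \<le> r \<longrightarrow> K * r \<le> \<Psi> r"
    "\<And>s \<xi>. \<Psi> (norm \<xi>) \<le> L (s, \<xi>)" and le: "\<And>\<xi>. g + q \<bullet> \<xi> \<le> L (t, \<xi>)"
  obtains d where "0 < d" "\<And>s \<xi>. \<bar>s - t\<bar> < d \<Longrightarrow> g + q \<bullet> \<xi> \<le> L (s, \<xi>) + 1"
proof -
  obtain R0 where R0: "\<And>r. R0 \<le> r \<Longrightarrow> (norm q + \<bar>g\<bar>) * r \<le> \<Psi> r" using \<Psi>(1) by blast
  define R where "R = max R0 1"
  have "uniformly_continuous_on (cball t 1 \<times> cball 0 R) L"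
    by (intro compact_uniformly_continuous compact_Times continuous_on_subset[OF L]) auto
  then obtain d where d: "0 < d" "\<And>x y. x \<in> cball t 1 \<times> cball 0 R \<Longrightarrow> y \<in> cball t 1 \<times> cball 0 R \<Longrightarrow>
      dist y x < d \<Longrightarrow> dist (L y) (L x) < 1"
    unfolding uniformly_continuous_on_def by (metis zero_less_one)
  show ?thesis
  proof (rule that[of "min d 1"])
    show "0 < min d 1" using d by simp
    fix s :: real and \<xi> :: "real^'n" assume s: "\<bar>s - t\<bar> < min d 1"
    show "g + q \<bullet> \<xi> \<le> L (s, \<xi>) + 1"
    proof (cases "norm \<xi> \<le> R")
      case True
      have "dist (L (s, \<xi>)) (L (t, \<xi>)) < 1"
        using s True by (intro d(2)) (auto simp: dist_Pair_Pair dist_real_def abs_minus_commute)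
      then show ?thesis using le[of \<xi>] by (simp add: dist_real_def)
    next
      case False
      then have n: "R0 \<le> norm \<xi>" "1 \<le> norm \<xi>" by (auto simp: R_def)
      have "q \<bullet> \<xi> \<le> norm q * norm \<xi>" by (rule norm_cauchy_schwarz)
      moreover have "\<bar>g\<bar> * 1 \<le> \<bar>g\<bar> * norm \<xi>" using n(2) by (intro mult_left_mono) auto
      ultimately have "g + q \<bullet> \<xi> \<le> (norm q + \<bar>g\<bar>) * norm \<xi>" by (simp add: algebra_simps)
      also have "\<dots> \<le> L (s, \<xi>)" using R0[OF n(1)] \<Psi>(2) order_trans by blast
      finally show ?thesis by simp
    qed
  qed
qed

lemma superlevel_integral_small:
  fixes f u :: "'a \<Rightarrow> real"
  assumes f: "integrable M (\<lambda>x. indicator \<Omega> x * f x)" and u: "u \<in> borel_measurable M"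
    and \<Omega>: "\<Omega> \<in> sets M" and e: "0 < e"
  obtains T where "\<And>t. T \<le> t \<Longrightarrow> (LINT x|M. indicator {x \<in> \<Omega>. t < u x} x * f x) < e"
proof -
  have eq: "indicator {x \<in> \<Omega>. t < u x} x * f x = (if t < u x then 1 else 0) * (indicator \<Omega> x * f x)" for t x
    by (auto simp: indicator_def)
  have "((\<lambda>t. LINT x|M. indicator {x \<in> \<Omega>. t < u x} x * f x) \<longlongrightarrow> (LINT x|M. 0)) at_top"
    unfolding eq
  proof (rule integral_dominated_convergence_at_top)
    show "integrable M (\<lambda>x. norm (indicator \<Omega> x * f x))" by (rule integrable_norm[OF f])
    show "(\<lambda>x. (if t < u x then 1 else 0) * (indicator \<Omega> x * f x)) \<in> borel_measurable M" for t
      using u borel_measurable_integrable[OF f] by measurable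
    show "AE x in M. ((\<lambda>t. (if t < u x then 1 else 0) * (indicator \<Omega> x * f x)) \<longlongrightarrow> 0) at_top"
    proof (intro AE_I2 tendsto_eventually)
      fix x
      show "\<forall>\<^sub>F t in at_top. (if t < u x then 1 else 0) * (indicator \<Omega> x * f x) = 0"
        using eventually_ge_at_top[of "u x"] by eventually_elim auto
    qed
  qed auto
  then have "\<forall>\<^sub>F t in at_top. (LINT x|M. indicator {x \<in> \<Omega>. t < u x} x * f x) < e"
    using e by (intro order_tendstoD(2)) auto
  then show ?thesis using that unfolding eventually_at_top_linorder by blast
qed

text \<open>On a short range of heights around \<open>t\<close> the integrand dominates an affine function of the
  gradient, whose linear part integrates to zero. Here \<open>\<gamma> t\<close> is the constant term. If \<open>\<gamma> t * m t \<ge> c\<close> for all large \<open>t\<close>, where \<open>m\<close> is the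
  distribution function of \<open>u\<close>, then adding up these contributions would give every tail of the
  integral at least \<open>c / 2\<close>.\<close>
lemma good_truncation_height:
  fixes L :: "real \<times> (real^'n) \<Rightarrow> real" and u :: "real^'n \<Rightarrow> real"
  assumes \<Omega>: "open \<Omega>" "bounded \<Omega>"
    and u: "u \<in> borel_measurable lebesgue" and g: "integrable lebesgue (\<lambda>x. indicator \<Omega> x *\<^sub>R g x)"
    and L: "continuous_on UNIV L" and \<Psi>: "\<And>r. 0 \<le> \<Psi> r" "\<And>K. \<exists>R. \<forall>r. R \<le> r \<longrightarrow> K * r \<le> \<Psi> r"
      "\<And>s \<xi>. \<Psi> (norm \<xi>) \<le> L (s, \<xi>)"
    and LI: "integrable lebesgue (\<lambda>x. indicator \<Omega> x * L (u x, g x))"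
    and zero: "\<forall>a\<ge>C. (LINT x|lebesgue. indicator {x \<in> \<Omega>. a < u x} x *\<^sub>R g x) = 0"
    and c: "0 < c"
  shows "\<exists>t q \<gamma> F. t0 \<le> t \<and> finite F \<and> 0 \<in> convex hull F \<and> (\<forall>\<xi>. \<gamma> + q \<bullet> \<xi> \<le> L (t, \<xi>)) \<and>
    (\<forall>\<xi>\<in>F. L (t, \<xi>) \<le> \<gamma> + q \<bullet> \<xi> + 1) \<and> \<gamma> * measure lebesgue {x \<in> \<Omega>. t < u x} < c"
proof (rule ccontr)
  assume contra: "\<not> ?thesis"
  have "\<exists>q \<gamma> F. finite F \<and> 0 \<in> convex hull F \<and> (\<forall>\<xi>. \<gamma> + q \<bullet> \<xi> \<le> L (t, \<xi>)) \<and>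
      (\<forall>\<xi>\<in>F. L (t, \<xi>) \<le> \<gamma> + q \<bullet> \<xi> + 1)" for t
  proof -
    have "continuous_on UNIV (\<lambda>\<xi>. L (t, \<xi>))"
      by (rule continuous_on_compose2[OF L]) (auto intro!: continuous_intros)
    moreover have "\<exists>R. \<forall>\<xi>. norm \<xi> \<ge> R \<longrightarrow> K * norm \<xi> \<le> L (t, \<xi>)" for K
      using \<Psi>(2)[of K] \<Psi>(3) by (meson order_trans)
    ultimately show ?thesis using affine_minorant_almost_contact[of "\<lambda>\<xi>. L (t, \<xi>)"] by metis
  qed
  then obtain q \<gamma> F where qgF: "\<And>t. finite (F t)" "\<And>t. 0 \<in> convex hull (F t)" "\<And>t \<xi>. \<gamma> t + q t \<bullet> \<xi> \<le> L (t, \<xi>)"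
    "\<And>t \<xi>. \<xi> \<in> F t \<Longrightarrow> L (t, \<xi>) \<le> \<gamma> t + q t \<bullet> \<xi> + 1" by metis
  define E where "E a = {x \<in> \<Omega>. a < u x}" for a
  define m where "m a = measure lebesgue (E a)" for a
  have large: "c \<le> \<gamma> t * m t" if "t0 \<le> t" for t
  proof (rule ccontr)
    assume "\<not> c \<le> \<gamma> t * m t"
    then have n: "\<gamma> t * measure lebesgue {x \<in> \<Omega>. t < u x} < c" by (simp add: m_def E_def)
    show False
      by (rule notE[OF contra], intro exI[of _ t] exI[of _ "q t"] exI[of _ "\<gamma> t"] exI[of _ "F t"]
          conjI allI ballI qgF that) (use n in auto)
  qed
  have \<Omega>s: "\<Omega> \<in> sets lebesgue" using \<Omega>(1) by simp
  have \<Omega>f: "emeasure lebesgue \<Omega> < \<infinity>" using emeasure_bounded_finite[OF \<Omega>(2)] \<Omega>(1) by simp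
  have "E a = \<Omega> \<inter> {x \<in> space lebesgue. a < u x}" for a by (auto simp: E_def)
  then have Es[measurable]: "E a \<in> sets lebesgue" for a using u \<Omega>s by simp
  have E\<Omega>: "E a \<subseteq> \<Omega>" for a by (auto simp: E_def)
  have Emono: "a \<le> b \<Longrightarrow> E b \<subseteq> E a" for a b by (auto simp: E_def)
  have Ef: "emeasure lebesgue (E a) < \<infinity>" for a
    using emeasure_mono[OF E\<Omega> \<Omega>s] \<Omega>f by (rule le_less_trans)
  have EI: "integrable lebesgue (indicator (E a) :: _ \<Rightarrow> real)" for a
    by (rule integrable_real_indicator[OF Es Ef])
  have Em: "(LINT x|lebesgue. indicator (E a) x) = m a" for a by (simp add: m_def)
  have mmono: "a \<le> b \<Longrightarrow> m b \<le> m a" for a b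
    unfolding Em[symmetric] using Emono by (intro integral_mono EI) (auto simp: indicator_def)
  have sub: "integrable lebesgue (\<lambda>x. indicator (E a) x *\<^sub>R f x)"
    if "integrable lebesgue (\<lambda>x. indicator \<Omega> x *\<^sub>R f x)" for a and f :: "real^'n \<Rightarrow> 'b::euclidean_space"
  proof -
    have "integrable lebesgue (\<lambda>x. indicator (E a) x *\<^sub>R (indicator \<Omega> x *\<^sub>R f x))"
      by (rule integrable_mult_indicator[OF Es that])
    moreover have "(\<lambda>x. indicat_real (E a) x *\<^sub>R (indicat_real \<Omega> x *\<^sub>R f x)) = (\<lambda>x. indicat_real (E a) x *\<^sub>R f x)"
      using E\<Omega> by (auto simp: fun_eq_iff indicator_def)
    ultimately show ?thesis by simp
  qed
  let ?L = "\<lambda>x. L (u x, g x)"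
  have L1I: "integrable lebesgue (\<lambda>x. indicator \<Omega> x * (?L x + 1))"
    unfolding distrib_left using LI \<Omega>s \<Omega>f by (intro Bochner_Integration.integrable_add) auto
  have EL: "integrable lebesgue (\<lambda>x. indicator (E a) x * (?L x + 1))" for a
    using sub[of "\<lambda>x. ?L x + 1" a] L1I by simp
  have Eg: "integrable lebesgue (\<lambda>x. indicator (E a) x *\<^sub>R g x)" for a by (rule sub[OF g])
  \<comment> \<open>The tail of the total cost. The added 1 pays for the loss when a minorant at
    height \<open>t\<close> is used at nearby heights.\<close>
  define \<Phi> where "\<Phi> a = (LINT x|lebesgue. indicator (E a) x * (?L x + 1))" for a
  have L0: "0 \<le> ?L x" for x using \<Psi>(1)[of "norm (g x)"] \<Psi>(3)[of "g x" "u x"] by linarith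
  obtain T1 where T1: "\<And>t. T1 \<le> t \<Longrightarrow> \<Phi> t < c / 2"
    using superlevel_integral_small[OF L1I u \<Omega>s, of "c / 2"] c unfolding \<Phi>_def E_def by auto
  \<comment> \<open>Above \<open>T1\<close> the tail is below c / 2 and above \<open>t0\<close> the
    negated claim is available. The margin of 1 above \<open>C\<close> is needed because the
    intervals around a height \<open>t\<close> may reach down by up to 1 and must stay where
    gradients have mean zero.\<close>
  define t1 where "t1 = max T1 (max t0 (C + 1))"
  have t1: "T1 \<le> t1" "t0 \<le> t1" "C + 1 \<le> t1" by (auto simp: t1_def)
  have pos: "0 < m t \<and> 0 < \<gamma> t" if "t0 \<le> t" for t
  proof -
    have "0 < \<gamma> t * m t" using large[OF that] c by linarith
    moreover have "0 \<le> m t" by (simp add: m_def)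
    ultimately show ?thesis by (auto simp: zero_less_mult_iff)
  qed
  \<comment> \<open>The linear term integrates to zero over both superlevel sets, so only the
    constant \<open>\<gamma> t\<close> remains, times the measure of {a < u <= b}. On that set the
    affine function is dominated pointwise; elsewhere the two indicator terms cancel.\<close>
  have increment: "\<gamma> t * (m a - m b) \<le> \<Phi> a - \<Phi> b"
    if ab: "C \<le> a" "a \<le> b" and close: "\<And>s \<xi>. a < s \<Longrightarrow> s \<le> b \<Longrightarrow> \<gamma> t + q t \<bullet> \<xi> \<le> L (s, \<xi>) + 1" for a b t
  proof -
    have "\<gamma> t * (m a - m b) = (LINT x|lebesgue. \<gamma> t * indicator (E a) x + q t \<bullet> (indicator (E a) x *\<^sub>R g x))
        - (LINT x|lebesgue. \<gamma> t * indicator (E b) x + q t \<bullet> (indicator (E b) x *\<^sub>R g x))"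
    proof -
      have "(LINT x|lebesgue. \<gamma> t * indicator (E a) x + q t \<bullet> (indicator (E a) x *\<^sub>R g x)) = \<gamma> t * m a" if "C \<le> a" for a
      proof -
        have "(LINT x|lebesgue. q t \<bullet> (indicator (E a) x *\<^sub>R g x)) = 0"
          using zero that Eg[of a] by (subst integral_inner_right) (auto simp: E_def)
        then show ?thesis
          using Bochner_Integration.integral_add[OF integrable_mult_right[OF EI, of "\<gamma> t" a] integrable_inner_right[OF Eg, of "q t" a]]
          by (simp add: m_def)
      qed
      then show ?thesis using ab by (simp add: right_diff_distrib)
    qed
    also have "\<dots> = (LINT x|lebesgue. (\<gamma> t * indicator (E a) x + q t \<bullet> (indicator (E a) x *\<^sub>R g x))
        - (\<gamma> t * indicator (E b) x + q t \<bullet> (indicator (E b) x *\<^sub>R g x)))"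
      by (intro Bochner_Integration.integral_diff[symmetric] Bochner_Integration.integrable_add
          integrable_mult_right EI integrable_inner_right Eg)
    also have "\<dots> \<le> (LINT x|lebesgue. indicator (E a) x * (?L x + 1) - indicator (E b) x * (?L x + 1))"
    proof (rule integral_mono)
      show "integrable lebesgue (\<lambda>x. (\<gamma> t * indicator (E a) x + q t \<bullet> (indicator (E a) x *\<^sub>R g x))
        - (\<gamma> t * indicator (E b) x + q t \<bullet> (indicator (E b) x *\<^sub>R g x)))"
        by (intro Bochner_Integration.integrable_diff Bochner_Integration.integrable_add
          integrable_mult_right EI integrable_inner_right Eg)
      show "integrable lebesgue (\<lambda>x. indicator (E a) x * (?L x + 1) - indicator (E b) x * (?L x + 1))"
        by (intro Bochner_Integration.integrable_diff EL)
      fix x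
      show "(\<gamma> t * indicator (E a) x + q t \<bullet> (indicator (E a) x *\<^sub>R g x))
        - (\<gamma> t * indicator (E b) x + q t \<bullet> (indicator (E b) x *\<^sub>R g x))
        \<le> indicator (E a) x * (?L x + 1) - indicator (E b) x * (?L x + 1)"
      proof (cases "x \<in> E a")
        case False
        then have "x \<notin> E b" using Emono[OF ab(2)] by blast
        then show ?thesis using False by simp
      next
        case True
        show ?thesis
        proof (cases "x \<in> E b")
          case False
          then have "a < u x" "u x \<le> b" using True by (auto simp: E_def)
          from close[OF this, of "g x"] show ?thesis using True False by simp
        qed (use True in simp)
      qed
    qed
    also have "\<dots> = \<Phi> a - \<Phi> b" unfolding \<Phi>_def by (rule Bochner_Integration.integral_diff[OF EL EL])
    finally show ?thesis .
  qed
  have mt1: "0 < m t1" using pos t1(2) by blast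
  \<comment> \<open>A lower bound for \<open>\<gamma>\<close> on all heights above
    \<open>t1\<close>: \<gamma>(t) >= c / m(t), and \<open>m\<close> is decreasing.\<close>
  define \<kappa> where "\<kappa> = c / m t1"
  \<comment> \<open>The estimate is additive over adjacent intervals and true on short intervals
    around each height, so bisection extends it to the whole interval. Each height uses its own
    \<open>q\<close> and \<open>\<gamma>\<close>, with no regularity in \<open>t\<close>.\<close>
  have chain: "\<kappa> * (m t1 - m T) \<le> \<Phi> t1 - \<Phi> T" if T: "t1 \<le> T" for T
  proof (rule Bolzano[where P = "\<lambda>a b. \<kappa> * (m a - m b) \<le> \<Phi> a - \<Phi> b", OF T])
    show "\<kappa> * (m a - m d) \<le> \<Phi> a - \<Phi> d"
      if "\<kappa> * (m a - m b) \<le> \<Phi> a - \<Phi> b" "\<kappa> * (m b - m d) \<le> \<Phi> b - \<Phi> d" for a b d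
      using that by (simp add: algebra_simps)
  next
    fix t assume local: "t1 \<le> t" "t \<le> T"
    obtain d where d: "0 < d" "\<And>s \<xi>. \<bar>s - t\<bar> < d \<Longrightarrow> \<gamma> t + q t \<bullet> \<xi> \<le> L (s, \<xi>) + 1"
      using affine_minorant_stable[OF L \<Psi>(2,3) qgF(3)] by metis
    show "\<exists>d>0. \<forall>a b. a \<le> t \<and> t \<le> b \<and> b - a < d \<longrightarrow> \<kappa> * (m a - m b) \<le> \<Phi> a - \<Phi> b"
    proof (intro exI[of _ "min d 1"] conjI allI impI)
      show "0 < min d 1" using d by simp
      fix a b assume ab: "a \<le> t \<and> t \<le> b \<and> b - a < min d 1"
      have "\<gamma> t * (m a - m b) \<le> \<Phi> a - \<Phi> b"
      proof (rule increment)
        show "C \<le> a" "a \<le> b" using ab local t1 by auto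
        fix s \<xi> assume "a < s" "s \<le> b"
        then show "\<gamma> t + q t \<bullet> \<xi> \<le> L (s, \<xi>) + 1" using ab by (intro d(2)) linarith
      qed
      moreover have "\<kappa> * (m a - m b) \<le> \<gamma> t * (m a - m b)"
      proof (rule mult_right_mono)
        have t0: "t0 \<le> t" using local t1 by simp
        have "c \<le> \<gamma> t * m t" by (rule large[OF t0])
        also have "\<dots> \<le> \<gamma> t * m t1"
          using pos[OF t0] local by (intro mult_left_mono mmono) auto
        finally show "\<kappa> \<le> \<gamma> t" using mt1 by (simp add: \<kappa>_def divide_le_eq)
        show "0 \<le> m a - m b" using mmono[of a b] ab by simp
      qed
      ultimately show "\<kappa> * (m a - m b) \<le> \<Phi> a - \<Phi> b" by linarith
    qed
  qed
  have one: "integrable lebesgue (\<lambda>x. indicator \<Omega> x * (1::real))" using \<Omega>s \<Omega>f by simp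
  \<comment> \<open>Beyond this height more than half of the measure at \<open>t1\<close> is gone,
    so the increments sum to at least \<kappa> m(t1) / 2 = c / 2, which contradicts the choice of
    \<open>T1\<close>.\<close>
  obtain T2 where T2: "\<And>t. T2 \<le> t \<Longrightarrow> m t < m t1 / 2"
    using superlevel_integral_small[OF one u \<Omega>s, of "m t1 / 2"] mt1 Em unfolding E_def by auto
  define T where "T = max T2 t1"
  have "m T < m t1 / 2" "t1 \<le> T" using T2[of T] by (auto simp: T_def)
  then have "\<kappa> * (m t1 / 2) \<le> \<kappa> * (m t1 - m T)"
    using c mt1 by (intro mult_left_mono) (auto simp: \<kappa>_def)
  also have "\<dots> \<le> \<Phi> t1 - \<Phi> T" by (rule chain[OF \<open>t1 \<le> T\<close>])
  also have "\<dots> \<le> \<Phi> t1"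
    unfolding \<Phi>_def using L0 by (simp add: integral_nonneg_AE)
  also have "\<dots> < c / 2" by (rule T1[OF t1(1)])
  finally show False using mt1 by (simp add: \<kappa>_def)
qed

section \<open>Truncation from above, then from both sides\<close>

lemma in_Lp_indicator:
  assumes "in_Lp p f" "0 \<le> p" "A \<in> sets lebesgue"
  shows "in_Lp p (\<lambda>x. indicator A x *\<^sub>R f x)"
proof (rule in_Lp_bound(1)[OF assms(1,2)])
  show "(\<lambda>x. indicator A x *\<^sub>R f x) \<in> borel_measurable lebesgue"
    using in_LpD(1)[OF assms(1)] assms(3) by measurable
qed (simp add: indicator_def)

lemma wgrad_const_diff: "wgrad \<phi> g \<Longrightarrow> wgrad (\<lambda>x. a - \<phi> x) (\<lambda>x. - g x)"
  using wgrad_diff[OF wgrad_affine[of 0 a]] by simp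

lemma wgrad_const_add: "wgrad w g \<Longrightarrow> wgrad (\<lambda>x. a + w x) g"
  using wgrad_add[OF wgrad_affine[of 0 a]] by simp

text \<open>The change happens only where u exceeds \<open>\<zeta> = t + w\<close>, a subset of {u >
  t}. There the old cost is a tail of an integrable function, and the new cost is bounded by the
  affine expression \<open>k\<close>, whose integral is small by the choice of the height and of
  \<open>w\<close>.\<close>

lemma truncation_from_above:
  fixes H :: "real \<times> (real^'n) \<Rightarrow> real"
  assumes \<Omega>: "open \<Omega>" "bounded \<Omega>" and p: "1 \<le> p"
    and w\<phi>: "wgrad \<phi> g\<phi>" and L\<phi>: "in_Lp p \<phi>" "in_Lp p g\<phi>" and \<phi>C: "\<And>x. \<phi> x \<le> C"
    and W: "W0 p \<Omega> v gv" and H: "continuous_on UNIV H"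
    and HI: "integrable lebesgue (\<lambda>x. indicator \<Omega> x * H (\<phi> x + v x, g\<phi> x + gv x))" and e: "0 < e"
  obtains \<zeta> T v' gv' where "W0 p \<Omega> v' gv'" "\<forall>x. 0 \<le> \<zeta> x" "\<forall>x\<in>\<Omega>. \<zeta> x \<le> T"
    "\<forall>x. \<phi> x + v' x = min (\<phi> x + v x) (\<zeta> x)"
    "Lp_int p (\<lambda>x. v' x - v x) < e" "Lp_int p (\<lambda>x. gv' x - gv x) < e"
    "integrable lebesgue (\<lambda>x. indicator \<Omega> x * H (\<phi> x + v' x, g\<phi> x + gv' x))"
    "(LINT x|lebesgue. indicator \<Omega> x * \<bar>H (\<phi> x + v' x, g\<phi> x + gv' x) - H (\<phi> x + v x, g\<phi> x + gv x)\<bar>) < e"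
proof -
  have p0: "0 < p" "0 \<le> p" using p by auto
  define u where "u x = \<phi> x + v x" for x
  define g where "g x = g\<phi> x + gv x" for x
  have wu: "wgrad u g" unfolding u_def g_def by (rule wgrad_add[OF w\<phi> W0_wgrad[OF p W]])
  have Lu: "in_Lp p u" "in_Lp p g"
    unfolding u_def g_def by (intro in_Lp_add(1) L\<phi> W0D(1,2)[OF W] p0)+
  have um: "u \<in> borel_measurable lebesgue" and gm: "g \<in> borel_measurable lebesgue"
    using Lu by (auto dest: in_LpD)
  have \<Omega>s[measurable]: "\<Omega> \<in> sets lebesgue" using \<Omega>(1) by simp
  have \<Omega>f: "emeasure lebesgue \<Omega> < \<infinity>" using emeasure_bounded_finite[OF \<Omega>(2)] \<Omega>(1) by simp
  obtain R where R: "\<And>x. x \<in> \<Omega> \<Longrightarrow> norm x \<le> R" using \<Omega>(2) unfolding bounded_iff by blast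
  let ?I = "indicator \<Omega> :: real^'n \<Rightarrow> real"
  have gI: "integrable lebesgue (\<lambda>x. ?I x *\<^sub>R g x)"
    by (intro locint_mult_integrable[OF wgrad_locint(2)[OF wu], where B = 1 and R = R])
      (auto simp: indicator_def dest: R)
  \<comment> \<open>The superlinear function is adapted to this particular \<open>u\<close>, so that
    adding it to the integrand keeps the cost of \<open>u\<close> finite.\<close>
  obtain \<Psi> where \<Psi>: "continuous_on UNIV \<Psi>" "\<And>r. 0 \<le> \<Psi> r" "\<And>K. \<exists>R. \<forall>r. R \<le> r \<longrightarrow> K * r \<le> \<Psi> r"
    "integrable lebesgue (\<lambda>x. \<Psi> (norm (?I x *\<^sub>R g x)))"
    using de_la_Vallee_Poussin[OF integrable_norm[OF gI] norm_ge_zero] by blast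
  define L where "L z = \<bar>H z\<bar> + norm (snd z) powr p + \<Psi> (norm (snd z))" for z :: "real \<times> (real^'n)"
  have Lc: "continuous_on UNIV L"
    unfolding L_def using p0
    by (intro continuous_on_add continuous_on_rabs H continuous_on_powr' continuous_on_compose2[OF \<Psi>(1)])
       (auto intro!: continuous_intros)
  have L\<Psi>: "\<Psi> (norm \<xi>) \<le> L (s, \<xi>)" and LH: "\<bar>H (s, \<xi>)\<bar> \<le> L (s, \<xi>)"
    and Lp: "norm \<xi> powr p \<le> L (s, \<xi>)" and L0: "0 \<le> L (s, \<xi>)" for s \<xi>
    using \<Psi>(2)[of "norm \<xi>"] by (auto simp: L_def)
  have LI: "integrable lebesgue (\<lambda>x. ?I x * L (u x, g x))"
  proof -
    have "integrable lebesgue (\<lambda>x. ?I x *\<^sub>R \<Psi> (norm (?I x *\<^sub>R g x)))"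
      by (rule integrable_mult_indicator[OF \<Omega>s \<Psi>(4)])
    moreover have "(\<lambda>x. ?I x *\<^sub>R \<Psi> (norm (?I x *\<^sub>R g x))) = (\<lambda>x. ?I x * \<Psi> (norm (g x)))"
      by (auto simp: fun_eq_iff indicator_def)
    ultimately have 1: "integrable lebesgue (\<lambda>x. ?I x * \<Psi> (norm (g x)))" by simp
    have 2: "integrable lebesgue (\<lambda>x. ?I x * norm (g x) powr p)"
      using integrable_mult_indicator[OF \<Omega>s in_LpD(2)[OF Lu(2)]] by simp
    have "integrable lebesgue (\<lambda>x. norm (?I x * H (u x, g x)))"
      using HI unfolding u_def g_def by (rule integrable_norm)
    then have 3: "integrable lebesgue (\<lambda>x. ?I x * \<bar>H (u x, g x)\<bar>)" by (simp add: abs_mult)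
    have "(\<lambda>x. ?I x * L (u x, g x)) = (\<lambda>x. ?I x * \<bar>H (u x, g x)\<bar> + ?I x * norm (g x) powr p + ?I x * \<Psi> (norm (g x)))"
      by (simp add: L_def fun_eq_iff distrib_left)
    then show ?thesis using 1 2 3 by simp
  qed
  \<comment> \<open>Heights above \<open>C'\<close> lie above the boundary datum and are also
    nonnegative; the sign gives \<zeta> >= 0 and makes the part cut off at most |u|.\<close>
  define C' where "C' = max C 0"
  \<comment> \<open>With the nonnegative barrier a - \<phi>, the positive part of v - (a - \<phi>) =
    u - a is an element of \<open>W0\<close> whose gradient is that of \<open>u\<close> on {u >
    a}.\<close>
  have zero': "(LINT x|lebesgue. indicator {x \<in> \<Omega>. a < u x} x *\<^sub>R g x) = 0" if a: "C' \<le> a" for a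
  proof -
    have "W0 p \<Omega> (\<lambda>x. max (v x - (a - \<phi> x)) 0) (\<lambda>x. if a - \<phi> x < v x then gv x - (- g\<phi> x) else 0)"
    proof (rule W0_trunc[OF p \<Omega> W wgrad_const_diff[OF w\<phi>]])
      show "0 \<le> a - \<phi> x" for x using \<phi>C[of x] a by (simp add: C'_def)
      show "in_Lp p (\<lambda>x. indicat_real (cball 0 R) x *\<^sub>R - g\<phi> x)" for R
        by (intro in_Lp_indicator cball_sets_lebesgue p0 in_Lp_uminus(1)[THEN iffD2] L\<phi>)
    qed
    from W0_integral_gradient(2)[OF p \<Omega>(2) this]
    have "(LINT x|lebesgue. (if a - \<phi> x < v x then gv x - (- g\<phi> x) else 0)) = 0" .
    moreover have "(if a - \<phi> x < v x then gv x - (- g\<phi> x) else 0) = indicator {x \<in> \<Omega>. a < u x} x *\<^sub>R g x" for x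
      using W0D(3)[OF W, of x] \<phi>C[of x] a by (cases "x \<in> \<Omega>") (auto simp: u_def g_def C'_def algebra_simps)
    ultimately show ?thesis by simp
  qed
  then have zero: "\<forall>a\<ge>C'. (LINT x|lebesgue. indicator {x \<in> \<Omega>. a < u x} x *\<^sub>R g x) = 0" by blast
  \<comment> \<open>One majorant for everything lost on {u > t}: |u|^p for the L^p distance,
    \<open>L\<close> for gradient and Lagrangian, and 1 so that its tail also bounds the measure of
    the set.\<close>
  define B where "B x = norm (u x) powr p + L (u x, g x) + 1" for x
  have BI: "integrable lebesgue (\<lambda>x. ?I x * B x)"
  proof -
    have "integrable lebesgue (\<lambda>x. ?I x * norm (u x) powr p)"
      using integrable_mult_indicator[OF \<Omega>s in_LpD(2)[OF Lu(1)]] by simp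
    moreover have "integrable lebesgue ?I" by (rule integrable_real_indicator[OF \<Omega>s \<Omega>f])
    ultimately show ?thesis using LI unfolding B_def distrib_left by simp
  qed
  have B: "norm (u x) powr p \<le> B x" "L (u x, g x) \<le> B x" "1 \<le> B x" for x
    using L0[of "u x" "g x"] by (auto simp: B_def add_increasing)
  \<comment> \<open>The errors add up to less than 5 e': one e' from the tail of \<open>B\<close>
    and four from \<open>k\<close>. The factor 2^p comes from splitting the difference of
    gradients.\<close>
  define e' where "e' = e / (6 * 2 powr p)"
  have two: "1 \<le> 2 powr p" using p0 by (simp add: ge_one_powr_ge_zero)
  have e': "0 < e'" "5 * 2 powr p * e' < e" using e two by (auto simp: e'_def)
  have e'5: "5 * e' < e"
  proof -
    have "5 * e' * 1 \<le> 5 * e' * 2 powr p" using two e' by (intro mult_left_mono) auto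
    then show ?thesis using e'(2) by (simp add: mult_ac)
  qed
  obtain T1 where T1: "\<And>t. T1 \<le> t \<Longrightarrow> (LINT x|lebesgue. indicator {x \<in> \<Omega>. t < u x} x * B x) < e'"
    using superlevel_integral_small[OF BI um \<Omega>s e'(1)] by blast
  from good_truncation_height[OF \<Omega> um gI Lc \<Psi>(2,3) L\<Psi> LI zero e'(1), where ?t0.0 = "max T1 C'"]
  obtain t q \<gamma> F where t: "max T1 C' \<le> t" and F: "finite F" "0 \<in> convex hull F"
    and qL: "\<And>\<xi>. \<gamma> + q \<bullet> \<xi> \<le> L (t, \<xi>)" "\<And>\<xi>. \<xi> \<in> F \<Longrightarrow> L (t, \<xi>) \<le> \<gamma> + q \<bullet> \<xi> + 1"
    and \<gamma>m: "\<gamma> * measure lebesgue {x \<in> \<Omega>. t < u x} < e'"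
    by blast
  have t0: "0 \<le> t" "C \<le> t" "T1 \<le> t" using t by (auto simp: C'_def)
  define E where "E = {x \<in> \<Omega>. t < u x}"
  let ?E = "indicator E :: real^'n \<Rightarrow> real"
  have "E = \<Omega> \<inter> {x \<in> space lebesgue. t < u x}" by (auto simp: E_def)
  then have Es[measurable]: "E \<in> sets lebesgue" using um \<Omega>s by simp
  have E\<Omega>: "E \<subseteq> \<Omega>" by (auto simp: E_def)
  have ER: "E \<subseteq> cball 0 R" using E\<Omega> R by auto
  have Ef: "emeasure lebesgue E < \<infinity>" using emeasure_mono[OF E\<Omega> \<Omega>s] \<Omega>f by (rule le_less_trans)
  have EI: "integrable lebesgue ?E" by (rule integrable_real_indicator[OF Es Ef])
  have EB: "integrable lebesgue (\<lambda>x. ?E x * B x)"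
  proof -
    have "integrable lebesgue (\<lambda>x. ?E x *\<^sub>R (?I x * B x))" by (rule integrable_mult_indicator[OF Es BI])
    moreover have "(\<lambda>x. ?E x *\<^sub>R (?I x * B x)) = (\<lambda>x. ?E x * B x)"
      using E\<Omega> by (auto simp: fun_eq_iff indicator_def)
    ultimately show ?thesis by simp
  qed
  have EBe: "(LINT x|lebesgue. ?E x * B x) < e'" using T1[OF t0(3)] by (simp add: E_def)
  define m where "m = measure lebesgue E"
  have m_int: "(LINT x|lebesgue. ?E x) = m" by (simp add: m_def)
  have m: "0 \<le> m" "m < e'"
  proof -
    show "0 \<le> m" by (simp add: m_def)
    have "m \<le> (LINT x|lebesgue. ?E x * B x)"
      unfolding m_int[symmetric] using B(3) by (intro integral_mono EI EB) (auto simp: indicator_def)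
    then show "m < e'" using EBe by linarith
  qed
  obtain M where M: "0 < M" "\<And>\<xi>. \<xi> \<in> F \<Longrightarrow> norm \<xi> \<le> M"
    using finite_imp_bounded[OF F(1)] unfolding bounded_pos by blast
  \<comment> \<open>Chosen so that the linear term, at most |q| times this bound, contributes at
    most e'; the 1 covers \<open>q = 0\<close>.\<close>
  have "0 < e' / (norm q + 1)" using e'(1) by (simp add: add_nonneg_pos)
  from integral_gradient_small[OF Es ER this, of M] obtain e1 where e1: "0 < e1"
    "\<And>w G. wgrad w G \<Longrightarrow> (\<And>x. norm (G x) \<le> M) \<Longrightarrow> (\<And>x. x \<in> cball 0 (R + 1) \<Longrightarrow> \<bar>w x\<bar> \<le> e1)
      \<Longrightarrow> norm (LINT x|lebesgue. ?E x *\<^sub>R G x) \<le> e' / (norm q + 1)" by blast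
  have "\<forall>\<^sub>F s in nhds t. \<forall>\<xi>\<in>F. L (s, \<xi>) < L (t, \<xi>) + 1"
  proof (rule eventually_ball_finite[OF F(1)], rule ballI)
    fix \<xi> assume "\<xi> \<in> F"
    have "continuous_on UNIV (\<lambda>s. L (s, \<xi>))"
      by (rule continuous_on_compose2[OF Lc]) (auto intro!: continuous_intros)
    then have "isCont (\<lambda>s. L (s, \<xi>)) t" by (simp add: continuous_on_eq_continuous_at)
    then have "((\<lambda>s. L (s, \<xi>)) \<longlongrightarrow> L (t, \<xi>)) (nhds t)" using tendsto_at_iff_tendsto_nhds[of "\<lambda>s. L (s, \<xi>)" t] by (simp add: isCont_def)
    then show "\<forall>\<^sub>F s in nhds t. L (s, \<xi>) < L (t, \<xi>) + 1" by (rule order_tendstoD(2)) simp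
  qed
  \<comment> \<open>A single neighbourhood of \<open>t\<close> serves all gradients in the finite
    set \<open>F\<close>. Below, \<open>w\<close> is kept under e2 / 2, so that t + w stays strictly
    inside.\<close>
  then obtain e2 where e2: "0 < e2" "\<And>s \<xi>. \<bar>s - t\<bar> < e2 \<Longrightarrow> \<xi> \<in> F \<Longrightarrow> L (s, \<xi>) < L (t, \<xi>) + 1"
    unfolding eventually_nhds_metric dist_real_def by blast
  have "0 < min e1 (e2 / 2)" using e1(1) e2(1) by simp
  from small_function_with_gradient_in[OF F bounded_cball this]
  obtain w G where wG: "wgrad w G" "\<And>x. G x \<in> F" "\<And>x. 0 \<le> w x"
    "\<And>x. x \<in> cball 0 (R + 1) \<Longrightarrow> w x \<le> min e1 (e2 / 2)" by blast
  have GM: "norm (G x) \<le> M" for x using M(2)[OF wG(2)] .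
  have Gm: "G \<in> borel_measurable lebesgue" by (rule locint_measurable[OF wgrad_locint(2)[OF wG(1)]])
  have w\<Omega>: "w x \<le> min e1 (e2 / 2)" if "x \<in> \<Omega>" for x using wG(4)[of x] R[OF that] by simp
  define \<zeta> where "\<zeta> x = t + w x" for x
  have w\<zeta>: "wgrad \<zeta> G" unfolding \<zeta>_def by (rule wgrad_const_add[OF wG(1)])
  have \<zeta>m: "\<zeta> \<in> borel_measurable lebesgue" by (rule locint_measurable[OF wgrad_locint(1)[OF w\<zeta>]])
  have \<zeta>t: "t \<le> \<zeta> x" for x using wG(3)[of x] by (simp add: \<zeta>_def)
  \<comment> \<open>The part of \<open>u\<close> above \<open>\<zeta>\<close>. The barrier \<zeta> -
    \<phi> is nonnegative because t >= C, so \<open>W0_trunc\<close> keeps \<open>d\<close> in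
    \<open>W0\<close>.\<close>
  define d where "d x = max (v x - (\<zeta> x - \<phi> x)) 0" for x
  define gd where "gd x = (if \<zeta> x - \<phi> x < v x then gv x - (G x - g\<phi> x) else 0)" for x
  have Wd: "W0 p \<Omega> d gd"
    unfolding d_def gd_def
  proof (rule W0_trunc[OF p \<Omega> W wgrad_diff[OF w\<zeta> w\<phi>]])
    show "0 \<le> \<zeta> x - \<phi> x" for x using \<zeta>t[of x] \<phi>C[of x] t0 by linarith
    fix R
    have "in_Lp p (\<lambda>x. indicat_real (cball 0 R) x *\<^sub>R G x)"
    proof -
      have "integrable lebesgue (\<lambda>x. norm (indicat_real (cball 0 R) x *\<^sub>R G x) powr p)"
        using Gm GM M(1) p0
        by (intro integrable_of_bounded[where B = "M powr p" and R = R])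
           (auto simp: indicator_def intro!: powr_mono2)
      moreover have "(\<lambda>x. indicat_real (cball 0 R) x *\<^sub>R G x) \<in> borel_measurable lebesgue"
        using Gm by measurable
      ultimately show ?thesis by (simp add: in_Lp_def)
    qed
    from in_Lp_diff(1)[OF this in_Lp_indicator[OF L\<phi>(2) p0(2) cball_sets_lebesgue] p0(2)]
    show "in_Lp p (\<lambda>x. indicat_real (cball 0 R) x *\<^sub>R (G x - g\<phi> x))" by (simp add: scaleR_diff_right)
  qed
  define v' where "v' x = v x - d x" for x
  define gv' where "gv' x = gv x - gd x" for x
  have Wv': "W0 p \<Omega> v' gv'" unfolding v'_def gv'_def by (rule W0_diff[OF p0(1) W Wd])
  have u': "\<phi> x + v' x = min (u x) (\<zeta> x)" for x by (simp add: v'_def d_def u_def min_def max_def)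
  have g': "g\<phi> x + gv' x = (if \<zeta> x < u x then G x else g x)" for x
    by (auto simp: gv'_def gd_def u_def g_def algebra_simps)
  have in_E: "x \<in> E" if "x \<in> \<Omega>" "\<zeta> x < u x" for x using that \<zeta>t[of x] by (auto simp: E_def)
  have off: "d x = 0 \<and> gd x = 0" if "x \<notin> E" for x
  proof (cases "x \<in> \<Omega>")
    case True
    then have "\<not> \<zeta> x < u x" using in_E that by blast
    then show ?thesis by (simp add: d_def gd_def u_def)
  qed (use W0D(3,4)[OF Wd] in auto)
  \<comment> \<open>Two units are lost: one because the points of \<open>F\<close> only almost touch
    the minorant, one for moving from height \<open>t\<close> to t + w.\<close>
  have upper: "L (\<zeta> x, G x) \<le> \<gamma> + 2 + q \<bullet> G x" if "x \<in> \<Omega>" for x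
  proof -
    have "\<bar>\<zeta> x - t\<bar> < e2" using w\<Omega>[OF that] wG(3)[of x] e2(1) by (simp add: \<zeta>_def)
    from e2(2)[OF this wG(2)[of x]] qL(2)[OF wG(2)[of x]] show ?thesis by linarith
  qed
  define k where "k x = ?E x * (\<gamma> + 2 + q \<bullet> G x)" for x
  have EG: "integrable lebesgue (\<lambda>x. ?E x *\<^sub>R G x)"
    using ER by (intro locint_mult_integrable[OF wgrad_locint(2)[OF wG(1)], where B = 1 and R = R])
      (auto simp: indicator_def)
  have k_eq: "k = (\<lambda>x. (\<gamma> + 2) * ?E x + q \<bullet> (?E x *\<^sub>R G x))" by (simp add: k_def fun_eq_iff algebra_simps)
  have kI: "integrable lebesgue k"
    unfolding k_eq by (intro Bochner_Integration.integrable_add integrable_mult_right EI integrable_inner_right EG)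
  \<comment> \<open>Both \<gamma> m and m are below e', so (\<gamma> + 2) m < 3 e'; the oscillation
    of \<open>w\<close> bounds the linear term by a fourth e'.\<close>
  have ke: "(LINT x|lebesgue. k x) < 4 * e'"
  proof -
    have "(LINT x|lebesgue. k x) = (\<gamma> + 2) * m + q \<bullet> (LINT x|lebesgue. ?E x *\<^sub>R G x)"
      unfolding k_eq
      by (simp only: Bochner_Integration.integral_add[OF integrable_mult_right[OF EI] integrable_inner_right[OF EG]]
          integral_inner_right[OF EG] integral_mult_right_zero m_int)
    moreover have "(\<gamma> + 2) * m < 3 * e'"
      using \<gamma>m m(2) by (simp add: m_def E_def algebra_simps)
    moreover have "q \<bullet> (LINT x|lebesgue. ?E x *\<^sub>R G x) \<le> e'"
    proof -
      have "\<bar>w x\<bar> \<le> e1" if "x \<in> cball 0 (R + 1)" for x using wG(4)[OF that] wG(3)[of x] by simp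
      from e1(2)[OF wG(1) GM this]
      have *: "norm (LINT x|lebesgue. ?E x *\<^sub>R G x) \<le> e' / (norm q + 1)" by blast
      have "q \<bullet> (LINT x|lebesgue. ?E x *\<^sub>R G x) \<le> norm q * norm (LINT x|lebesgue. ?E x *\<^sub>R G x)"
        by (rule norm_cauchy_schwarz)
      also have "\<dots> \<le> norm q * (e' / (norm q + 1))" by (rule mult_left_mono[OF * norm_ge_zero])
      also have "\<dots> \<le> e'"
      proof -
        have "norm q * e' \<le> e' * (norm q + 1)" using e'(1) by (simp add: algebra_simps)
        moreover have "0 < norm q + 1" by (simp add: add_nonneg_pos)
        ultimately show ?thesis by (simp only: times_divide_eq_right pos_divide_le_eq)
      qed
      finally show ?thesis .
    qed
    ultimately show ?thesis by linarith
  qed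
  \<comment> \<open>The integral of \<open>q \<bullet> G\<close> is known to be small over
    \<open>E\<close>, which was fixed before \<open>w\<close>, and not over the smaller set {u >
    \<zeta>} that depends on \<open>w\<close>. Enlarging the domain is allowed because
    \<open>k\<close> bounds L (\<zeta>, G) >= 0 on all of \<open>E\<close>.\<close>
  have k0: "0 \<le> k x" and kL: "\<zeta> x < u x \<Longrightarrow> x \<in> \<Omega> \<Longrightarrow> L (\<zeta> x, G x) \<le> k x" for x
  proof -
    show "0 \<le> k x"
    proof (cases "x \<in> E")
      case True
      then show ?thesis using upper[of x] E\<Omega> L0[of "\<zeta> x" "G x"] by (auto simp: k_def)
    qed (simp add: k_def)
    show "L (\<zeta> x, G x) \<le> k x" if "\<zeta> x < u x" "x \<in> \<Omega>" using upper[OF that(2)] in_E[OF that(2,1)] by (simp add: k_def)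
  qed
  have S: "integrable lebesgue (\<lambda>x. ?E x * B x + k x)"
    by (rule Bochner_Integration.integrable_add[OF EB kI])
  have Se: "(LINT x|lebesgue. ?E x * B x + k x) < 5 * e'"
    using EBe ke by (simp add: Bochner_Integration.integral_add[OF EB kI])
  have BE0: "0 \<le> ?E x * B x" for x using B(3)[of x] by (auto simp: indicator_def)
  have 1: "Lp_int p (\<lambda>x. v' x - v x) < e"
  proof -
    have "Lp_int p (\<lambda>x. v' x - v x) = Lp_int p d"
      using in_Lp_uminus(2)[of p d] by (simp add: v'_def)
    also have "\<dots> \<le> (LINT x|lebesgue. ?E x * B x)"
      unfolding Lp_int_def
    proof (rule integral_mono[OF in_LpD(2)[OF W0D(1)[OF Wd]] EB])
      fix x
      show "norm (d x) powr p \<le> ?E x * B x"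
      proof (cases "x \<in> E")
        case True
        then have "0 \<le> u x" using t0 by (auto simp: E_def)
        then have "norm (d x) \<le> norm (u x)" using \<zeta>t[of x] t0 by (auto simp: d_def u_def)
        then have "norm (d x) powr p \<le> norm (u x) powr p" using p0 by (intro powr_mono2) auto
        then show ?thesis using B(1)[of x] True by simp
      qed (use off in simp)
    qed
    finally show ?thesis using EBe e'5 e'(1) by linarith
  qed
  have 2: "Lp_int p (\<lambda>x. gv' x - gv x) < e"
  proof -
    have "Lp_int p (\<lambda>x. gv' x - gv x) = Lp_int p gd"
      using in_Lp_uminus(2)[of p gd] by (simp add: gv'_def)
    also have "\<dots> \<le> (LINT x|lebesgue. 2 powr p * (?E x * B x + k x))"
      unfolding Lp_int_def
    proof (rule integral_mono[OF in_LpD(2)[OF W0D(2)[OF Wd]] integrable_mult_right[OF S]])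
      fix x
      show "norm (gd x) powr p \<le> 2 powr p * (?E x * B x + k x)"
      proof (cases "x \<in> E \<and> \<zeta> x < u x")
        case True
        then have x: "x \<in> \<Omega>" "x \<in> E" "\<zeta> x < u x" using E\<Omega> by auto
        have "gd x = g x + - G x" using x by (simp add: gd_def u_def g_def algebra_simps)
        then have "norm (gd x) powr p \<le> 2 powr p * (norm (g x) powr p + norm (G x) powr p)"
          using powr_norm_add_le[OF p0(2), of "g x" "- G x"] by simp
        also have "\<dots> \<le> 2 powr p * (?E x * B x + k x)"
          using Lp[of "g x" "u x"] B(2)[of x] Lp[of "G x" "\<zeta> x"] kL[OF x(3,1)] x(2)
          by (intro mult_left_mono add_mono) auto
        finally show ?thesis .
      next
        case False
        then have "gd x = 0" using off[of x] by (auto simp: gd_def u_def)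
        then show ?thesis using BE0[of x] k0[of x] by simp
      qed
    qed
    also have "\<dots> = 2 powr p * (LINT x|lebesgue. ?E x * B x + k x)" by simp
    also have "\<dots> \<le> 2 powr p * (5 * e')" using Se by (intro mult_left_mono) auto
    finally show ?thesis using e'(2) by (simp add: mult_ac)
  qed
  have pair_meas: "(\<lambda>x. H (a x, b x)) \<in> borel_measurable lebesgue"
    if "a \<in> borel_measurable lebesgue" "b \<in> borel_measurable lebesgue" for a :: "real^'n \<Rightarrow> real" and b
    by (rule measurable_compose[OF borel_measurable_Pair[OF that] borel_measurable_continuous_onI[OF H]])
  let ?h = "\<lambda>x. H (u x, g x)" and ?h' = "\<lambda>x. H (\<phi> x + v' x, g\<phi> x + gv' x)"
  have hm: "?h \<in> borel_measurable lebesgue" by (rule pair_meas[OF um gm])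
  have hm': "?h' \<in> borel_measurable lebesgue"
  proof (rule pair_meas)
    show "(\<lambda>x. \<phi> x + v' x) \<in> borel_measurable lebesgue" unfolding u' using um \<zeta>m by measurable
    show "(\<lambda>x. g\<phi> x + gv' x) \<in> borel_measurable lebesgue" unfolding g' using um \<zeta>m Gm gm by measurable
  qed
  have diff_le: "?I x * \<bar>?h' x - ?h x\<bar> \<le> ?E x * B x + k x" for x
  proof (cases "x \<in> \<Omega> \<and> \<zeta> x < u x")
    case True
    then have x: "x \<in> \<Omega>" "\<zeta> x < u x" "x \<in> E" using in_E by auto
    have "?h' x = H (\<zeta> x, G x)" using x by (simp add: u' g')
    then have "\<bar>?h' x - ?h x\<bar> \<le> L (\<zeta> x, G x) + L (u x, g x)"
      using LH[of "\<zeta> x" "G x"] LH[of "u x" "g x"] by linarith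
    then show ?thesis using x kL[OF x(2,1)] B(2)[of x] by simp
  next
    case False
    have "?I x * \<bar>?h' x - ?h x\<bar> = 0"
    proof (cases "x \<in> \<Omega>")
      case True
      then have "\<not> \<zeta> x < u x" using False by blast
      then have "min (u x) (\<zeta> x) = u x" "g\<phi> x + gv' x = g x" using g'[of x] by auto
      then show ?thesis unfolding u' by simp
    qed simp
    then show ?thesis using BE0[of x] k0[of x] by linarith
  qed
  have dI: "integrable lebesgue (\<lambda>x. ?I x * \<bar>?h' x - ?h x\<bar>)"
  proof (rule Bochner_Integration.integrable_bound[OF S])
    show "(\<lambda>x. ?I x * \<bar>?h' x - ?h x\<bar>) \<in> borel_measurable lebesgue" using hm hm' by measurable
    show "AE x in lebesgue. norm (?I x * \<bar>?h' x - ?h x\<bar>) \<le> norm (?E x * B x + k x)"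
    proof (rule AE_I2)
      fix x
      have "norm (?I x * \<bar>?h' x - ?h x\<bar>) = ?I x * \<bar>?h' x - ?h x\<bar>" by (simp add: abs_mult)
      also have "\<dots> \<le> ?E x * B x + k x" by (rule diff_le)
      also have "\<dots> \<le> norm (?E x * B x + k x)" by simp
      finally show "norm (?I x * \<bar>?h' x - ?h x\<bar>) \<le> norm (?E x * B x + k x)" .
    qed
  qed
  have 3: "(LINT x|lebesgue. ?I x * \<bar>?h' x - ?h x\<bar>) < e"
    using integral_mono[OF dI S diff_le] Se e'5 by linarith
  have HI': "integrable lebesgue (\<lambda>x. ?I x * ?h x)" using HI by (simp add: u_def g_def)
  have 4: "integrable lebesgue (\<lambda>x. ?I x * ?h' x)"
  proof (rule Bochner_Integration.integrable_bound[OF Bochner_Integration.integrable_add[OF integrable_norm[OF HI'] dI]])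
    show "(\<lambda>x. ?I x * ?h' x) \<in> borel_measurable lebesgue" using hm' by measurable
    show "AE x in lebesgue. norm (?I x * ?h' x) \<le> norm (norm (?I x * ?h x) + ?I x * \<bar>?h' x - ?h x\<bar>)"
      by (rule AE_I2) (auto simp: indicator_def)
  qed
  show ?thesis
  proof (rule that[OF Wv' _ _ _ 1 2 4])
    show "\<forall>x. 0 \<le> \<zeta> x" using \<zeta>t t0(1) order_trans by blast
    show "\<forall>x\<in>\<Omega>. \<zeta> x \<le> t + e1" using w\<Omega> by (simp add: \<zeta>_def)
    show "\<forall>x. \<phi> x + v' x = min (\<phi> x + v x) (\<zeta> x)" using u' by (simp add: u_def)
    show "(LINT x|lebesgue. ?I x * \<bar>?h' x - H (\<phi> x + v x, g\<phi> x + gv x)\<bar>) < e"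
      using 3 by (simp add: u_def g_def)
  qed
qed

text \<open>Cut \<open>u\<close> from above, then apply the same lemma to the negative of the
  result, with z |-> H (- z) as integrand. The barriers are nonnegative, so the second cut does not
  destroy the upper bound.\<close>

lemma bounded_truncation:
  fixes H :: "real \<times> (real^'n) \<Rightarrow> real"
  assumes \<Omega>: "open \<Omega>" "bounded \<Omega>" and p: "1 \<le> p"
    and w\<phi>: "wgrad \<phi> g\<phi>" and L\<phi>: "in_Lp p \<phi>" "in_Lp p g\<phi>" and \<phi>C: "\<And>x. \<bar>\<phi> x\<bar> \<le> C"
    and W: "W0 p \<Omega> v gv" and H: "continuous_on UNIV H"
    and HI: "integrable lebesgue (\<lambda>x. indicator \<Omega> x * H (\<phi> x + v x, g\<phi> x + gv x))" and e: "0 < e"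
  obtains T V gV where "W0 p \<Omega> V gV" "\<forall>x\<in>\<Omega>. \<bar>\<phi> x + V x\<bar> \<le> T"
    "Lp_int p (\<lambda>x. V x - v x) < e" "Lp_int p (\<lambda>x. gV x - gv x) < e"
    "integrable lebesgue (\<lambda>x. indicator \<Omega> x * H (\<phi> x + V x, g\<phi> x + gV x))"
    "(LINT x|lebesgue. indicator \<Omega> x * \<bar>H (\<phi> x + V x, g\<phi> x + gV x) - H (\<phi> x + v x, g\<phi> x + gv x)\<bar>) < e"
proof -
  have p0: "0 < p" "0 \<le> p" using p by auto
  have two: "1 \<le> 2 powr p" using p0 by (simp add: ge_one_powr_ge_zero)
  \<comment> \<open>Two truncation errors below \<open>d\<close> are added at the price of a factor
    2^p.\<close>
  define d where "d = e / (2 * 2 powr p)"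
  have d: "0 < d" "2 powr p * (d + d) = e" using e by (auto simp: d_def)
  have d2: "d + d \<le> e"
  proof -
    have "1 * (d + d) \<le> 2 powr p * (d + d)" using two d(1) by (intro mult_right_mono) auto
    then show ?thesis using d(2) by simp
  qed
  have \<phi>1: "\<phi> x \<le> C" and \<phi>2: "- \<phi> x \<le> C" for x using \<phi>C[of x] by auto
  let ?I = "indicator \<Omega> :: real^'n \<Rightarrow> real"
  let ?h = "\<lambda>v gv x. H (\<phi> x + v x, g\<phi> x + gv x)"
  obtain \<zeta>1 T1 v1 gv1 where 1: "W0 p \<Omega> v1 gv1" "\<forall>x. 0 \<le> \<zeta>1 x" "\<forall>x\<in>\<Omega>. \<zeta>1 x \<le> T1"
    "\<forall>x. \<phi> x + v1 x = min (\<phi> x + v x) (\<zeta>1 x)"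
    "Lp_int p (\<lambda>x. v1 x - v x) < d" "Lp_int p (\<lambda>x. gv1 x - gv x) < d"
    "integrable lebesgue (\<lambda>x. ?I x * ?h v1 gv1 x)"
    "(LINT x|lebesgue. ?I x * \<bar>?h v1 gv1 x - ?h v gv x\<bar>) < d"
    by (rule truncation_from_above[OF \<Omega> p w\<phi> L\<phi> \<phi>1 W H HI d(1)])
  have H': "continuous_on UNIV (\<lambda>z. H (- z))"
    by (rule continuous_on_compose2[OF H]) (auto intro!: continuous_intros)
  have HI': "integrable lebesgue (\<lambda>x. ?I x * H (- (- \<phi> x + - v1 x, - g\<phi> x + - gv1 x)))"
    using 1(7) by (simp add: add.commute)
  have L\<phi>': "in_Lp p (\<lambda>x. - \<phi> x)" "in_Lp p (\<lambda>x. - g\<phi> x)" using L\<phi> by (simp_all add: in_Lp_uminus)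
  obtain \<zeta>2 T2 v2 gv2 where 2: "W0 p \<Omega> v2 gv2" "\<forall>x. 0 \<le> \<zeta>2 x" "\<forall>x\<in>\<Omega>. \<zeta>2 x \<le> T2"
    "\<forall>x. - \<phi> x + v2 x = min (- \<phi> x + - v1 x) (\<zeta>2 x)"
    "Lp_int p (\<lambda>x. v2 x - - v1 x) < d" "Lp_int p (\<lambda>x. gv2 x - - gv1 x) < d"
    "integrable lebesgue (\<lambda>x. ?I x * H (- (- \<phi> x + v2 x, - g\<phi> x + gv2 x)))"
    "(LINT x|lebesgue. ?I x * \<bar>H (- (- \<phi> x + v2 x, - g\<phi> x + gv2 x)) - H (- (- \<phi> x + - v1 x, - g\<phi> x + - gv1 x))\<bar>) < d"
    by (rule truncation_from_above[OF \<Omega> p wgrad_uminus[OF w\<phi>] L\<phi>' \<phi>2 W0_uminus[OF p0(1) 1(1)] H' HI' d(1)])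
  define V where "V x = - v2 x" for x
  define gV where "gV x = - gv2 x" for x
  have WV: "W0 p \<Omega> V gV" unfolding V_def gV_def by (rule W0_uminus[OF p0(1) 2(1)])
  have \<Omega>s[measurable]: "\<Omega> \<in> sets lebesgue" using \<Omega>(1) by simp
  have neg: "H (- (- \<phi> x + v2 x, - g\<phi> x + gv2 x)) = ?h V gV x"
    "H (- (- \<phi> x + - v1 x, - g\<phi> x + - gv1 x)) = ?h v1 gv1 x" for x
    by (simp_all add: V_def gV_def add.commute)
  have HV: "integrable lebesgue (\<lambda>x. ?I x * ?h V gV x)" using 2(7) unfolding neg .
  have HV1: "(LINT x|lebesgue. ?I x * \<bar>?h V gV x - ?h v1 gv1 x\<bar>) < d" using 2(8) unfolding neg .
  have close: "Lp_int p (\<lambda>x. a x - c x) < e"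
    if "Lp_int p (\<lambda>x. - a x - - b x) < d" "Lp_int p (\<lambda>x. b x - c x) < d" "in_Lp p a" "in_Lp p b" "in_Lp p c"
    for a b c :: "real^'n \<Rightarrow> 'b::euclidean_space"
  proof -
    have "Lp_int p (\<lambda>x. a x - b x) < d"
      using that(1) in_Lp_uminus(2)[of p "\<lambda>x. a x - b x"] by simp
    then have "2 powr p * (Lp_int p (\<lambda>x. a x - b x) + Lp_int p (\<lambda>x. b x - c x)) < 2 powr p * (d + d)"
      using that(2) by (intro mult_strict_left_mono add_strict_mono) auto
    then show ?thesis
      using in_Lp_triangle[OF in_Lp_diff(1)[OF that(3,4) p0(2)] in_Lp_diff(1)[OF that(4,5) p0(2)] p0(2)] d(2) by linarith
  qed
  have dI: "integrable lebesgue (\<lambda>x. ?I x * \<bar>a x - b x\<bar>)"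
    if "integrable lebesgue (\<lambda>x. ?I x * a x)" "integrable lebesgue (\<lambda>x. ?I x * b x)" for a b :: "real^'n \<Rightarrow> real"
  proof -
    have "integrable lebesgue (\<lambda>x. norm (?I x * a x - ?I x * b x))"
      by (intro integrable_norm Bochner_Integration.integrable_diff that)
    then show ?thesis by (simp add: right_diff_distrib[symmetric] abs_mult)
  qed
  show ?thesis
  proof (rule that[OF WV _ _ _ HV])
    show "\<forall>x\<in>\<Omega>. \<bar>\<phi> x + V x\<bar> \<le> max T1 T2"
    proof
      fix x assume x: "x \<in> \<Omega>"
      have b: "0 \<le> \<zeta>1 x" "\<zeta>1 x \<le> T1" "0 \<le> \<zeta>2 x" "\<zeta>2 x \<le> T2" using 1(2,3) 2(2,3) x by auto
      have "\<phi> x + v1 x \<le> \<zeta>1 x" using 1(4) by simp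
      \<comment> \<open>Read with the opposite sign, this says that the final function is the
        maximum of \<phi> + v1 and -\<zeta>2: at least -T2, and at most the larger of \<zeta>1 and
        0.\<close>
      moreover have "- \<phi> x + v2 x = min (- \<phi> x + - v1 x) (\<zeta>2 x)" using 2(4) by blast
      ultimately show "\<bar>\<phi> x + V x\<bar> \<le> max T1 T2" using b by (auto simp: V_def min_def max_def abs_le_iff split: if_splits)
    qed
    show "Lp_int p (\<lambda>x. V x - v x) < e"
      using 2(5) W0D(1)[OF WV] W0D(1)[OF 1(1)] W0D(1)[OF W] 1(5) by (intro close[of _ v1]) (simp_all add: V_def[abs_def])
    show "Lp_int p (\<lambda>x. gV x - gv x) < e"
      using 2(6) W0D(2)[OF WV] W0D(2)[OF 1(1)] W0D(2)[OF W] 1(6) by (intro close[of _ gv1]) (simp_all add: gV_def[abs_def])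
    have "(LINT x|lebesgue. ?I x * \<bar>?h V gV x - ?h v gv x\<bar>)
        \<le> (LINT x|lebesgue. ?I x * \<bar>?h V gV x - ?h v1 gv1 x\<bar> + ?I x * \<bar>?h v1 gv1 x - ?h v gv x\<bar>)"
      by (intro integral_mono Bochner_Integration.integrable_add dI HV 1(7) HI) (auto simp: indicator_def)
    also have "\<dots> = (LINT x|lebesgue. ?I x * \<bar>?h V gV x - ?h v1 gv1 x\<bar>) + (LINT x|lebesgue. ?I x * \<bar>?h v1 gv1 x - ?h v gv x\<bar>)"
      by (intro Bochner_Integration.integral_add dI HV 1(7) HI)
    finally show "(LINT x|lebesgue. ?I x * \<bar>?h V gV x - ?h v gv x\<bar>) < e"
      using HV1 1(8) d2 by linarith
  qed
qed

section \<open>Transfer to the spaces on \<open>\<Omega>\<close> and conclusion\<close>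

lemma lebesgue_on_integral_open:
  fixes f :: "real^'n \<Rightarrow> real"
  assumes "open \<Omega>"
  shows "integrable (lebesgue_on \<Omega>) f \<longleftrightarrow> integrable lebesgue (\<lambda>x. indicator \<Omega> x * f x)"
    "(LINT x|lebesgue_on \<Omega>. f x) = (LINT x|lebesgue. indicator \<Omega> x * f x)"
    "f \<in> borel_measurable (lebesgue_on \<Omega>) \<longleftrightarrow> (\<lambda>x. indicator \<Omega> x * f x) \<in> borel_measurable lebesgue"
proof -
  have S: "\<Omega> \<inter> space lebesgue \<in> sets lebesgue" using assms by simp
  show "integrable (lebesgue_on \<Omega>) f \<longleftrightarrow> integrable lebesgue (\<lambda>x. indicator \<Omega> x * f x)"
    "(LINT x|lebesgue_on \<Omega>. f x) = (LINT x|lebesgue. indicator \<Omega> x * f x)"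
    "f \<in> borel_measurable (lebesgue_on \<Omega>) \<longleftrightarrow> (\<lambda>x. indicator \<Omega> x * f x) \<in> borel_measurable lebesgue"
    using integrable_restrict_space[OF S, of f] integral_restrict_space[OF S, of f]
      borel_measurable_restrict_space_iff[OF S, of f] by simp_all
qed

lemma AE_lebesgue_on_open:
  assumes "open \<Omega>"
  shows "(AE x in lebesgue_on \<Omega>. P x) \<longleftrightarrow> (AE x in lebesgue. x \<in> \<Omega> \<longrightarrow> P x)"
  using assms by (intro AE_restrict_space_iff) simp

lemma lagrangian_along_AE:
  assumes \<Omega>: "open \<Omega>" and w: "has_weak_gradient \<Omega> u g" and AE: "AE x in lebesgue. x \<in> \<Omega> \<longrightarrow> u x = u' x"
  shows "AE x in lebesgue. indicator \<Omega> x * lagrangian_along \<Omega> H u x = indicator \<Omega> x * H (u' x, g x)"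
  using weak_grad_AE(2)[OF \<Omega> w] AE
  by eventually_elim (auto simp: lagrangian_along_def indicator_def)

text \<open>Outside \<open>\<Omega>\<close> both \<open>u\<close> and
  \<open>weak_grad \<Omega> u\<close> are arbitrary, so \<open>H\<close> is composed with their zero
  extensions and the product masked afterwards.\<close>

lemma lagrangian_along_measurable:
  fixes H :: "real \<times> (real^'n) \<Rightarrow> real"
  assumes \<Omega>: "open \<Omega>" and w: "has_weak_gradient \<Omega> u g" and H: "continuous_on UNIV H"
  shows "(\<lambda>x. indicator \<Omega> x * lagrangian_along \<Omega> H u x) \<in> borel_measurable lebesgue"
proof -
  have [measurable]: "\<Omega> \<in> sets lebesgue" using \<Omega> by simp
  have um: "(\<lambda>x. indicator \<Omega> x *\<^sub>R u x) \<in> borel_measurable lebesgue"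
    using w unfolding has_weak_gradient_def by (intro locally_integrable_measurable \<Omega>) auto
  have "(\<lambda>x. H (indicator \<Omega> x *\<^sub>R u x, indicator \<Omega> x *\<^sub>R weak_grad \<Omega> u x)) \<in> borel_measurable lebesgue"
    by (rule measurable_compose[OF borel_measurable_Pair[OF um weak_grad_AE(3)[OF \<Omega> w]] borel_measurable_continuous_onI[OF H]])
  then have "(\<lambda>x. indicator \<Omega> x * H (indicator \<Omega> x *\<^sub>R u x, indicator \<Omega> x *\<^sub>R weak_grad \<Omega> u x)) \<in> borel_measurable lebesgue"
    by measurable
  moreover have "(\<lambda>x. indicator \<Omega> x * H (indicator \<Omega> x *\<^sub>R u x, indicator \<Omega> x *\<^sub>R weak_grad \<Omega> u x))
      = (\<lambda>x. indicator \<Omega> x * lagrangian_along \<Omega> H u x)"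
    by (auto simp: fun_eq_iff lagrangian_along_def indicator_def)
  ultimately show ?thesis by simp
qed

theorem theorem1p2:
  fixes \<Omega> :: "(real^'n) set"
    and p :: real
    and \<phi> :: "real^'n \<Rightarrow> real"
    and H :: "real \<times> (real^'n) \<Rightarrow> real"
  assumes "open \<Omega>" and "bounded \<Omega>"
    and "1 \<le> p" and "p \<le> real CARD('n)"
    and "\<phi> \<in> W1p p UNIV \<inter> Linf UNIV"
    and "continuous_on UNIV H"
  shows "\<forall>u \<in> admissible p \<Omega> \<phi> H. Linf_regular_at p \<Omega> \<phi> H u"
proof
  fix u assume u: "u \<in> admissible p \<Omega> \<phi> H"
  note \<Omega> = assms(1,2) and p = assms(3) and H = assms(6)
  have p0: "0 < p" "0 \<le> p" using p by auto
  have \<Omega>s[measurable]: "\<Omega> \<in> sets lebesgue" using \<Omega>(1) by simp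
  let ?I = "indicator \<Omega> :: real^'n \<Rightarrow> real"
  obtain g\<phi> where g\<phi>: "\<phi> \<in> Lp p UNIV" "g\<phi> \<in> Lp p UNIV" "has_weak_gradient UNIV \<phi> g\<phi>"
    using assms(5) by (auto simp: W1p_def)
  obtain C where "AE x in lebesgue_on UNIV. \<bar>\<phi> x\<bar> \<le> C"
    using assms(5) by (auto simp: Linf_def)
  then have C: "AE x in lebesgue. \<bar>\<phi> x\<bar> \<le> C" by (simp only: AE_lebesgue_on_open[OF open_UNIV] UNIV_I simp_thms)
  have w\<phi>: "wgrad \<phi> g\<phi>" by (rule has_weak_gradient_UNIV[OF g\<phi>(3)])
  have L\<phi>: "in_Lp p \<phi>" "in_Lp p g\<phi>"
    using g\<phi>(1,2) by (simp_all add: Lp_iff_in_Lp[OF open_UNIV p0(2)])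
  \<comment> \<open>The truncation lemmas ask for a pointwise bound on the boundary datum;
    \<open>\<theta>\<close> is a representative of \<open>\<phi>\<close> bounded everywhere by
    |C|.\<close>
  define \<theta> where "\<theta> x = (if \<bar>\<phi> x\<bar> \<le> C then \<phi> x else 0)" for x
  have \<phi>m: "\<phi> \<in> borel_measurable lebesgue" using L\<phi>(1) by (rule in_LpD)
  have \<theta>m: "\<theta> \<in> borel_measurable lebesgue" unfolding \<theta>_def using \<phi>m by measurable
  have \<theta>AE: "AE x in lebesgue. \<phi> x = \<theta> x" using C by eventually_elim (simp add: \<theta>_def)
  have w\<theta>: "wgrad \<theta> g\<phi>" by (rule wgrad_cong_AE[OF w\<phi> \<theta>m in_LpD(1)[OF L\<phi>(2)] \<theta>AE]) simp
  have L\<theta>: "in_Lp p \<theta>" by (rule in_Lp_cong_AE[OF L\<phi>(1) \<theta>m \<theta>AE])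
  have \<theta>C: "\<bar>\<theta> x\<bar> \<le> \<bar>C\<bar>" for x by (simp add: \<theta>_def)
  obtain v where v: "u = (\<lambda>x. \<phi> x + v x)" "v \<in> W1p_0 p \<Omega>"
    using u by (auto simp: admissible_def W1p_bdry_def)
  obtain g where g: "has_weak_gradient \<Omega> v g" "W0 p \<Omega> (\<lambda>x. ?I x *\<^sub>R v x) (\<lambda>x. ?I x *\<^sub>R g x)"
    by (rule W1p_0_imp_W0[OF p \<Omega>(1) v(2)])
  \<comment> \<open>\<open>v\<close> is constrained only on \<open>\<Omega>\<close>; its zero
    extension is the object that \<open>W0\<close> and the truncation lemmas work with.\<close>
  define vt where "vt x = ?I x *\<^sub>R v x" for x
  define gt where "gt x = ?I x *\<^sub>R g x" for x
  have W: "W0 p \<Omega> vt gt" using g(2) by (simp add: vt_def[abs_def] gt_def[abs_def])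
  have wsum: "has_weak_gradient \<Omega> (\<lambda>x. \<phi> x + V x) (\<lambda>x. g\<phi> x + gV x)" if "W0 p \<Omega> V gV" for V gV
    by (rule wgrad_has_weak_gradient[OF \<Omega>(1) wgrad_add[OF w\<phi> W0_wgrad[OF p that]]])
  have sumL: "(\<lambda>x. \<phi> x + V x) \<in> Lp p \<Omega>" "(\<lambda>x. g\<phi> x + gV x) \<in> Lp p \<Omega>" if "W0 p \<Omega> V gV" for V gV
    unfolding Lp_iff_in_Lp[OF \<Omega>(1) p0(2)]
    by (intro in_Lp_indicator in_Lp_add(1) L\<phi> W0D(1,2)[OF that] p0 \<Omega>s)+
  have uvt: "x \<in> \<Omega> \<Longrightarrow> u x = \<phi> x + vt x" for x by (simp add: v(1) vt_def)
  have Iu: "(\<lambda>x. ?I x *\<^sub>R u x) = (\<lambda>x. ?I x *\<^sub>R (\<phi> x + vt x))"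
    using uvt by (auto simp: fun_eq_iff indicator_def)
  have um: "(\<lambda>x. ?I x *\<^sub>R u x) \<in> borel_measurable lebesgue"
    using sumL(1)[OF W] unfolding Lp_iff_in_Lp[OF \<Omega>(1) p0(2)] Iu by (rule in_LpD)
  have wu: "has_weak_gradient \<Omega> u (\<lambda>x. g\<phi> x + gt x)"
    by (rule has_weak_gradient_cong_AE[OF \<Omega>(1) wsum[OF W] um]) (use uvt in auto)
  have uL: "u \<in> Lp p \<Omega>"
    using sumL(1)[OF W] unfolding Lp_iff_in_Lp[OF \<Omega>(1) p0(2)] Iu .
  have u\<theta>: "AE x in lebesgue. x \<in> \<Omega> \<longrightarrow> u x = \<theta> x + vt x"
    using \<theta>AE by eventually_elim (simp add: uvt)
  note Lag_u = lagrangian_along_AE[OF \<Omega>(1) wu u\<theta>, of H]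
  note Lag_um = lagrangian_along_measurable[OF \<Omega>(1) wu H]
  have pair_meas: "(\<lambda>x. ?I x * H (\<theta> x + V x, g\<phi> x + gV x)) \<in> borel_measurable lebesgue"
    if "W0 p \<Omega> V gV" for V gV
  proof -
    have "(\<lambda>x. \<theta> x + V x) \<in> borel_measurable lebesgue" "(\<lambda>x. g\<phi> x + gV x) \<in> borel_measurable lebesgue"
      using \<theta>m in_LpD(1)[OF L\<phi>(2)] in_LpD(1)[OF W0D(1)[OF that]] in_LpD(1)[OF W0D(2)[OF that]] by measurable
    from measurable_compose[OF borel_measurable_Pair[OF this] borel_measurable_continuous_onI[OF H]]
    show ?thesis by measurable
  qed
  have Lag_uI: "integrable lebesgue (\<lambda>x. ?I x * lagrangian_along \<Omega> H u x)"
    using u by (simp add: admissible_def lebesgue_on_integral_open(1)[OF \<Omega>(1)])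
  have HI: "integrable lebesgue (\<lambda>x. ?I x * H (\<theta> x + vt x, g\<phi> x + gt x))"
    by (rule integrable_cong_AE_imp[OF Lag_uI pair_meas[OF W]]) (use Lag_u in auto)
  define Q where "Q k T V gV \<longleftrightarrow> W0 p \<Omega> V gV \<and> (\<forall>x\<in>\<Omega>. \<bar>\<theta> x + V x\<bar> \<le> T) \<and>
      Lp_int p (\<lambda>x. V x - vt x) < inverse (real (Suc k)) \<and> Lp_int p (\<lambda>x. gV x - gt x) < inverse (real (Suc k)) \<and>
      integrable lebesgue (\<lambda>x. ?I x * H (\<theta> x + V x, g\<phi> x + gV x)) \<and>
      (LINT x|lebesgue. ?I x * \<bar>H (\<theta> x + V x, g\<phi> x + gV x) - H (\<theta> x + vt x, g\<phi> x + gt x)\<bar>) < inverse (real (Suc k))"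
    for k T V gV
  have "\<exists>T V gV. Q k T V gV" for k
  proof -
    have "0 < inverse (real (Suc k))" by simp
    then show ?thesis
      unfolding Q_def by (rule bounded_truncation[OF \<Omega> p w\<theta> L\<theta> L\<phi>(2) \<theta>C W H HI]) (intro exI conjI; assumption)
  qed
  then obtain T V gV where Q: "\<And>k. Q k (T k) (V k) (gV k)" by metis
  have V: "W0 p \<Omega> (V k) (gV k)" "x \<in> \<Omega> \<Longrightarrow> \<bar>\<theta> x + V k x\<bar> \<le> T k"
    "Lp_int p (\<lambda>x. V k x - vt x) < inverse (real (Suc k))" "Lp_int p (\<lambda>x. gV k x - gt x) < inverse (real (Suc k))"
    "integrable lebesgue (\<lambda>x. ?I x * H (\<theta> x + V k x, g\<phi> x + gV k x))"
    "(LINT x|lebesgue. ?I x * \<bar>H (\<theta> x + V k x, g\<phi> x + gV k x) - H (\<theta> x + vt x, g\<phi> x + gt x)\<bar>) < inverse (real (Suc k))"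
    for k x
    using Q[of k] unfolding Q_def by blast+
  \<comment> \<open>Formed with \<open>\<phi>\<close> and not with \<open>\<theta>\<close>, since
    \<open>W1p_bdry\<close> consists literally of sums of \<open>\<phi>\<close> and an element of
    \<open>W1p_0\<close>. The bounds obtained for \<open>\<theta>\<close> carry over almost
    everywhere.\<close>
  define U where "U k x = \<phi> x + V k x" for k x
  have wU: "has_weak_gradient \<Omega> (U k) (\<lambda>x. g\<phi> x + gV k x)" for k unfolding U_def by (rule wsum[OF V(1)])
  have U\<theta>: "AE x in lebesgue. x \<in> \<Omega> \<longrightarrow> U k x = \<theta> x + V k x" for k
    using \<theta>AE by eventually_elim (simp add: U_def)
  note Lag_U = lagrangian_along_AE[OF \<Omega>(1) wU U\<theta>, of H]
  note Lag_Um = lagrangian_along_measurable[OF \<Omega>(1) wU H]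
  have Lag_UI: "integrable lebesgue (\<lambda>x. ?I x * lagrangian_along \<Omega> H (U k) x)" for k
    by (rule integrable_cong_AE_imp[OF V(5) Lag_Um]) (use Lag_U[of k] in \<open>auto elim: eventually_mono\<close>)
  show "Linf_regular_at p \<Omega> \<phi> H u"
    unfolding Linf_regular_at_def
  proof (intro exI[of _ U] conjI allI)
    fix k
    have Vm: "V k \<in> borel_measurable lebesgue" using W0D(1)[OF V(1)] by (rule in_LpD)
    have "V k \<in> W1p_0 p \<Omega>"
      by (rule W0_imp_W1p_0(1)[OF p \<Omega>(1) V(1)]) (use Vm in \<open>measurable, auto\<close>)
    then have "U k \<in> W1p_bdry p \<Omega> \<phi>" unfolding W1p_bdry_def U_def by blast
    then have "U k \<in> admissible p \<Omega> \<phi> H"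
      using Lag_UI by (simp add: admissible_def lebesgue_on_integral_open(1)[OF \<Omega>(1)])
    moreover have "U k \<in> Linf \<Omega>"
      unfolding Linf_def mem_Collect_eq lebesgue_on_integral_open(3)[OF \<Omega>(1)] AE_lebesgue_on_open[OF \<Omega>(1)]
    proof (intro conjI exI)
      show "(\<lambda>x. ?I x * U k x) \<in> borel_measurable lebesgue" unfolding U_def using \<phi>m Vm by measurable
      show "AE x in lebesgue. x \<in> \<Omega> \<longrightarrow> \<bar>U k x\<bar> \<le> T k"
        using U\<theta>[of k] by eventually_elim (use V(2) in auto)
    qed
    ultimately show "U k \<in> admissible p \<Omega> \<phi> H \<inter> Linf \<Omega>" by blast
  next
    have W1: "U k \<in> W1p p \<Omega>" for k
      unfolding W1p_def using wU[of k] sumL[OF V(1), of k] by (auto simp: U_def[abs_def])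
    have W2: "u \<in> W1p p \<Omega>" unfolding W1p_def using wu uL sumL(2)[OF W] by blast
    \<comment> \<open>The boundary datum cancels, and what remains vanishes off
      \<open>\<Omega>\<close>, so the norm on \<open>\<Omega>\<close> consists of the whole-space
      integrals already estimated.\<close>
    have norm: "W1p_norm p \<Omega> (\<lambda>x. U k x - u x)
        = (Lp_int p (\<lambda>x. V k x - vt x) + Lp_int p (\<lambda>x. gV k x - gt x)) powr (1 / p)" for k
    proof -
      have "(\<lambda>x. ?I x *\<^sub>R (U k x - u x)) = (\<lambda>x. V k x - vt x)"
        "(\<lambda>x. ?I x *\<^sub>R ((g\<phi> x + gV k x) - (g\<phi> x + gt x))) = (\<lambda>x. gV k x - gt x)"
        using uvt W0D(3,4)[OF V(1)[of k]] W0D(3,4)[OF W] by (auto simp: fun_eq_iff U_def indicator_def)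
      then show ?thesis
        using W1p_norm_eq[OF \<Omega>(1) has_weak_gradient_diff[OF \<Omega>(1) wU wu], of p k] by simp
    qed
    have "(\<lambda>k. (Lp_int p (\<lambda>x. V k x - vt x) + Lp_int p (\<lambda>x. gV k x - gt x)) powr (1 / p)) \<longlonglongrightarrow> 0 powr (1 / p)"
    proof (rule tendsto_powr')
      have l: "(\<lambda>k. Lp_int p (\<lambda>x. V k x - vt x)) \<longlonglongrightarrow> 0" "(\<lambda>k. Lp_int p (\<lambda>x. gV k x - gt x)) \<longlonglongrightarrow> 0"
        by (rule Lim_null_comparison[OF _ LIMSEQ_inverse_real_of_nat];
            use V(3,4) in \<open>simp add: Lp_int_nonneg less_imp_le del: of_nat_Suc\<close>)+
      show "(\<lambda>k. Lp_int p (\<lambda>x. V k x - vt x) + Lp_int p (\<lambda>x. gV k x - gt x)) \<longlonglongrightarrow> 0"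
        using tendsto_add[OF l] by simp
    qed (use p0 in \<open>auto simp: Lp_int_nonneg add_nonneg_nonneg\<close>)
    then show "W1p_tendsto p \<Omega> U u"
      unfolding W1p_tendsto_def norm using W1 W2 by simp
  next
    have AEd: "AE x in lebesgue. ?I x * \<bar>lagrangian_along \<Omega> H (U k) x - lagrangian_along \<Omega> H u x\<bar>
        = ?I x * \<bar>H (\<theta> x + V k x, g\<phi> x + gV k x) - H (\<theta> x + vt x, g\<phi> x + gt x)\<bar>" for k
      using Lag_U[of k] Lag_u by eventually_elim (auto simp: indicator_def)
    have eq: "(LINT x|lebesgue_on \<Omega>. \<bar>lagrangian_along \<Omega> H (U k) x - lagrangian_along \<Omega> H u x\<bar>)
        = (LINT x|lebesgue. ?I x * \<bar>H (\<theta> x + V k x, g\<phi> x + gV k x) - H (\<theta> x + vt x, g\<phi> x + gt x)\<bar>)" for k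
      unfolding lebesgue_on_integral_open(2)[OF \<Omega>(1)]
    proof (rule integral_cong_AE[OF _ _ AEd])
      have ab: "?I x * \<bar>a - b\<bar> = \<bar>?I x * a - ?I x * b\<bar>" for a b x by (simp add: right_diff_distrib[symmetric] abs_mult)
      show "(\<lambda>x. ?I x * \<bar>lagrangian_along \<Omega> H (U k) x - lagrangian_along \<Omega> H u x\<bar>) \<in> borel_measurable lebesgue"
        unfolding ab using Lag_Um[of k] Lag_um by (intro borel_measurable_abs borel_measurable_diff)
      show "(\<lambda>x. ?I x * \<bar>H (\<theta> x + V k x, g\<phi> x + gV k x) - H (\<theta> x + vt x, g\<phi> x + gt x)\<bar>) \<in> borel_measurable lebesgue"
        unfolding ab by (intro borel_measurable_abs borel_measurable_diff pair_meas V(1) W)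
    qed
    have lim: "(\<lambda>k. LINT x|lebesgue. ?I x * \<bar>H (\<theta> x + V k x, g\<phi> x + gV k x) - H (\<theta> x + vt x, g\<phi> x + gt x)\<bar>) \<longlonglongrightarrow> 0"
    proof (rule Lim_null_comparison[OF _ LIMSEQ_inverse_real_of_nat], rule always_eventually, rule allI)
      fix k
      have "0 \<le> (LINT x|lebesgue. ?I x * \<bar>H (\<theta> x + V k x, g\<phi> x + gV k x) - H (\<theta> x + vt x, g\<phi> x + gt x)\<bar>)"
        by (intro integral_nonneg_AE AE_I2) simp
      then show "norm (LINT x|lebesgue. ?I x * \<bar>H (\<theta> x + V k x, g\<phi> x + gV k x) - H (\<theta> x + vt x, g\<phi> x + gt x)\<bar>) \<le> inverse (real (Suc k))"
        using V(6)[of k] by simp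
    qed
    show "L1_tendsto \<Omega> (\<lambda>k. lagrangian_along \<Omega> H (U k)) (lagrangian_along \<Omega> H u)"
      unfolding L1_tendsto_def eq using lim Lag_UI Lag_uI by (simp add: lebesgue_on_integral_open(1)[OF \<Omega>(1)])
  qed
qed

end
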